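(* The Acyclic Matching problem remains NP-hard when the input graph is restricted to planar line graphs with maximum degree $4$.
   Context: All graphs are finite and simple. A graph $G$ is a line graph if $G=L(H)$ for some graph $H$, where $L(H)$ has the edges of $H$ as vertices, two adjacent iff they share an endpoint in $H$. A matching $M$ (set of pairwise nonadjacent edges) is acyclic if the subgraph induced on the endpoints of the edges of $M$ is acyclic. The Acyclic Matching problem: given a graph $G$ and a positive integer $k$, decide whether $G$ has an acyclic matching of size $k$. *)

theory Defs
  imports "HOL-Analysis.Analysis" "HOL-Computational_Algebra.Polynomial"
begin

section \<open>Finite simple graphs\<close>

record 'a ugraph =
  verts :: "'a set"
  edges :: "'a set set"

definition simple_graph :: "'a ugraph \<Rightarrow> bool" where
  "simple_graph G \<longleftrightarrow>
     finite (verts G) \<and> (\<forall>e \<in> edges G. e \<subseteq> verts G \<and> card e = 2)"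

definition degree_of :: "'a ugraph \<Rightarrow> 'a \<Rightarrow> nat" where
  "degree_of G v = card {e \<in> edges G. v \<in> e}"

text \<open>The maximum degree of the graph without vertices is taken to be 0.\<close>

definition max_degree :: "'a ugraph \<Rightarrow> nat" where
  "max_degree G = Max (insert 0 (degree_of G ` verts G))"

definition graph_iso :: "'a ugraph \<Rightarrow> 'b ugraph \<Rightarrow> bool" where
  "graph_iso G H \<longleftrightarrow>
     (\<exists>f. bij_betw f (verts G) (verts H) \<and>
          (\<forall>u \<in> verts G. \<forall>v \<in> verts G. {u, v} \<in> edges G \<longleftrightarrow> {f u, f v} \<in> edges H))"

definition line_graph :: "'a ugraph \<Rightarrow> 'a set ugraph" where
  "line_graph H =
     \<lparr>verts = edges H,
      edges = {{e, f} | e f. e \<in> edges H \<and> f \<in> edges H \<and> e \<noteq> f \<and> e \<inter> f \<noteq> {}}\<rparr>"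

text \<open>Every finite graph has an isomorphic copy with vertices in \<^typ>\<open>nat\<close>, so it is no
  restriction to take the root graph over \<^typ>\<open>nat\<close>.\<close>

definition is_line_graph :: "'a ugraph \<Rightarrow> bool" where
  "is_line_graph G \<longleftrightarrow> (\<exists>H :: nat ugraph. simple_graph H \<and> graph_iso G (line_graph H))"

text \<open>A planar drawing places the vertices at distinct points \<open>pos v\<close> and draws every edge
  \<open>e\<close> as a simple arc \<open>\<gamma> e\<close> joining its two endpoints. Arcs pass through no other vertex
  and meet each other only in vertices.\<close>

definition planar :: "'a ugraph \<Rightarrow> bool" where
  "planar G \<longleftrightarrow>
     (\<exists>(pos :: 'a \<Rightarrow> complex) (\<gamma> :: 'a set \<Rightarrow> real \<Rightarrow> complex).
        inj_on pos (verts G) \<and>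
        (\<forall>e \<in> edges G. arc (\<gamma> e) \<and>
           {pathstart (\<gamma> e), pathfinish (\<gamma> e)} = pos ` e \<and>
           path_image (\<gamma> e) \<inter> pos ` verts G = pos ` e) \<and>
        (\<forall>e \<in> edges G. \<forall>f \<in> edges G. e \<noteq> f \<longrightarrow>
           path_image (\<gamma> e) \<inter> path_image (\<gamma> f) \<subseteq> pos ` verts G))"

definition is_cycle :: "'a ugraph \<Rightarrow> 'a list \<Rightarrow> bool" where
  "is_cycle G vs \<longleftrightarrow>
     length vs \<ge> 3 \<and> distinct vs \<and> set vs \<subseteq> verts G \<and>
     (\<forall>i < length vs. {vs ! i, vs ! (Suc i mod length vs)} \<in> edges G)"

definition acyclic_graph :: "'a ugraph \<Rightarrow> bool" where
  "acyclic_graph G \<longleftrightarrow> (\<nexists>vs. is_cycle G vs)"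

definition induced_subgraph :: "'a ugraph \<Rightarrow> 'a set \<Rightarrow> 'a ugraph" where
  "induced_subgraph G S = \<lparr>verts = verts G \<inter> S, edges = {e \<in> edges G. e \<subseteq> S}\<rparr>"

definition matching :: "'a ugraph \<Rightarrow> 'a set set \<Rightarrow> bool" where
  "matching G M \<longleftrightarrow> M \<subseteq> edges G \<and> (\<forall>e \<in> M. \<forall>f \<in> M. e \<noteq> f \<longrightarrow> e \<inter> f = {})"

definition acyclic_matching :: "'a ugraph \<Rightarrow> 'a set set \<Rightarrow> bool" where
  "acyclic_matching G M \<longleftrightarrow> matching G M \<and> acyclic_graph (induced_subgraph G (\<Union>M))"


section \<open>Turing machines\<close>

text \<open>Nondeterministic multi-tape machines with two-way infinite tapes. States and symbols are
  initial segments of \<^typ>\<open>nat\<close>; state 0 is initial and state 1 is accepting; symbol 0 is the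
  blank, symbols 1 and 2 stand for the input bits \<^const>\<open>False\<close> and \<^const>\<open>True\<close>. A transition
  \<open>(q, rs, q', as)\<close> applies in state \<open>q\<close> when the heads read \<open>rs\<close>; it changes to state \<open>q'\<close>
  and, on each tape, writes a symbol and moves the head by -1, 0 or 1. A machine halts when no
  transition applies.\<close>

record tm =
  num_tapes :: nat
  num_symbols :: nat
  num_states :: nat
  transitions :: "(nat \<times> nat list \<times> nat \<times> (nat \<times> int) list) set"

definition wf_tm :: "tm \<Rightarrow> bool" where
  "wf_tm M \<longleftrightarrow>
     num_tapes M \<ge> 1 \<and> num_symbols M \<ge> 3 \<and> num_states M \<ge> 2 \<and>
     (\<forall>(q, rs, q', as) \<in> transitions M.
        q < num_states M \<and> q' < num_states M \<and>
        length rs = num_tapes M \<and> (\<forall>s \<in> set rs. s < num_symbols M) \<and>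
        length as = num_tapes M \<and>
        (\<forall>(s, d) \<in> set as. s < num_symbols M \<and> d \<in> {-1, 0, 1}))"

definition deterministic :: "tm \<Rightarrow> bool" where
  "deterministic M \<longleftrightarrow>
     (\<forall>q rs q1 as1 q2 as2.
        (q, rs, q1, as1) \<in> transitions M \<longrightarrow> (q, rs, q2, as2) \<in> transitions M \<longrightarrow>
        q1 = q2 \<and> as1 = as2)"

text \<open>A tape consists of its contents and the position of its head.\<close>

type_synonym tape = "(int \<Rightarrow> nat) \<times> int"
type_synonym config = "nat \<times> tape list"

definition read_tape :: "tape \<Rightarrow> nat" where
  "read_tape t = fst t (snd t)"

definition act_tape :: "nat \<times> int \<Rightarrow> tape \<Rightarrow> tape" where
  "act_tape a t = ((fst t)(snd t := fst a), snd t + snd a)"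

definition tm_step :: "tm \<Rightarrow> config \<Rightarrow> config \<Rightarrow> bool" where
  "tm_step M c c' \<longleftrightarrow>
     (\<exists>as. (fst c, map read_tape (snd c), fst c', as) \<in> transitions M \<and>
           snd c' = map2 act_tape as (snd c))"

definition halted :: "tm \<Rightarrow> config \<Rightarrow> bool" where
  "halted M c \<longleftrightarrow> (\<nexists>c'. tm_step M c c')"

definition word_contents :: "bool list \<Rightarrow> int \<Rightarrow> nat" where
  "word_contents w i =
     (if 0 \<le> i \<and> i < int (length w) then (if w ! nat i then 2 else 1) else 0)"

definition init_config :: "tm \<Rightarrow> bool list \<Rightarrow> config" where
  "init_config M w =
     (0, (word_contents w, 0) # replicate (num_tapes M - 1) (word_contents [], 0))"


section \<open>NP-hardness\<close>

definition NP :: "bool list set set" where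
  "NP = {L. \<exists>M (p :: nat poly). wf_tm M \<and>
          (\<forall>w t c. (tm_step M ^^ t) (init_config M w) c \<longrightarrow> t \<le> poly p (length w)) \<and>
          (\<forall>w. w \<in> L \<longleftrightarrow>
             (\<exists>t c. (tm_step M ^^ t) (init_config M w) c \<and> halted M c \<and> fst c = 1))}"

text \<open>The input is given on the first tape, the output is left on the last one.\<close>

definition polytime_computable :: "(bool list \<Rightarrow> bool list) \<Rightarrow> bool" where
  "polytime_computable f \<longleftrightarrow>
     (\<exists>M (p :: nat poly). wf_tm M \<and> deterministic M \<and>
        (\<forall>w. \<exists>t c. t \<le> poly p (length w) \<and> (tm_step M ^^ t) (init_config M w) c \<and>
               halted M c \<and> fst (last (snd c)) = word_contents (f w)))"

text \<open>A decision problem has a set \<open>I\<close> of admissible instances, a predicate \<open>yes\<close> and an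
  encoding \<open>enc\<close> of instances as words. A many-one reduction to it must produce an admissible
  instance on every input, so a restriction of the instances is a restriction on reductions.\<close>

definition NP_hard :: "('i \<Rightarrow> bool list) \<Rightarrow> 'i set \<Rightarrow> ('i \<Rightarrow> bool) \<Rightarrow> bool" where
  "NP_hard enc I yes \<longleftrightarrow>
     (\<forall>L \<in> NP. \<exists>f. polytime_computable f \<and>
        (\<forall>w. \<exists>i \<in> I. f w = enc i \<and> (w \<in> L \<longleftrightarrow> yes i)))"


section \<open>The Acyclic Matching problem\<close>

definition acyclic_matching_instances :: "(nat ugraph \<times> nat) set" where
  "acyclic_matching_instances =
     {(G, k). simple_graph G \<and> (\<exists>n. verts G = {..<n}) \<and> k > 0}"

definition has_acyclic_matching :: "nat ugraph \<times> nat \<Rightarrow> bool" where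
  "has_acyclic_matching = (\<lambda>(G, k). \<exists>M. acyclic_matching G M \<and> card M = k)"

text \<open>Binary digits, least significant first.\<close>

fun binary :: "nat \<Rightarrow> bool list" where
  "binary k = (if k = 0 then [] else odd k # binary (k div 2))"

declare binary.simps [simp del]

text \<open>The number of vertices in unary, a separator, the adjacency matrix row by row, and \<open>k\<close>
  in binary.\<close>

definition encode_instance :: "nat ugraph \<times> nat \<Rightarrow> bool list" where
  "encode_instance = (\<lambda>(G, k). let n = card (verts G) in
     replicate n True @ [False] @
     concat (map (\<lambda>i. map (\<lambda>j. {i, j} \<in> edges G) [0..<n]) [0..<n]) @
     binary k)"

lemma binary_inj: "binary k = binary l \<Longrightarrow> k = l"
proof (induction k arbitrary: l rule: less_induct)
  case (less k)
  show ?case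
  proof (cases "k = 0 \<or> l = 0")
    case True
    then show ?thesis using less.prems by (auto simp: binary.simps split: if_splits)
  next
    case False
    have "odd k = odd l" "binary (k div 2) = binary (l div 2)"
      using less.prems False binary.simps[of k] binary.simps[of l] by simp_all
    moreover have "k div 2 < k" using False by simp
    ultimately have "k div 2 = l div 2" "odd k = odd l" using less.IH by blast+
    then show ?thesis by presburger
  qed
qed

lemma concat_map_eq:
  assumes "concat (map (\<lambda>i. map (f i) ys) xs) = concat (map (\<lambda>i. map (g i) ys) xs)"
    and "i \<in> set xs" and "j \<in> set ys"
  shows "f i j = g i j"
  using assms by (induction xs) auto

lemma inj_on_encode_instance: "inj_on encode_instance acyclic_matching_instances"
proof (rule inj_onI, clarify)
  fix G H :: "nat ugraph" and k l
  assume G: "(G, k) \<in> acyclic_matching_instances" and H: "(H, l) \<in> acyclic_matching_instances"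
    and eq: "encode_instance (G, k) = encode_instance (H, l)"
  obtain n m where n: "verts G = {..<n}" and m: "verts H = {..<m}"
    using G H by (auto simp: acyclic_matching_instances_def)
  have tw: "takeWhile id (replicate a True @ [False] @ xs) = replicate a True" for a xs
    by (induction a) auto
  have "takeWhile id (encode_instance (G, k)) = replicate n True"
    unfolding encode_instance_def by (simp only: Let_def case_prod_conv n card_lessThan tw)
  moreover have "takeWhile id (encode_instance (H, l)) = replicate m True"
    unfolding encode_instance_def by (simp only: Let_def case_prod_conv m card_lessThan tw)
  ultimately have nm: "n = m" using eq by (metis length_replicate)
  define A where "A G = concat (map (\<lambda>i. map (\<lambda>j. {i, j} \<in> edges G) [0..<n]) [0..<n])"
    for G :: "nat ugraph"
  have len: "length (A G) = length (A H)"
    unfolding A_def by (simp add: length_concat comp_def)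
  have "A G @ binary k = A H @ binary l"
    using eq unfolding encode_instance_def A_def by (simp add: n m nm)
  then have "A G = A H" and "binary k = binary l" using len by auto
  have adj: "{i, j} \<in> edges G \<longleftrightarrow> {i, j} \<in> edges H" if "i < n" "j < n" for i j
    using concat_map_eq[OF \<open>A G = A H\<close>[unfolded A_def], of i j] that by simp
  have e: "\<exists>i j. e = {i, j} \<and> i < n \<and> j < n" if "e \<in> edges G \<or> e \<in> edges H" for e
  proof -
    have "card e = 2" "e \<subseteq> {..<n}"
      using that G H n m nm by (auto simp: acyclic_matching_instances_def simple_graph_def)
    then show ?thesis by (auto simp: card_2_iff)
  qed
  have "edges G = edges H" using adj e by blast
  then show "G = H \<and> k = l" using n m nm binary_inj[OF \<open>binary k = binary l\<close>] by simp
qed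

end

theory Submission imports Defs "HOL-Combinatorics.Transposition" begin

text \<open>The graphs of the reduction are line graphs of subcubic subgraphs of the square lattice. An
  acyclic matching of largest conceivable size in such a graph consists of paths of the lattice
  graph that pass through every point of degree at least two and end in every point of degree one,
  and the pairs of edges that are matched along a path are all centred at points of the same
  colour of the lattice. So every path carries a bit. With two gadgets, found by computer search,
  these bits are combined to a crossbar of row and column wires that solves an exact cover
  problem, and the tableau of a nondeterministic machine is an exact cover problem in which every
  constraint concerns only neighbouring tiles.\<close>

section \<open>Runs of nondeterministic machines as exact covers\<close>

type_synonym transition = "nat \<times> nat list \<times> nat \<times> (nat \<times> int) list"

text \<open>A halted machine in the accepting state may idle, so that acceptance becomes the existence of a
  long run.\<close>

definition idling :: "tm \<Rightarrow> transition set" where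
  "idling M = {(1, rs, 1, map (\<lambda>s. (s, 0)) rs) | rs. length rs = num_tapes M \<and>
     (\<forall>s\<in>set rs. s < num_symbols M) \<and> (\<forall>q' as. (1, rs, q', as) \<notin> transitions M)}"

definition patient :: "tm \<Rightarrow> tm" where
  "patient M = M\<lparr>transitions := transitions M \<union> idling M\<rparr>"

definition wf_config :: "tm \<Rightarrow> config \<Rightarrow> bool" where
  "wf_config M c \<longleftrightarrow> length (snd c) = num_tapes M \<and> (\<forall>t\<in>set (snd c). \<forall>i. fst t i < num_symbols M)"

definition heads_within :: "nat \<Rightarrow> config \<Rightarrow> bool" where
  "heads_within U c \<longleftrightarrow> (\<forall>j<length (snd c). \<bar>snd (snd c ! j)\<bar> \<le> int U)"

definition accepts :: "tm \<Rightarrow> bool list \<Rightarrow> bool" where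
  "accepts M w \<longleftrightarrow> (\<exists>t c. (tm_step M ^^ t) (init_config M w) c \<and> halted M c \<and> fst c = 1)"

definition endless_run :: "tm \<Rightarrow> bool list \<Rightarrow> nat \<Rightarrow> (nat \<Rightarrow> config) \<Rightarrow> bool" where
  "endless_run M w U f \<longleftrightarrow> f 0 = init_config M w \<and> (\<forall>i. tm_step (patient M) (f i) (f (Suc i))) \<and>
     (\<forall>i. wf_config M (f i) \<and> heads_within U (f i))"

lemma patient_simps [simp]: "num_tapes (patient M) = num_tapes M" "num_symbols (patient M) = num_symbols M"
  "num_states (patient M) = num_states M" "transitions (patient M) = transitions M \<union> idling M"
  by (simp_all add: patient_def)

lemma wf_patient: "wf_tm M \<Longrightarrow> wf_tm (patient M)"
  by (auto simp: wf_tm_def idling_def)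

lemma wf_tmD:
  assumes "wf_tm M" "(q, rs, q', as) \<in> transitions M"
  shows "q < num_states M" "q' < num_states M" "length rs = num_tapes M" "\<forall>s\<in>set rs. s < num_symbols M"
    "length as = num_tapes M" "\<forall>a\<in>set as. fst a < num_symbols M \<and> snd a \<in> {-1, 0, 1}"
  using assms unfolding wf_tm_def case_prod_unfold by fastforce+

lemma wf_config_init: "wf_tm M \<Longrightarrow> wf_config M (init_config M w)"
  by (auto simp: wf_config_def init_config_def word_contents_def wf_tm_def)

lemma wf_config_step:
  assumes M: "wf_tm M" and c: "wf_config M c" and st: "tm_step M c c'"
  shows "wf_config M c'" "\<And>j. j < num_tapes M \<Longrightarrow> \<bar>snd (snd c' ! j) - snd (snd c ! j)\<bar> \<le> 1"
proof -
  obtain as where as: "(fst c, map read_tape (snd c), fst c', as) \<in> transitions M"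
    and c': "snd c' = map2 act_tape as (snd c)" using st by (auto simp: tm_step_def)
  note w = wf_tmD[OF M as]
  have len: "length (snd c) = num_tapes M" using c by (simp add: wf_config_def)
  have nth: "snd c' ! j = act_tape (as ! j) (snd c ! j)" if "j < num_tapes M" for j
    using that len w(5) by (simp add: c')
  have "fst (snd c' ! j) i < num_symbols M" if "j < num_tapes M" for j i
  proof -
    have "as ! j \<in> set as" "snd c ! j \<in> set (snd c)" using that w(5) len by simp_all
    then show ?thesis using w(6) c unfolding nth[OF that] wf_config_def act_tape_def by auto
  qed
  then show "wf_config M c'" unfolding wf_config_def all_set_conv_all_nth using len w(5) by (simp add: c')
  fix j assume j: "j < num_tapes M"
  have "as ! j \<in> set as" using j w(5) by simp
  then have "snd (as ! j) \<in> {-1, 0, 1}" using w(6) by blast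
  then show "\<bar>snd (snd c' ! j) - snd (snd c ! j)\<bar> \<le> 1" unfolding nth[OF j] act_tape_def by auto
qed

lemma run_invariant:
  assumes M: "wf_tm M" and run: "(tm_step M ^^ t) (init_config M w) c"
  shows "wf_config M c \<and> heads_within t c"
  using run
proof (induction t arbitrary: c)
  case 0
  then have c: "c = init_config M w" by simp
  have "snd (snd c ! j) = 0" if "j < length (snd c)" for j
    using that unfolding c init_config_def by (cases j) auto
  then show ?case using wf_config_init[OF M] c by (simp add: heads_within_def)
next
  case (Suc t)
  then obtain d where d: "(tm_step M ^^ t) (init_config M w) d" "tm_step M d c" by auto
  have wf_d: "wf_config M d" and heads_d: "heads_within t d" using Suc.IH[OF d(1)] by blast+
  have wf_c: "wf_config M c" by (rule wf_config_step(1)[OF M wf_d d(2)])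
  have "\<bar>snd (snd c ! j)\<bar> \<le> int (Suc t)" if j: "j < num_tapes M" for j
  proof -
    have "\<bar>snd (snd d ! j)\<bar> \<le> int t" using heads_d wf_d j by (simp add: heads_within_def wf_config_def)
    then show ?thesis using wf_config_step(2)[OF M wf_d d(2) j] by linarith
  qed
  then show ?case using wf_c by (simp add: heads_within_def wf_config_def)
qed

lemma step_patient: "tm_step M c c' \<Longrightarrow> tm_step (patient M) c c'"
  by (auto simp: tm_step_def)

lemma step_patientD:
  assumes "tm_step (patient M) c c'" "\<not> tm_step M c c'"
  shows "halted M c \<and> fst c = 1"
proof -
  obtain as where as: "(fst c, map read_tape (snd c), fst c', as) \<in> transitions M \<union> idling M"
    "snd c' = map2 act_tape as (snd c)" using assms(1) by (auto simp: tm_step_def)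
  then have "(fst c, map read_tape (snd c), fst c', as) \<in> idling M" using assms(2) by (auto simp: tm_step_def)
  then show ?thesis by (auto simp: idling_def halted_def tm_step_def)
qed

lemma idle_step:
  assumes "wf_config M c" "halted M c" "fst c = 1"
  shows "tm_step (patient M) c c"
proof -
  let ?rs = "map read_tape (snd c)"
  have len: "length ?rs = num_tapes M" using assms(1) by (simp add: wf_config_def)
  have "\<forall>s\<in>set ?rs. s < num_symbols M" using assms(1) by (auto simp: wf_config_def read_tape_def)
  moreover have "(1, ?rs, q', as) \<notin> transitions M" for q' as
  proof
    assume "(1, ?rs, q', as) \<in> transitions M"
    then have "tm_step M c (q', map2 act_tape as (snd c))" using assms(3) by (auto simp: tm_step_def)
    then show False using assms(2) by (auto simp: halted_def)
  qed
  ultimately have "(1, ?rs, 1, map (\<lambda>s. (s, 0)) ?rs) \<in> idling M" using len unfolding idling_def by blast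
  moreover have "map2 act_tape (map (\<lambda>s. (s, 0)) ?rs) (snd c) = snd c"
    by (rule nth_equalityI) (auto simp: act_tape_def read_tape_def)
  ultimately show ?thesis unfolding tm_step_def using assms(3) by (intro exI[of _ "map (\<lambda>s. (s, 0)) ?rs"]) simp
qed

lemma endless_run_if_accepts:
  assumes M: "wf_tm M" and bound: "\<And>t c. (tm_step M ^^ t) (init_config M w) c \<Longrightarrow> t < U"
    and acc: "accepts M w"
  shows "\<exists>f. endless_run M w U f"
proof -
  from acc obtain t c where c: "(tm_step M ^^ t) (init_config M w) c" "halted M c" "fst c = 1"
    unfolding accepts_def by blast
  obtain g where g: "g 0 = init_config M w" "g t = c" "\<And>i. i < t \<Longrightarrow> tm_step M (g i) (g (Suc i))"
    using c(1) unfolding relpowp_fun_conv by blast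
  define f where "f i = (if i \<le> t then g i else c)" for i
  have reached: "\<exists>u\<le>t. (tm_step M ^^ u) (init_config M w) (f i)" for i
  proof (cases "i \<le> t")
    case True
    then have "(tm_step M ^^ i) (init_config M w) (f i)"
      unfolding relpowp_fun_conv using g by (intro exI[of _ g]) (simp add: f_def)
    then show ?thesis using True by blast
  qed (use c(1) in \<open>auto simp: f_def\<close>)
  have "wf_config M (f i) \<and> heads_within U (f i)" for i
  proof -
    obtain u where "u \<le> t" "(tm_step M ^^ u) (init_config M w) (f i)" using reached by blast
    then have "u < U" "wf_config M (f i)" "heads_within u (f i)" using bound run_invariant[OF M] by blast+
    then show ?thesis by (fastforce simp: heads_within_def)
  qed
  moreover have "tm_step (patient M) (f i) (f (Suc i))" for i
  proof (cases "i < t")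
    case True
    then show ?thesis using g(3)[OF True] by (simp add: f_def step_patient)
  next
    case False
    then have "f i = c" "f (Suc i) = c" using g(2) by (auto simp: f_def)
    moreover have "wf_config M c" using run_invariant[OF M c(1)] by blast
    ultimately show ?thesis using idle_step c(2,3) by simp
  qed
  moreover have "f 0 = init_config M w" using g by (simp add: f_def)
  ultimately show ?thesis unfolding endless_run_def by blast
qed

lemma accepts_if_long_run:
  assumes bound: "\<And>t c. (tm_step M ^^ t) (init_config M w) c \<Longrightarrow> t < U"
    and run: "(tm_step (patient M) ^^ U) (init_config M w) c"
  shows "accepts M w"
proof -
  obtain f where f: "f 0 = init_config M w" "\<And>i. i < U \<Longrightarrow> tm_step (patient M) (f i) (f (Suc i))"
    using run unfolding relpowp_fun_conv by blast
  define idle where "idle i \<longleftrightarrow> i < U \<and> \<not> tm_step M (f i) (f (Suc i))" for i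
  have "\<exists>i. idle i"
  proof (rule ccontr)
    assume "\<nexists>i. idle i"
    then have "(tm_step M ^^ U) (init_config M w) (f U)"
      unfolding relpowp_fun_conv idle_def using f by (intro exI[of _ f]) blast
    then show False using bound by blast
  qed
  then obtain i where i: "idle i" and least: "\<And>j. j < i \<Longrightarrow> \<not> idle j"
    using exists_least_iff[of idle] by blast
  have "(tm_step M ^^ i) (init_config M w) (f i)"
    unfolding relpowp_fun_conv using f(1) least i by (intro exI[of _ f]) (auto simp: idle_def)
  then show ?thesis using step_patientD[OF f(2)] i unfolding idle_def accepts_def by blast
qed

subsection \<open>Tableaux as Wang tilings\<close>

text \<open>A cell of a configuration holds a symbol and possibly the head, for every tape.\<close>

record tile =
  action :: transition
  cell :: "(nat \<times> bool) list"
  left_heads :: "bool list"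
  right_heads :: "bool list"
  is_first :: bool
  is_last :: bool

definition left_colour :: "tile \<Rightarrow> (transition \<times> bool list \<times> bool list) option" where
  "left_colour T = (if is_first T then None else Some (action T, left_heads T, map snd (cell T)))"

definition right_colour :: "tile \<Rightarrow> (transition \<times> bool list \<times> bool list) option" where
  "right_colour T = (if is_last T then None else Some (action T, map snd (cell T), right_heads T))"

definition top_colour :: "tile \<Rightarrow> nat \<times> (nat \<times> bool) list \<times> bool \<times> bool" where
  "top_colour T = (fst (action T), cell T, is_first T, is_last T)"

definition updated_cell ::
  "(nat \<times> int) list \<Rightarrow> (nat \<times> bool) list \<Rightarrow> bool list \<Rightarrow> bool list \<Rightarrow> (nat \<times> bool) list" where
  "updated_cell as cs lh rh = map (\<lambda>j.
     (if snd (cs ! j) then fst (as ! j) else fst (cs ! j),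
      snd (cs ! j) \<and> snd (as ! j) = 0 \<or> lh ! j \<and> snd (as ! j) = 1 \<or> rh ! j \<and> snd (as ! j) = -1))
     [0..<length cs]"

definition bottom_colour :: "tile \<Rightarrow> nat \<times> (nat \<times> bool) list \<times> bool \<times> bool" where
  "bottom_colour T = (case action T of (q, rs, q', as) \<Rightarrow>
     (q', updated_cell as (cell T) (left_heads T) (right_heads T), is_first T, is_last T))"

definition tiles :: "tm \<Rightarrow> tile set" where
  "tiles M = {T. action T \<in> transitions (patient M) \<and>
     length (cell T) = num_tapes M \<and> length (left_heads T) = num_tapes M \<and> length (right_heads T) = num_tapes M \<and>
     (\<forall>c\<in>set (cell T). fst c < num_symbols M) \<and>
     (\<forall>j<num_tapes M. snd (cell T ! j) \<longrightarrow> fst (cell T ! j) = fst (snd (action T)) ! j) \<and>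
     (is_first T \<longrightarrow> left_heads T = replicate (num_tapes M) False) \<and>
     (is_last T \<longrightarrow> right_heads T = replicate (num_tapes M) False)}"

lemma finite_transitions:
  assumes M: "wf_tm M"
  shows "finite (transitions M)"
proof -
  let ?actions = "{as. set as \<subseteq> {..<num_symbols M} \<times> {-1, 0, 1 :: int} \<and> length as = num_tapes M}"
  let ?reads = "{rs. set rs \<subseteq> {..<num_symbols M} \<and> length rs = num_tapes M}"
  have "transitions M \<subseteq> {..<num_states M} \<times> ?reads \<times> {..<num_states M} \<times> ?actions"
  proof (clarify, intro conjI SigmaI)
    fix q rs q' as assume tr: "(q, rs, q', as) \<in> transitions M"
    note wf = wf_tmD[OF M tr]
    show "q \<in> {..<num_states M}" "q' \<in> {..<num_states M}" "rs \<in> ?reads" using wf by auto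
    show "as \<in> ?actions" using wf(5,6) by fastforce
  qed
  moreover have "finite ?actions" "finite ?reads" by (simp_all add: finite_lists_length_eq)
  ultimately show ?thesis by (meson finite_SigmaI finite_lessThan finite_subset)
qed

lemma finite_tiles:
  assumes M: "wf_tm M"
  shows "finite (tiles M)"
proof -
  let ?cells = "{cs. set cs \<subseteq> {..<num_symbols M} \<times> (UNIV :: bool set) \<and> length cs = num_tapes M}"
  let ?heads = "{bs. set bs \<subseteq> (UNIV :: bool set) \<and> length bs = num_tapes M}"
  let ?tuple = "\<lambda>T :: tile. (action T, cell T, left_heads T, right_heads T, is_first T, is_last T)"
  have "inj ?tuple" by (auto simp: inj_on_def intro: tile.equality)
  moreover have "?tuple ` tiles M \<subseteq>
      transitions (patient M) \<times> ?cells \<times> ?heads \<times> ?heads \<times> UNIV \<times> UNIV"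
    by (auto simp: tiles_def)
  moreover have "finite ?cells" "finite ?heads" by (simp_all only: finite_lists_length_eq finite_SigmaI finite_lessThan finite)
  moreover have "finite (transitions (patient M))" by (rule finite_transitions[OF wf_patient[OF M]])
  ultimately show ?thesis by (meson finite_SigmaI finite finite_subset finite_imageD inj_on_subset subset_UNIV)
qed

text \<open>A configuration is drawn as a row of cells; column \<open>s\<close> shows position \<open>s - U\<close> of the tapes.\<close>

definition cell_of :: "tm \<Rightarrow> nat \<Rightarrow> config \<Rightarrow> nat \<Rightarrow> (nat \<times> bool) list" where
  "cell_of M U c s =
     map (\<lambda>j. (fst (snd c ! j) (int s - int U), snd (snd c ! j) = int s - int U)) [0..<num_tapes M]"

definition heads_left_of :: "tm \<Rightarrow> nat \<Rightarrow> config \<Rightarrow> nat \<Rightarrow> bool list" where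
  "heads_left_of M U c s = map (\<lambda>j. s \<noteq> 0 \<and> snd (snd c ! j) = int s - 1 - int U) [0..<num_tapes M]"

definition heads_right_of :: "tm \<Rightarrow> nat \<Rightarrow> config \<Rightarrow> nat \<Rightarrow> bool list" where
  "heads_right_of M U c s = map (\<lambda>j. s \<noteq> 2 * U \<and> snd (snd c ! j) = int s + 1 - int U) [0..<num_tapes M]"

definition top_of :: "tm \<Rightarrow> nat \<Rightarrow> config \<Rightarrow> nat \<Rightarrow> nat \<times> (nat \<times> bool) list \<times> bool \<times> bool" where
  "top_of M U c s = (fst c, cell_of M U c s, s = 0, s = 2 * U)"

definition tile_of :: "tm \<Rightarrow> nat \<Rightarrow> config \<Rightarrow> nat \<Rightarrow> (nat \<times> int) list \<Rightarrow> nat \<Rightarrow> tile" where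
  "tile_of M U c q' as s = \<lparr>action = (fst c, map read_tape (snd c), q', as), cell = cell_of M U c s,
     left_heads = heads_left_of M U c s, right_heads = heads_right_of M U c s,
     is_first = (s = 0), is_last = (s = 2 * U)\<rparr>"

lemma init_config_patient [simp]: "init_config (patient M) w = init_config M w"
  by (simp add: init_config_def)

lemma wf_config_patient [simp]: "wf_config (patient M) c = wf_config M c"
  by (simp add: wf_config_def)

lemma length_cell_of [simp]: "length (cell_of M U c s) = num_tapes M"
  by (simp add: cell_of_def)

lemma top_colour_tile_of: "top_colour (tile_of M U c q' as s) = top_of M U c s"
  by (simp add: tile_of_def top_colour_def top_of_def)

lemma updated_cell_of:
  assumes M: "wf_tm M" and tr: "(q, rs, q', as) \<in> transitions (patient M)"
    and c: "wf_config M c" "heads_within U c" and s: "s \<le> 2 * U"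
  shows "updated_cell as (cell_of M U c s) (heads_left_of M U c s) (heads_right_of M U c s) =
    cell_of M U (q', map2 act_tape as (snd c)) s"
proof (rule nth_equalityI)
  fix j assume "j < length (updated_cell as (cell_of M U c s) (heads_left_of M U c s) (heads_right_of M U c s))"
  then have j: "j < num_tapes M" by (simp add: updated_cell_def)
  note wf = wf_tmD[OF wf_patient[OF M] tr]
  have len: "length (snd c) = num_tapes M" "length as = num_tapes M"
    using c wf(5) by (simp_all add: wf_config_def)
  have "as ! j \<in> set as" using j len by simp
  then have move: "snd (as ! j) = -1 \<or> snd (as ! j) = 0 \<or> snd (as ! j) = 1" using wf(6) by blast
  have near: "\<bar>snd (snd c ! j)\<bar> \<le> int U" using c j len by (simp add: heads_within_def)
  have head: "(snd (snd c ! j) = int s - int U \<and> snd (as ! j) = 0 \<or>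
      (s \<noteq> 0 \<and> snd (snd c ! j) = int s - 1 - int U) \<and> snd (as ! j) = 1 \<or>
      (s \<noteq> 2 * U \<and> snd (snd c ! j) = int s + 1 - int U) \<and> snd (as ! j) = -1) \<longleftrightarrow>
      snd (snd c ! j) + snd (as ! j) = int s - int U"
    using move near s by auto
  show "updated_cell as (cell_of M U c s) (heads_left_of M U c s) (heads_right_of M U c s) ! j =
      cell_of M U (q', map2 act_tape as (snd c)) s ! j"
    using j len head by (simp add: updated_cell_def cell_of_def heads_left_of_def heads_right_of_def act_tape_def)
qed (simp add: updated_cell_def)

lemma bottom_colour_tile_of:
  assumes "wf_tm M" "(fst c, map read_tape (snd c), q', as) \<in> transitions (patient M)"
    "wf_config M c" "heads_within U c" "s \<le> 2 * U"
  shows "bottom_colour (tile_of M U c q' as s) = top_of M U (q', map2 act_tape as (snd c)) s"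
  by (simp add: bottom_colour_def tile_of_def top_of_def updated_cell_of[OF assms])

lemma tile_of_in_tiles:
  assumes c: "wf_config M c" and tr: "(fst c, map read_tape (snd c), q', as) \<in> transitions (patient M)"
  shows "tile_of M U c q' as s \<in> tiles M"
proof -
  have len: "length (snd c) = num_tapes M" using c by (simp add: wf_config_def)
  have "\<forall>x\<in>set (cell_of M U c s). fst x < num_symbols M"
    using c len by (auto simp: cell_of_def wf_config_def)
  moreover have "snd (cell_of M U c s ! j) \<longrightarrow> fst (cell_of M U c s ! j) = map read_tape (snd c) ! j"
    if "j < num_tapes M" for j
    using that len by (simp add: cell_of_def read_tape_def)
  ultimately show ?thesis using tr
    by (simp add: tiles_def tile_of_def heads_left_of_def heads_right_of_def map_replicate_const)
qed

lemma right_colour_tile_of: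
  assumes "s < 2 * U"
  shows "right_colour (tile_of M U c q' as s) = left_colour (tile_of M U c q' as (Suc s))"
  using assms
  by (auto simp: right_colour_def left_colour_def tile_of_def cell_of_def heads_left_of_def heads_right_of_def
      algebra_simps)

definition strip_of :: "tm \<Rightarrow> nat \<Rightarrow> config \<Rightarrow> (nat \<Rightarrow> tile) \<Rightarrow> bool" where
  "strip_of M U c strip \<longleftrightarrow>
     (\<forall>s\<le>2 * U. strip s \<in> tiles M \<and> top_colour (strip s) = top_of M U c s) \<and>
     (\<forall>s<2 * U. right_colour (strip s) = left_colour (strip (Suc s)))"

lemma strip_of_components:
  assumes strip: "strip_of M U c strip" and s: "s \<le> 2 * U"
  shows "fst (action (strip s)) = fst c" "cell (strip s) = cell_of M U c s"
    "is_first (strip s) \<longleftrightarrow> s = 0" "is_last (strip s) \<longleftrightarrow> s = 2 * U"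
  using strip s by (simp_all add: strip_of_def top_colour_def top_of_def)

lemma strip_of_adjacent:
  assumes strip: "strip_of M U c strip" and s: "s < 2 * U"
  shows "action (strip (Suc s)) = action (strip s)"
    "left_heads (strip (Suc s)) = map snd (cell_of M U c s)"
    "right_heads (strip s) = map snd (cell_of M U c (Suc s))"
proof -
  have "right_colour (strip s) = left_colour (strip (Suc s))" using strip s by (simp add: strip_of_def)
  then show "action (strip (Suc s)) = action (strip s)"
    "left_heads (strip (Suc s)) = map snd (cell_of M U c s)"
    "right_heads (strip s) = map snd (cell_of M U c (Suc s))"
    using strip_of_components[OF strip, of s] strip_of_components[OF strip, of "Suc s"] s
    by (simp_all add: right_colour_def left_colour_def)
qed

lemma strip_of_heads:
  assumes strip: "strip_of M U c strip" and s: "s \<le> 2 * U"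
  shows "left_heads (strip s) = heads_left_of M U c s" "right_heads (strip s) = heads_right_of M U c s"
proof -
  have tile: "strip s \<in> tiles M" using strip s by (simp add: strip_of_def)
  show "left_heads (strip s) = heads_left_of M U c s"
  proof (cases s)
    case 0
    then show ?thesis using tile strip_of_components(3)[OF strip s]
      by (simp add: tiles_def heads_left_of_def map_replicate_const)
  next
    case (Suc r)
    then show ?thesis using strip_of_adjacent(2)[OF strip, of r] s by (simp add: cell_of_def heads_left_of_def)
  qed
  show "right_heads (strip s) = heads_right_of M U c s"
  proof (cases "s = 2 * U")
    case True
    then show ?thesis using tile strip_of_components(4)[OF strip s]
      by (simp add: tiles_def heads_right_of_def map_replicate_const)
  next
    case False
    then show ?thesis using strip_of_adjacent(3)[OF strip, of s] s
      by (simp add: cell_of_def heads_right_of_def algebra_simps)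
  qed
qed

lemma strip_of_eq_tile_of:
  assumes M: "wf_tm M" and strip: "strip_of M U c strip" and c: "wf_config M c" "heads_within U c"
  obtains q' as where "(fst c, map read_tape (snd c), q', as) \<in> transitions (patient M)"
    "\<And>s. s \<le> 2 * U \<Longrightarrow> strip s = tile_of M U c q' as s"
proof -
  have same_action: "action (strip s) = action (strip 0)" if "s \<le> 2 * U" for s
    using that by (induction s) (simp_all add: strip_of_adjacent(1)[OF strip])
  have tile: "strip s \<in> tiles M" if "s \<le> 2 * U" for s using strip that by (simp add: strip_of_def)
  obtain rs q' as where act: "action (strip 0) = (fst c, rs, q', as)"
    using strip_of_components(1)[OF strip, of 0] by (metis le0 prod.collapse)
  have tr: "(fst c, rs, q', as) \<in> transitions (patient M)" using tile[of 0] act by (simp add: tiles_def)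
  have reads: "rs = map read_tape (snd c)"
  proof (rule nth_equalityI)
    have len: "length (snd c) = num_tapes M" using c by (simp add: wf_config_def)
    then show lens: "length rs = length (map read_tape (snd c))"
      using wf_tmD(3)[OF wf_patient[OF M] tr] by simp
    fix j assume "j < length rs"
    then have j: "j < num_tapes M" using lens len by simp
    define s where "s = nat (snd (snd c ! j) + int U)"
    have "\<bar>snd (snd c ! j)\<bar> \<le> int U" using c j len by (simp add: heads_within_def)
    then have s: "s \<le> 2 * U" "int s - int U = snd (snd c ! j)" by (auto simp: s_def)
    then have "fst (cell (strip s) ! j) = rs ! j"
      using tile[OF s(1)] j act same_action[OF s(1)] strip_of_components(2)[OF strip s(1)]
      by (simp add: tiles_def cell_of_def)
    then show "rs ! j = map read_tape (snd c) ! j"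
      using j len s strip_of_components(2)[OF strip s(1)] by (simp add: cell_of_def read_tape_def)
  qed
  show ?thesis
  proof (rule that)
    show "(fst c, map read_tape (snd c), q', as) \<in> transitions (patient M)" using tr by (simp only: reads)
    show "strip s = tile_of M U c q' as s" if "s \<le> 2 * U" for s
      using same_action[OF that] act reads strip_of_components[OF strip that] strip_of_heads[OF strip that]
      by (intro tile.equality) (simp_all add: tile_of_def)
  qed
qed

definition row_length :: "nat \<Rightarrow> nat" where "row_length U = 2 * U + 1"

text \<open>The rows of a tableau are listed one after the other, and the positions of the list are counted
  from 1. What the input demands of a position in the first row depends on a bounded amount of
  information.\<close>

definition input_class :: "bool list \<Rightarrow> nat \<Rightarrow> nat \<Rightarrow> nat \<times> bool \<times> bool \<times> bool \<times> bool" where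
  "input_class w U b = (word_contents w (int b - int (U + 1)), b = U + 1, b = 1, b = row_length U, b \<le> row_length U)"

definition fits_input :: "tm \<Rightarrow> nat \<times> bool \<times> bool \<times> bool \<times> bool \<Rightarrow> tile \<Rightarrow> bool" where
  "fits_input M ic T \<longleftrightarrow> (case ic of (s, h, leftmost, rightmost, first_row) \<Rightarrow>
     first_row \<longrightarrow> top_colour T = (0, (s, h) # replicate (num_tapes M - 1) (0, h), leftmost, rightmost))"

lemma fits_input_first_row:
  assumes "wf_tm M" "s \<le> 2 * U"
  shows "fits_input M (input_class w U (Suc s)) T \<longleftrightarrow> top_colour T = top_of M U (init_config M w) s"
proof -
  have tapes: "1 \<le> num_tapes M" using assms by (simp add: wf_tm_def)
  have "cell_of M U (init_config M w) s =
      (word_contents w (int s - int U), s = U) # replicate (num_tapes M - 1) (0, s = U)"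
  proof (rule nth_equalityI)
    fix j assume "j < length (cell_of M U (init_config M w) s)"
    then have "j < num_tapes M" by simp
    then show "cell_of M U (init_config M w) s ! j =
        ((word_contents w (int s - int U), s = U) # replicate (num_tapes M - 1) (0, s = U)) ! j"
      by (cases j) (auto simp: cell_of_def init_config_def word_contents_def)
  qed (use tapes in simp)
  then show ?thesis using assms(2)
    by (simp add: fits_input_def input_class_def row_length_def top_of_def init_config_def)
qed

lemma run_if_tableau:
  assumes M: "wf_tm M"
    and tile: "\<And>t s. t \<le> U \<Longrightarrow> s \<le> 2 * U \<Longrightarrow> strip t s \<in> tiles M"
    and init: "\<And>s. s \<le> 2 * U \<Longrightarrow> top_colour (strip 0 s) = top_of M U (init_config M w) s"
    and horiz: "\<And>t s. t \<le> U \<Longrightarrow> s < 2 * U \<Longrightarrow> right_colour (strip t s) = left_colour (strip t (Suc s))"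
    and vert: "\<And>t s. t < U \<Longrightarrow> s \<le> 2 * U \<Longrightarrow> bottom_colour (strip t s) = top_colour (strip (Suc t) s)"
    and t: "t \<le> U"
  shows "\<exists>c. (tm_step (patient M) ^^ t) (init_config M w) c \<and>
    (\<forall>s\<le>2 * U. top_colour (strip t s) = top_of M U c s)"
  using t
proof (induction t)
  case 0
  then show ?case using init by auto
next
  case (Suc t)
  then obtain c where run: "(tm_step (patient M) ^^ t) (init_config M w) c"
    and top: "\<And>s. s \<le> 2 * U \<Longrightarrow> top_colour (strip t s) = top_of M U c s" by auto
  have t: "t < U" using Suc.prems by simp
  have "wf_config M c \<and> heads_within t c" using run_invariant[OF wf_patient[OF M], of t w c] run
    by (simp add: wf_config_patient)
  then have c: "wf_config M c" "heads_within U c" using t by (fastforce simp: heads_within_def)+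
  obtain q' as where tr: "(fst c, map read_tape (snd c), q', as) \<in> transitions (patient M)"
    and strip: "\<And>s. s \<le> 2 * U \<Longrightarrow> strip t s = tile_of M U c q' as s"
    using strip_of_eq_tile_of[OF M _ c, of "strip t"] tile top horiz t by (auto simp: strip_of_def)
  have "tm_step (patient M) c (q', map2 act_tape as (snd c))" using tr by (auto simp: tm_step_def)
  moreover have "top_colour (strip (Suc t) s) = top_of M U (q', map2 act_tape as (snd c)) s" if "s \<le> 2 * U" for s
    using vert[OF t that] bottom_colour_tile_of[OF M tr c that] by (simp add: strip[OF that])
  ultimately show ?case using relpowp_Suc_I[OF run] by blast
qed

definition listed_tableau :: "tm \<Rightarrow> bool list \<Rightarrow> nat \<Rightarrow> nat set \<Rightarrow> (nat \<Rightarrow> tile) \<Rightarrow> bool" where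
  "listed_tableau M w U B T \<longleftrightarrow>
     (\<forall>b\<in>B. T b \<in> tiles M \<and> fits_input M (input_class w U b) (T b)) \<and>
     (\<forall>b\<in>B. b + 1 \<in> B \<longrightarrow> right_colour (T b) = left_colour (T (b + 1))) \<and>
     (\<forall>b\<in>B. b + row_length U \<in> B \<longrightarrow> bottom_colour (T b) = top_colour (T (b + row_length U)))"

lemma row_major_Suc:
  fixes m S :: nat
  assumes "0 < S"
  shows "m mod S = S - 1 \<and> Suc m mod S = 0 \<or>
    m mod S < S - 1 \<and> Suc m mod S = Suc (m mod S) \<and> Suc m div S = m div S"
  using mod_less_divisor[OF assms, of m] by (auto simp: mod_Suc div_Suc)

lemma endless_run_tile_of:
  assumes M: "wf_tm M" and run: "endless_run M w U f"
  obtains as where "\<And>t s. tile_of M U (f t) (fst (f (Suc t))) (as t) s \<in> tiles M"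
    "\<And>t s. s \<le> 2 * U \<Longrightarrow>
      bottom_colour (tile_of M U (f t) (fst (f (Suc t))) (as t) s) = top_of M U (f (Suc t)) s"
proof -
  have "\<forall>t. \<exists>as. (fst (f t), map read_tape (snd (f t)), fst (f (Suc t)), as) \<in> transitions (patient M) \<and>
      snd (f (Suc t)) = map2 act_tape as (snd (f t))"
    using run unfolding endless_run_def tm_step_def by blast
  then obtain as where
    tr: "\<And>t. (fst (f t), map read_tape (snd (f t)), fst (f (Suc t)), as t) \<in> transitions (patient M)"
    and act: "\<And>t. snd (f (Suc t)) = map2 act_tape (as t) (snd (f t))" by metis
  have wf: "wf_config M (f t)" "heads_within U (f t)" for t using run by (auto simp: endless_run_def)
  show ?thesis
  proof
    show "tile_of M U (f t) (fst (f (Suc t))) (as t) s \<in> tiles M" for t s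
      by (rule tile_of_in_tiles[OF wf(1) tr])
    show "bottom_colour (tile_of M U (f t) (fst (f (Suc t))) (as t) s) = top_of M U (f (Suc t)) s"
      if "s \<le> 2 * U" for t s
      using bottom_colour_tile_of[OF M tr wf that] by (simp add: act[symmetric])
  qed
qed

lemma listed_tableau_if_endless_run:
  assumes M: "wf_tm M" and run: "endless_run M w U f"
  shows "\<exists>T. listed_tableau M w U {1..} T"
proof -
  let ?S = "row_length U"
  obtain as where tile: "\<And>t s. tile_of M U (f t) (fst (f (Suc t))) (as t) s \<in> tiles M"
    and bottom: "\<And>t s. s \<le> 2 * U \<Longrightarrow>
      bottom_colour (tile_of M U (f t) (fst (f (Suc t))) (as t) s) = top_of M U (f (Suc t)) s"
    using endless_run_tile_of[OF M run] by blast
  define strip where "strip t = tile_of M U (f t) (fst (f (Suc t))) (as t)" for t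
  define T where "T b = strip ((b - 1) div ?S) ((b - 1) mod ?S)" for b
  have S: "0 < ?S" and column: "m mod ?S \<le> 2 * U" for m
    using mod_less_divisor[of ?S m] by (simp_all add: row_length_def)
  have "fits_input M (input_class w U b) (T b)" if "1 \<le> b" for b
  proof (cases "b \<le> ?S")
    case True
    then have "(b - 1) div ?S = 0" "(b - 1) mod ?S = b - 1" "b - 1 \<le> 2 * U"
      using that by (simp_all add: row_length_def)
    then show ?thesis
      using fits_input_first_row[OF M, of "b - 1" U w "T b"] run that
      by (simp add: T_def strip_def top_colour_tile_of endless_run_def)
  qed (simp add: fits_input_def input_class_def)
  moreover have "right_colour (T b) = left_colour (T (b + 1))" if b: "1 \<le> b" for b
  proof -
    obtain m where m: "b = Suc m" using b by (cases b) auto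
    from row_major_Suc[OF S, of m] show ?thesis
    proof (elim disjE conjE)
      assume "m mod ?S = ?S - 1" "Suc m mod ?S = 0"
      then show ?thesis
        by (simp add: m T_def strip_def row_length_def right_colour_def left_colour_def tile_of_def)
    next
      assume "m mod ?S < ?S - 1" "Suc m mod ?S = Suc (m mod ?S)" "Suc m div ?S = m div ?S"
      then show ?thesis by (simp add: m T_def strip_def right_colour_tile_of row_length_def)
    qed
  qed
  moreover have "bottom_colour (T b) = top_colour (T (b + ?S))" if "1 \<le> b" for b
  proof -
    have shift: "b + ?S - 1 = (b - 1) + ?S" using that by simp
    have "(b + ?S - 1) div ?S = Suc ((b - 1) div ?S)" "(b + ?S - 1) mod ?S = (b - 1) mod ?S"
      unfolding shift using S by simp_all
    then show ?thesis
      unfolding T_def strip_def by (simp only: bottom[OF column] top_colour_tile_of)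
  qed
  moreover have "T b \<in> tiles M" for b by (simp add: T_def strip_def tile)
  ultimately show ?thesis unfolding listed_tableau_def by (intro exI[of _ T]) simp
qed

lemma run_if_listed_tableau:
  assumes M: "wf_tm M" and T: "listed_tableau M w U {1..row_length U * row_length U} T"
  shows "\<exists>c. (tm_step (patient M) ^^ U) (init_config M w) c"
proof -
  let ?S = "row_length U"
  have inside: "1 + t * ?S + s \<in> {1..?S * ?S}" if "t \<le> U" "s \<le> 2 * U" for t s
  proof -
    have "1 + t * ?S + s \<le> (t + 1) * ?S" using that by (simp add: row_length_def)
    also have "\<dots> \<le> ?S * ?S" using that by (intro mult_le_mono1) (simp add: row_length_def)
    finally show ?thesis by simp
  qed
  have "\<exists>c. (tm_step (patient M) ^^ U) (init_config M w) c \<and>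
      (\<forall>s\<le>2 * U. top_colour (T (1 + U * ?S + s)) = top_of M U c s)"
  proof (rule run_if_tableau[OF M, where strip = "\<lambda>t s. T (1 + t * ?S + s)"])
    show "T (1 + t * ?S + s) \<in> tiles M" if "t \<le> U" "s \<le> 2 * U" for t s
      using T inside[OF that] by (simp add: listed_tableau_def)
    show "top_colour (T (1 + 0 * ?S + s)) = top_of M U (init_config M w) s" if "s \<le> 2 * U" for s
    proof -
      have "fits_input M (input_class w U (1 + 0 * ?S + s)) (T (1 + 0 * ?S + s))"
        using T inside[of 0 s] that unfolding listed_tableau_def by blast
      then show ?thesis using fits_input_first_row[OF M that] by simp
    qed
    show "right_colour (T (1 + t * ?S + s)) = left_colour (T (1 + t * ?S + Suc s))" if "t \<le> U" "s < 2 * U" for t s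
      using T inside[of t s] inside[of t "Suc s"] that by (simp add: listed_tableau_def)
    show "bottom_colour (T (1 + t * ?S + s)) = top_colour (T (1 + Suc t * ?S + s))" if "t < U" "s \<le> 2 * U" for t s
    proof -
      have "1 + Suc t * ?S + s = 1 + t * ?S + s + ?S" by simp
      then show ?thesis using T inside[of t s] inside[of "Suc t" s] that
        unfolding listed_tableau_def by (metis Suc_leI less_imp_le)
    qed
  qed simp
  then show ?thesis by blast
qed

subsection \<open>Tilings as exact covers\<close>

definition count :: "nat \<Rightarrow> (nat \<Rightarrow> bool) \<Rightarrow> nat" where "count K P = card {a. a < K \<and> P a}"

text \<open>At every position \<open>b\<close> some of \<open>K\<close> objects are chosen. There are \<open>C\<close> constraints at every position,
  and exactly one object that is relevant to the constraint must be chosen at \<open>b\<close>, \<open>b + 1\<close> or \<open>b + S\<close>.\<close>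

definition exact_cover ::
  "nat \<Rightarrow> nat \<Rightarrow> nat \<Rightarrow> (nat \<Rightarrow> nat \<Rightarrow> nat \<Rightarrow> bool) \<Rightarrow> (nat \<Rightarrow> nat \<Rightarrow> bool) \<Rightarrow> (nat \<Rightarrow> nat \<Rightarrow> bool) \<Rightarrow>
   (nat \<Rightarrow> nat \<Rightarrow> bool) \<Rightarrow> bool" where
  "exact_cover K C S A0 A1 A2 x \<longleftrightarrow> (\<forall>b\<in>{1..S * S}. \<forall>t<C.
     count K (\<lambda>a. x b a \<and> A0 b t a) + count K (\<lambda>a. x (b + 1) a \<and> A1 t a) +
     count K (\<lambda>a. x (b + S) a \<and> A2 t a) = 1)"

locale wang_tiles =
  fixes ts :: "'a list" and left right :: "'a \<Rightarrow> 'c" and upper lower :: "'a \<Rightarrow> 'd"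
    and fits :: "'i \<Rightarrow> 'a \<Rightarrow> bool"
begin

definition constraints :: "(('i \<Rightarrow> 'a \<Rightarrow> bool) \<times> ('a \<Rightarrow> bool) \<times> ('a \<Rightarrow> bool)) list" where
  "constraints = [(\<lambda>i T. True, \<lambda>T. False, \<lambda>T. False), (fits, \<lambda>T. False, \<lambda>T. False)] @
     map (\<lambda>c. (\<lambda>i T. right T = c, \<lambda>T. left T \<noteq> c, \<lambda>T. False)) (map right ts) @
     map (\<lambda>c. (\<lambda>i T. lower T = c, \<lambda>T. False, \<lambda>T. upper T \<noteq> c)) (map lower ts)"

definition relevant_here :: "'i \<Rightarrow> nat \<Rightarrow> nat \<Rightarrow> bool" where
  "relevant_here i t a \<longleftrightarrow> a < length ts \<and> fst (constraints ! t) i (ts ! a)"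

definition relevant_right :: "nat \<Rightarrow> nat \<Rightarrow> bool" where
  "relevant_right t a \<longleftrightarrow> a < length ts \<and> fst (snd (constraints ! t)) (ts ! a)"

definition relevant_below :: "nat \<Rightarrow> nat \<Rightarrow> bool" where
  "relevant_below t a \<longleftrightarrow> a < length ts \<and> snd (snd (constraints ! t)) (ts ! a)"

lemma all_constraints_iff:
  "(\<forall>t<length constraints.
      Q (fst (constraints ! t)) (fst (snd (constraints ! t))) (snd (snd (constraints ! t)))) \<longleftrightarrow>
   Q (\<lambda>i T. True) (\<lambda>T. False) (\<lambda>T. False) \<and> Q fits (\<lambda>T. False) (\<lambda>T. False) \<and>
   (\<forall>c\<in>right ` set ts. Q (\<lambda>i T. right T = c) (\<lambda>T. left T \<noteq> c) (\<lambda>T. False)) \<and>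
   (\<forall>c\<in>lower ` set ts. Q (\<lambda>i T. lower T = c) (\<lambda>T. False) (\<lambda>T. upper T \<noteq> c))"
proof -
  have "(\<forall>t<length constraints.
      Q (fst (constraints ! t)) (fst (snd (constraints ! t))) (snd (snd (constraints ! t)))) \<longleftrightarrow>
      (\<forall>r\<in>set constraints. Q (fst r) (fst (snd r)) (snd (snd r)))" by (simp add: all_set_conv_all_nth)
  then show ?thesis by (simp add: constraints_def ball_Un)
qed

text \<open>There is one object more than tiles, so that the number of objects is positive.\<close>

definition num_objects :: nat where "num_objects = Suc (length ts)"

lemma count_unique:
  assumes "i < length ts" "\<And>a. a < num_objects \<Longrightarrow> Q a \<and> a < length ts \<longleftrightarrow> a = i"
  shows "count num_objects (\<lambda>a. Q a \<and> a < length ts \<and> P (ts ! a)) = of_bool (P (ts ! i))"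
proof -
  have "{a. a < num_objects \<and> Q a \<and> a < length ts \<and> P (ts ! a)} = {a. a = i \<and> P (ts ! i)}"
    using assms(1) assms(2)[of i] assms(2) by (intro Collect_cong) (auto simp: num_objects_def less_Suc_eq)
  then show ?thesis by (simp add: count_def)
qed

lemma exact_cover_if_tiling:
  assumes tile: "\<And>b. 1 \<le> b \<Longrightarrow> T b \<in> set ts \<and> fits (ic b) (T b)"
    and match: "\<And>b. 1 \<le> b \<Longrightarrow> right (T b) = left (T (b + 1)) \<and> lower (T b) = upper (T (b + S))"
  shows "\<exists>x. exact_cover num_objects (length constraints) S (\<lambda>b. relevant_here (ic b)) relevant_right relevant_below x"
proof -
  have "\<forall>b. \<exists>a. 1 \<le> b \<longrightarrow> a < length ts \<and> ts ! a = T b" using tile by (metis in_set_conv_nth)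
  then obtain ix where ix: "\<And>b. 1 \<le> b \<Longrightarrow> ix b < length ts \<and> ts ! ix b = T b" by metis
  have count: "count num_objects (\<lambda>a. a = ix b \<and> a < length ts \<and> P (ts ! a)) = of_bool (P (T b))" if "1 \<le> b" for b P
  proof -
    have "count num_objects (\<lambda>a. a = ix b \<and> a < length ts \<and> P (ts ! a)) = of_bool (P (ts ! ix b))"
      by (rule count_unique) (use ix[OF that] in auto)
    then show ?thesis using ix[OF that] by simp
  qed
  have "exact_cover num_objects (length constraints) S (\<lambda>b. relevant_here (ic b)) relevant_right relevant_below (\<lambda>b a. a = ix b)"
    unfolding exact_cover_def
  proof
    fix b assume "b \<in> {1..S * S}"
    then have b: "1 \<le> b" "1 \<le> b + 1" "1 \<le> b + S" by simp_all
    have "\<forall>t<length constraints. of_bool (fst (constraints ! t) (ic b) (T b)) +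
        of_bool (fst (snd (constraints ! t)) (T (b + 1))) + of_bool (snd (snd (constraints ! t)) (T (b + S))) = (1 :: nat)"
      unfolding all_constraints_iff[of "\<lambda>P0 P1 P2. of_bool (P0 (ic b) (T b)) + of_bool (P1 (T (b + 1))) +
          of_bool (P2 (T (b + S))) = (1 :: nat)"]
      using tile[OF b(1)] match[OF b(1)] by auto
    then show "\<forall>t<length constraints. count num_objects (\<lambda>a. a = ix b \<and> relevant_here (ic b) t a) +
        count num_objects (\<lambda>a. a = ix (b + 1) \<and> relevant_right t a) +
        count num_objects (\<lambda>a. a = ix (b + S) \<and> relevant_below t a) = 1"
      unfolding relevant_here_def relevant_right_def relevant_below_def
        count[OF b(1)] count[OF b(2)] count[OF b(3)] .
  qed
  then show ?thesis by blast
qed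

definition chosen :: "(nat \<Rightarrow> nat \<Rightarrow> bool) \<Rightarrow> nat \<Rightarrow> ('a \<Rightarrow> bool) \<Rightarrow> nat" where
  "chosen x b P = count num_objects (\<lambda>a. x b a \<and> a < length ts \<and> P (ts ! a))"

lemma exact_cover_chosen:
  assumes x: "exact_cover num_objects (length constraints) S (\<lambda>b. relevant_here (ic b)) relevant_right relevant_below x"
    and b: "b \<in> {1..S * S}"
  shows "chosen x b (\<lambda>T. True) = 1" "chosen x b (fits (ic b)) = 1"
    "T \<in> set ts \<Longrightarrow> chosen x b (\<lambda>T'. right T' = right T) + chosen x (b + 1) (\<lambda>T'. left T' \<noteq> right T) = 1"
    "T \<in> set ts \<Longrightarrow> chosen x b (\<lambda>T'. lower T' = lower T) + chosen x (b + S) (\<lambda>T'. upper T' \<noteq> lower T) = 1"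
proof -
  have "\<forall>t<length constraints. chosen x b (fst (constraints ! t) (ic b)) +
      chosen x (b + 1) (fst (snd (constraints ! t))) + chosen x (b + S) (snd (snd (constraints ! t))) = 1"
    using x b by (simp add: exact_cover_def chosen_def relevant_here_def relevant_right_def relevant_below_def)
  note equations = this[unfolded all_constraints_iff[of "\<lambda>P0 P1 P2. chosen x b (P0 (ic b)) + chosen x (b + 1) P1 +
    chosen x (b + S) P2 = 1"]]
  have "chosen x b' (\<lambda>T. False) = 0" for b' by (simp add: chosen_def count_def)
  then show "chosen x b (\<lambda>T. True) = 1" "chosen x b (fits (ic b)) = 1"
    "T \<in> set ts \<Longrightarrow> chosen x b (\<lambda>T'. right T' = right T) + chosen x (b + 1) (\<lambda>T'. left T' \<noteq> right T) = 1"
    "T \<in> set ts \<Longrightarrow> chosen x b (\<lambda>T'. lower T' = lower T) + chosen x (b + S) (\<lambda>T'. upper T' \<noteq> lower T) = 1"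
    using equations by simp_all
qed

lemma chosen_unique_tile:
  assumes "chosen x b (\<lambda>T. True) = 1"
  shows "\<exists>T\<in>set ts. \<forall>P. chosen x b P = of_bool (P T)"
proof -
  obtain i where i: "{a. a < num_objects \<and> x b a \<and> a < length ts} = {i}"
    using assms by (auto simp: chosen_def count_def card_1_singleton_iff)
  then have "i < length ts" by blast
  have "chosen x b P = of_bool (P (ts ! i))" for P
    unfolding chosen_def by (rule count_unique[OF \<open>i < length ts\<close>]) (use i in blast)
  then show ?thesis using \<open>i < length ts\<close> by (intro bexI[of _ "ts ! i"]) simp_all
qed

lemma tiling_if_exact_cover:
  assumes x: "exact_cover num_objects (length constraints) S (\<lambda>b. relevant_here (ic b)) relevant_right relevant_below x"
  obtains T where "\<And>b. b \<in> {1..S * S} \<Longrightarrow> T b \<in> set ts \<and> fits (ic b) (T b)"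
    "\<And>b. b \<in> {1..S * S} \<Longrightarrow> b + 1 \<in> {1..S * S} \<Longrightarrow> right (T b) = left (T (b + 1))"
    "\<And>b. b \<in> {1..S * S} \<Longrightarrow> b + S \<in> {1..S * S} \<Longrightarrow> lower (T b) = upper (T (b + S))"
proof -
  note equations = exact_cover_chosen[OF x]
  have "\<forall>b. \<exists>T. b \<in> {1..S * S} \<longrightarrow> T \<in> set ts \<and> (\<forall>P. chosen x b P = of_bool (P T))"
    using chosen_unique_tile[OF equations(1)] by blast
  then obtain T where T: "\<And>b. b \<in> {1..S * S} \<Longrightarrow> T b \<in> set ts"
    and chosen: "\<And>b P. b \<in> {1..S * S} \<Longrightarrow> chosen x b P = of_bool (P (T b))" by metis
  show ?thesis
  proof
    show "T b \<in> set ts \<and> fits (ic b) (T b)" if "b \<in> {1..S * S}" for b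
      using equations(2)[OF that] T[OF that] by (simp add: chosen[OF that] del: One_nat_def)
    show "right (T b) = left (T (b + 1))" if "b \<in> {1..S * S}" "b + 1 \<in> {1..S * S}" for b
      using equations(3)[OF that(1) T[OF that(1)]] unfolding chosen[OF that(1)] chosen[OF that(2)] by simp
    show "lower (T b) = upper (T (b + S))" if "b \<in> {1..S * S}" "b + S \<in> {1..S * S}" for b
      using equations(4)[OF that(1) T[OF that(1)]] unfolding chosen[OF that(1)] chosen[OF that(2)] by simp
  qed
qed

end

theorem NP_exact_cover:
  assumes "L \<in> NP"
  obtains K C :: nat and A0 A1 A2 and p :: "nat poly"
  where "1 \<le> K" "1 \<le> C" "\<And>n. 1 \<le> poly p n"
    "\<And>w. w \<in> L \<longleftrightarrow> (\<exists>x. exact_cover K C (row_length (poly p (length w)))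
       (\<lambda>b. A0 (input_class w (poly p (length w)) b)) A1 A2 x)"
proof -
  obtain M p where M: "wf_tm M"
    and time: "\<And>w t c. (tm_step M ^^ t) (init_config M w) c \<Longrightarrow> t \<le> poly p (length w)"
    and L: "\<And>w. w \<in> L \<longleftrightarrow> accepts M w"
    using assms unfolding NP_def accepts_def by blast
  obtain ts where ts: "set ts = tiles M" using finite_list[OF finite_tiles[OF M]] by blast
  interpret wang_tiles ts left_colour right_colour top_colour bottom_colour "fits_input M" .
  show ?thesis
  proof
    show "1 \<le> num_objects" "1 \<le> length constraints" "1 \<le> poly (p + 1) n" for n
      by (simp_all add: num_objects_def constraints_def)
    fix w :: "bool list"
    define U where "U = poly (p + 1) (length w)"
    let ?cover = "exact_cover num_objects (length constraints) (row_length U)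
      (\<lambda>b. relevant_here (input_class w U b)) relevant_right relevant_below"
    have bound: "t < U" if "(tm_step M ^^ t) (init_config M w) c" for t c
      using time[OF that] by (simp add: U_def)
    have "accepts M w \<longleftrightarrow> (\<exists>x. ?cover x)"
    proof
      assume "accepts M w"
      then have "\<exists>f. endless_run M w U f" by (intro endless_run_if_accepts[OF M]) (rule bound)
      then obtain T where "listed_tableau M w U {1..} T"
        using listed_tableau_if_endless_run[OF M] by blast
      then show "\<exists>x. ?cover x"
        by (intro exact_cover_if_tiling[of T]) (simp_all add: listed_tableau_def ts)
    next
      assume "\<exists>x. ?cover x"
      then obtain T where "listed_tableau M w U {1..row_length U * row_length U} T"
        using tiling_if_exact_cover unfolding listed_tableau_def ts by metis
      then show "accepts M w"
        using run_if_listed_tableau[OF M] accepts_if_long_run bound by blast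
    qed
    then show "w \<in> L \<longleftrightarrow> (\<exists>x. exact_cover num_objects (length constraints) (row_length (poly (p + 1) (length w)))
        (\<lambda>b. relevant_here (input_class w (poly (p + 1) (length w)) b)) relevant_right relevant_below x)"
      unfolding L U_def .
  qed
qed

section \<open>Structured multi-tape programs\<close>

datatype com =
    Act nat "nat \<Rightarrow> nat \<times> int"
  | Seq com com
  | While nat nat com
  | Cond nat nat com com

inductive exec :: "com \<Rightarrow> tape list \<Rightarrow> nat \<Rightarrow> tape list \<Rightarrow> bool" where
  exec_Act: "i < length ts \<Longrightarrow>
     exec (Act i g) ts 1 (ts[i := act_tape (g (read_tape (ts ! i))) (ts ! i)])"
| exec_Seq: "exec c ts a us \<Longrightarrow> exec d us b vs \<Longrightarrow> exec (Seq c d) ts (Suc (a + b)) vs"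
| exec_While_stop: "i < length ts \<Longrightarrow> read_tape (ts ! i) = s \<Longrightarrow> exec (While i s c) ts 1 ts"
| exec_While_loop: "i < length ts \<Longrightarrow> read_tape (ts ! i) \<noteq> s \<Longrightarrow> exec c ts a us \<Longrightarrow>
     exec (While i s c) us b vs \<Longrightarrow> exec (While i s c) ts (Suc (a + b)) vs"
| exec_Cond: "i < length ts \<Longrightarrow> exec (if read_tape (ts ! i) = s then c else d) ts a us \<Longrightarrow>
     exec (Cond i s c d) ts (Suc a) us"

text \<open>The control states of the machine that runs a program are continuations, i.e. lists of
  programs still to be executed; only finitely many of them are reachable.\<close>

fun next_state :: "nat \<Rightarrow> com list \<Rightarrow> nat list \<Rightarrow> (com list \<times> (nat \<times> int) list) option" where
  "next_state n [] rs = None"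
| "next_state n (Act i g # k) rs =
     Some (k, map (\<lambda>j. if j = i then g (rs ! j) else (rs ! j, 0)) [0..<n])"
| "next_state n (Seq c d # k) rs = Some (c # d # k, map (\<lambda>j. (rs ! j, 0)) [0..<n])"
| "next_state n (While i s c # k) rs =
     Some (if rs ! i = s then k else c # While i s c # k, map (\<lambda>j. (rs ! j, 0)) [0..<n])"
| "next_state n (Cond i s c d # k) rs =
     Some ((if rs ! i = s then c else d) # k, map (\<lambda>j. (rs ! j, 0)) [0..<n])"

fun continuations :: "com \<Rightarrow> com list \<Rightarrow> com list set" where
  "continuations (Act i g) k = {Act i g # k}"
| "continuations (Seq c d) k =
     {Seq c d # k} \<union> continuations c (d # k) \<union> continuations d k"
| "continuations (While i s c) k =
     {While i s c # k} \<union> continuations c (While i s c # k)"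
| "continuations (Cond i s c d) k =
     {Cond i s c d # k} \<union> continuations c k \<union> continuations d k"

lemma finite_continuations: "finite (continuations c k)"
  by (induction c arbitrary: k) auto

lemma Cons_in_continuations: "c # k \<in> continuations c k"
  by (cases c) auto

lemma continuations_closed:
  "q \<in> continuations c k \<Longrightarrow> next_state n q rs = Some (q', as) \<Longrightarrow>
     q' \<in> insert k (continuations c k)"
proof (induction c arbitrary: k q)
  case (Seq c d)
  then show ?case
    using Seq.IH(1)[of q "d # k"] Seq.IH(2)[of q k] Cons_in_continuations[of c "d # k"] Cons_in_continuations[of d k]
    by auto
next
  case (While i s c)
  then show ?case
    using While.IH[of q "While i s c # k"] Cons_in_continuations[of c "While i s c # k"] by (auto split: if_splits)
next
  case (Cond i s c d)
  then show ?case
    using Cond.IH(1)[of q k] Cond.IH(2)[of q k] Cons_in_continuations[of c k] Cons_in_continuations[of d k]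
    by (auto split: if_splits)
qed auto

primrec wf_com :: "com \<Rightarrow> bool" where
  "wf_com (Act i g) \<longleftrightarrow> (\<forall>s<3. fst (g s) < 3 \<and> snd (g s) \<in> {-1, 0, 1})"
| "wf_com (Seq c d) \<longleftrightarrow> wf_com c \<and> wf_com d"
| "wf_com (While i s c) \<longleftrightarrow> wf_com c"
| "wf_com (Cond i s c d) \<longleftrightarrow> wf_com c \<and> wf_com d"

lemma continuations_wf:
  "q \<in> continuations c k \<Longrightarrow> wf_com c \<Longrightarrow> \<forall>d\<in>set k. wf_com d \<Longrightarrow> \<forall>d\<in>set q. wf_com d"
proof (induction c arbitrary: k)
  case (Seq c d)
  have "\<forall>e\<in>set (d # k). wf_com e" using Seq.prems by simp
  note IH = Seq.IH(1)[OF _ _ this] Seq.IH(2)[OF _ _ Seq.prems(3)]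
  from Seq.prems(1) consider "q = Seq c d # k" | "q \<in> continuations c (d # k)"
    | "q \<in> continuations d k" by auto
  then show ?case using Seq.prems(2,3) IH by cases simp_all
next
  case (While i s c)
  have "\<forall>e\<in>set (While i s c # k). wf_com e" using While.prems by simp
  note IH = While.IH[OF _ _ this]
  from While.prems(1) consider "q = While i s c # k" | "q \<in> continuations c (While i s c # k)" by auto
  then show ?case using While.prems(2,3) IH by cases simp_all
next
  case (Cond i s c d)
  note IH = Cond.IH(1)[OF _ _ Cond.prems(3)] Cond.IH(2)[OF _ _ Cond.prems(3)]
  from Cond.prems(1) consider "q = Cond i s c d # k" | "q \<in> continuations c k"
    | "q \<in> continuations d k" by auto
  then show ?case using Cond.prems(2,3) IH by cases simp_all
qed auto

definition ternary :: "nat \<Rightarrow> tape list \<Rightarrow> bool" where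
  "ternary n ts \<longleftrightarrow> length ts = n \<and> (\<forall>t\<in>set ts. \<forall>p. fst t p < 3)"

definition com_step :: "nat \<Rightarrow> com list \<times> tape list \<Rightarrow> com list \<times> tape list \<Rightarrow> bool" where
  "com_step n c c' \<longleftrightarrow> (\<exists>as. next_state n (fst c) (map read_tape (snd c)) = Some (fst c', as) \<and>
     snd c' = map2 act_tape as (snd c))"

lemma map2_act_tape_read:
  "length ts = n \<Longrightarrow> map2 act_tape (map (\<lambda>j. (map read_tape ts ! j, 0)) [0..<n]) ts = ts"
  by (rule nth_equalityI) (auto simp: act_tape_def read_tape_def)

lemma map2_act_tape_Act:
  "length ts = n \<Longrightarrow> i < n \<Longrightarrow>
   map2 act_tape (map (\<lambda>j. if j = i then g (map read_tape ts ! j) else (map read_tape ts ! j, 0))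
     [0..<n]) ts = ts[i := act_tape (g (read_tape (ts ! i))) (ts ! i)]"
  by (rule nth_equalityI) (auto simp: act_tape_def read_tape_def nth_list_update)

lemma exec_length: "exec c ts t us \<Longrightarrow> length us = length ts"
  by (induction rule: exec.induct) auto

lemma exec_com_step:
  "exec c ts t us \<Longrightarrow> length ts = n \<Longrightarrow> (com_step n ^^ t) (c # k, ts) (k, us)"
proof (induction arbitrary: k rule: exec.induct)
  case (exec_Act i ts g)
  then show ?case by (auto simp: com_step_def map2_act_tape_Act)
next
  case (exec_Seq c ts a us d b vs)
  have enter: "com_step n (Seq c d # k, ts) (c # d # k, ts)"
    using exec_Seq.prems by (auto simp: com_step_def map2_act_tape_read)
  have "(com_step n ^^ (a + b)) (c # d # k, ts) (k, vs)"
    using exec_Seq.IH exec_Seq.prems exec_length[OF exec_Seq.hyps(1)]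
    by (auto simp: relpowp_add)
  with enter show ?case by (rule relpowp_Suc_I2)
next
  case (exec_While_stop i ts s c)
  then show ?case by (auto simp: com_step_def map2_act_tape_read)
next
  case (exec_While_loop i ts s c a us b vs)
  have enter: "com_step n (While i s c # k, ts) (c # While i s c # k, ts)"
    using exec_While_loop.prems exec_While_loop.hyps
    by (auto simp: com_step_def map2_act_tape_read)
  have "(com_step n ^^ (a + b)) (c # While i s c # k, ts) (k, vs)"
    using exec_While_loop.IH exec_While_loop.prems exec_length[OF exec_While_loop.hyps(3)]
    by (auto simp: relpowp_add)
  with enter show ?case by (rule relpowp_Suc_I2)
next
  case (exec_Cond i ts s c d a us)
  have enter: "com_step n (Cond i s c d # k, ts) ((if read_tape (ts ! i) = s then c else d) # k, ts)"
    using exec_Cond.prems exec_Cond.hyps by (auto simp: com_step_def map2_act_tape_read)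
  show ?case by (rule relpowp_Suc_I2[OF enter exec_Cond.IH[OF exec_Cond.prems]])
qed

lemma next_state_actions:
  assumes next_q: "next_state n q rs = Some (q', as)" and wf: "\<forall>d\<in>set q. wf_com d"
    and rs: "length rs = n" "\<forall>s\<in>set rs. s < 3"
  shows "length as = n" "\<forall>a\<in>set as. fst a < 3 \<and> snd a \<in> {-1, 0, 1}"
proof -
  show len: "length as = n" using next_q by (cases "(n, q, rs)" rule: next_state.cases) auto
  have "rs ! j < 3" if "j < n" for j using rs that by auto
  then have "fst (as ! j) < 3 \<and> snd (as ! j) \<in> {-1, 0, 1}" if "j < n" for j
    using next_q wf that by (cases "(n, q, rs)" rule: next_state.cases) (auto dest!: spec[of _ "rs ! j"])
  then show "\<forall>a\<in>set as. fst a < 3 \<and> snd a \<in> {-1, 0, 1}" unfolding all_set_conv_all_nth len by blast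
qed

lemma ternary_reads: "ternary n ts \<Longrightarrow> length (map read_tape ts) = n \<and> (\<forall>s\<in>set (map read_tape ts). s < 3)"
  by (auto simp: ternary_def read_tape_def)

lemma ternary_com_step:
  assumes step: "com_step n (q, ts) (q', ts')" and wf: "\<forall>d\<in>set q. wf_com d" and ts: "ternary n ts"
  shows "ternary n ts'"
proof -
  obtain as where as: "next_state n q (map read_tape ts) = Some (q', as)"
    and ts': "ts' = map2 act_tape as ts" using step by (auto simp: com_step_def)
  have len: "length ts = n" "length as = n" and written: "\<forall>a\<in>set as. fst a < 3"
    using ts next_state_actions[OF as wf] ternary_reads[OF ts] by (simp_all add: ternary_def)
  have "fst (ts' ! j) p < 3" if "j < n" for j p
    using that len written ts by (simp add: ts' act_tape_def ternary_def)
  moreover have "length ts' = n" using len by (simp add: ts')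
  ultimately show ?thesis unfolding ternary_def all_set_conv_all_nth by blast
qed

lemma ex_numbering_from_zero:
  assumes "finite Q" "q0 \<in> Q"
  obtains h :: "'a \<Rightarrow> nat" where "inj_on h Q" "h q0 = 0" "\<And>q. q \<in> Q \<Longrightarrow> h q < card Q"
proof -
  obtain g where g: "bij_betw g Q {0..<card Q}" using ex_bij_betw_finite_nat[OF assms(1)] ..
  have less: "g q < card Q" if "q \<in> Q" for q using g that by (auto simp: bij_betw_def)
  show ?thesis
  proof
    show "inj_on (Transposition.transpose 0 (g q0) \<circ> g) Q"
      by (intro comp_inj_on bij_betw_imp_inj_on[OF g] inj_onI) (metis Transposition.transpose_involutory)
    show "(Transposition.transpose 0 (g q0) \<circ> g) q0 = 0" by simp
    show "(Transposition.transpose 0 (g q0) \<circ> g) q < card Q" if "q \<in> Q" for q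
      using less[OF that] less[OF assms(2)] by (auto simp: Transposition.transpose_def)
  qed
qed

locale numbered_control =
  fixes c :: com and n :: nat and h :: "com list \<Rightarrow> nat"
  assumes wf: "wf_com c" and tapes: "1 \<le> n"
    and inj: "inj_on h (insert [] (continuations c []))" and start: "h [c] = 0"
    and less_card: "q \<in> insert [] (continuations c []) \<Longrightarrow> h q < card (insert [] (continuations c []))"
begin

definition control :: "com list set" where "control = insert [] (continuations c [])"

definition machine :: tm where
  "machine = \<lparr>num_tapes = n, num_symbols = 3, num_states = card control,
    transitions = {(h q, rs, h q', as) | q rs q' as. q \<in> control \<and> length rs = n \<and> (\<forall>s\<in>set rs. s < 3) \<and>
      next_state n q rs = Some (q', as)}\<rparr>"

lemma num_tapes_machine: "num_tapes machine = n"
  by (simp add: machine_def)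

lemma machine_transitionE:
  assumes "(s, rs, s', as) \<in> transitions machine"
  obtains q q' where "s = h q" "s' = h q'" "q \<in> control" "length rs = n" "\<forall>s\<in>set rs. s < 3"
    "next_state n q rs = Some (q', as)"
  using assms by (auto simp: machine_def)

lemma start_in_control: "[c] \<in> control"
  using Cons_in_continuations[of c "[]"] by (simp add: control_def)

lemma control_closed: "q \<in> control \<Longrightarrow> next_state n q rs = Some (q', as) \<Longrightarrow> q' \<in> control"
  using continuations_closed[of q c "[]"] by (auto simp: control_def)

lemma control_wf: "q \<in> control \<Longrightarrow> \<forall>d\<in>set q. wf_com d"
  using continuations_wf[of q c "[]"] wf by (auto simp: control_def)

lemma h_eq_iff: "q \<in> control \<Longrightarrow> q' \<in> control \<Longrightarrow> h q = h q' \<longleftrightarrow> q = q'"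
  using inj by (auto simp: control_def inj_on_def)

lemma wf_machine: "wf_tm machine"
proof -
  have "card {[], [c]} \<le> card control"
    using start_in_control by (intro card_mono) (simp_all add: control_def finite_continuations)
  moreover have "s < card control \<and> s' < card control \<and> length rs = n \<and> (\<forall>s\<in>set rs. s < 3) \<and>
      length as = n \<and> (\<forall>(s, d)\<in>set as. s < 3 \<and> d \<in> {-1, 0, 1})"
    if tr: "(s, rs, s', as) \<in> transitions machine" for s rs s' as
  proof -
    obtain q q' where q: "s = h q" "s' = h q'" "q \<in> control" and rs: "length rs = n" "\<forall>s\<in>set rs. s < 3"
      and next_q: "next_state n q rs = Some (q', as)" using machine_transitionE[OF tr] by metis
    then show ?thesis
      using less_card[folded control_def] control_closed[OF q(3) next_q]
        next_state_actions[OF next_q control_wf[OF q(3)] rs] by (auto simp: case_prod_unfold)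
  qed
  moreover have "num_symbols machine = 3" "num_states machine = card control" by (simp_all add: machine_def)
  ultimately show ?thesis
    unfolding wf_tm_def num_tapes_machine using tapes by fastforce
qed

lemma deterministic_machine: "deterministic machine"
proof -
  have "q1 = q2 \<and> as1 = as2"
    if "(s, rs, q1, as1) \<in> transitions machine" "(s, rs, q2, as2) \<in> transitions machine" for s rs q1 q2 as1 as2
    using that by (elim machine_transitionE) (auto simp: h_eq_iff)
  then show ?thesis unfolding deterministic_def by blast
qed

lemma machine_step:
  assumes step: "com_step n (q, ts) (q', ts')" and q: "q \<in> control" and ts: "ternary n ts"
  shows "q' \<in> control" "ternary n ts'" "tm_step machine (h q, ts) (h q', ts')"
proof -
  obtain as where as: "next_state n q (map read_tape ts) = Some (q', as)"
    and ts': "ts' = map2 act_tape as ts" using step by (auto simp: com_step_def)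
  show "q' \<in> control" by (rule control_closed[OF q as])
  show "ternary n ts'" by (rule ternary_com_step[OF step control_wf[OF q] ts])
  have "(h q, map read_tape ts, h q', as) \<in> transitions machine"
    unfolding machine_def tm.select_convs mem_Collect_eq using q ternary_reads[OF ts] as by blast
  then show "tm_step machine (h q, ts) (h q', ts')" using ts' by (auto simp: tm_step_def)
qed

lemma machine_steps:
  assumes "(com_step n ^^ t) (q, ts) (q', ts')" "q \<in> control" "ternary n ts"
  shows "q' \<in> control \<and> ternary n ts' \<and> (tm_step machine ^^ t) (h q, ts) (h q', ts')"
  using assms(1)
proof (induction t arbitrary: q' ts')
  case (Suc t)
  then obtain q'' ts'' where "(com_step n ^^ t) (q, ts) (q'', ts'')"
    and step: "com_step n (q'', ts'') (q', ts')" by auto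
  then have "q'' \<in> control" "ternary n ts''" "(tm_step machine ^^ t) (h q, ts) (h q'', ts'')"
    using Suc.IH by blast+
  then show ?case using machine_step[OF step] by (auto intro: relpowp_Suc_I)
qed (use assms in auto)

lemma halted_machine: "halted machine (h [], ts)"
proof -
  have "\<not> tm_step machine (h [], ts) d" for d
  proof
    assume "tm_step machine (h [], ts) d"
    then obtain rs s' as where "(h [], rs, s', as) \<in> transitions machine" by (auto simp: tm_step_def)
    then show False by (elim machine_transitionE) (auto simp: h_eq_iff control_def)
  qed
  then show ?thesis by (simp add: halted_def)
qed

lemma machine_exec:
  assumes ts: "ternary n ts" and ex: "exec c ts t us"
  shows "(tm_step machine ^^ t) (0, ts) (h [], us)"
proof -
  have "(com_step n ^^ t) ([c], ts) ([], us)" using exec_com_step[OF ex] ts by (simp add: ternary_def)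
  then show ?thesis using machine_steps start_in_control ts start by metis
qed

end

lemma tm_of_com:
  assumes "wf_com c" "1 \<le> n"
  obtains M where "wf_tm M" "deterministic M" "num_tapes M = n"
    "\<And>ts t us. ternary n ts \<Longrightarrow> exec c ts t us \<Longrightarrow> \<exists>d. (tm_step M ^^ t) (0, ts) d \<and> halted M d \<and> snd d = us"
proof -
  have "finite (insert [] (continuations c []))" "[c] \<in> insert [] (continuations c [])"
    using Cons_in_continuations[of c "[]"] by (simp_all add: finite_continuations)
  from ex_numbering_from_zero[OF this] obtain h where "inj_on h (insert [] (continuations c []))" "h [c] = 0"
    "\<And>q. q \<in> insert [] (continuations c []) \<Longrightarrow> h q < card (insert [] (continuations c []))"
    by blast
  then interpret numbered_control c n h by unfold_locales (use assms in blast)+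
  show ?thesis
  proof (rule that[OF wf_machine deterministic_machine num_tapes_machine])
    show "\<exists>d. (tm_step machine ^^ t) (0, ts) d \<and> halted machine d \<and> snd d = us"
      if "ternary n ts" "exec c ts t us" for ts t us
      using machine_exec[OF that] halted_machine by auto
  qed
qed

section \<open>Counter programs\<close>

text \<open>A counter is a tape with a mark at position 0; its value is the position of the head.\<close>

definition counter_tape :: "nat \<Rightarrow> tape" where
  "counter_tape v = ((\<lambda>p. if p = 0 then 1 else 0), int v)"

type_synonym cstate = "(nat \<Rightarrow> nat) \<times> int \<times> bool list"

text \<open>The first tape holds the input, the last one the output, the \<open>m\<close> tapes between them are
  counters.\<close>

definition conf :: "bool list \<Rightarrow> nat \<Rightarrow> cstate \<Rightarrow> tape list" where
  "conf w m s = (case s of (\<rho>, h, out) \<Rightarrow>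
     (word_contents w, h) # map (\<lambda>r. counter_tape (\<rho> r)) [0..<m] @
     [(word_contents out, int (length out))])"

lemma length_conf [simp]: "length (conf w m s) = m + 2"
  by (simp add: conf_def split: prod.split)

lemma conf_nth_counter: "r < m \<Longrightarrow> conf w m (\<rho>, h, out) ! Suc r = counter_tape (\<rho> r)"
  by (simp add: conf_def nth_append)

lemma conf_update_counter:
  "r < m \<Longrightarrow> (conf w m (\<rho>, h, out))[Suc r := counter_tape v] = conf w m (\<rho>(r := v), h, out)"
  by (rule nth_equalityI)
    (auto simp: conf_def nth_append nth_list_update nth_Cons' split: if_splits)

lemma read_counter [simp]: "read_tape (counter_tape v) = (if v = 0 then 1 else 0)"
  by (simp add: read_tape_def counter_tape_def)

definition inc :: "nat \<Rightarrow> com" where "inc r = Act (Suc r) (\<lambda>s. (s, 1))"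
definition dec :: "nat \<Rightarrow> com" where "dec r = Act (Suc r) (\<lambda>s. (s, if s = 1 then 0 else -1))"
definition move :: "int \<Rightarrow> com" where "move d = Act 0 (\<lambda>s. (s, d))"
definition emit :: "nat \<Rightarrow> bool \<Rightarrow> com" where
  "emit m b = Act (Suc m) (\<lambda>s. (if b then 2 else 1, 1))"
definition loop :: "nat \<Rightarrow> com \<Rightarrow> com" where "loop r c = While (Suc r) 1 c"
definition ifzero :: "nat \<Rightarrow> com \<Rightarrow> com \<Rightarrow> com" where "ifzero r c d = Cond (Suc r) 1 c d"

definition runs :: "bool list \<Rightarrow> nat \<Rightarrow> com \<Rightarrow> cstate \<Rightarrow> nat \<Rightarrow> cstate \<Rightarrow> bool" where
  "runs w m c s B s' \<longleftrightarrow> (\<exists>t\<le>B. exec c (conf w m s) t (conf w m s'))"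

lemma runs_cong: "runs w m c s B s' \<Longrightarrow> s' = t \<Longrightarrow> B \<le> B' \<Longrightarrow> runs w m c s B' t"
  using order_trans by (auto simp: runs_def)

lemma runs_inc:
  assumes r: "r < m"
  shows "runs w m (inc r) (\<rho>, h, out) 1 (\<rho>(r := Suc (\<rho> r)), h, out)"
proof -
  have "act_tape (read_tape (counter_tape (\<rho> r)), 1) (counter_tape (\<rho> r)) = counter_tape (Suc (\<rho> r))"
    by (auto simp: act_tape_def counter_tape_def read_tape_def)
  then have "exec (inc r) (conf w m (\<rho>, h, out)) 1 (conf w m (\<rho>(r := Suc (\<rho> r)), h, out))"
    using exec_Act[of "Suc r" "conf w m (\<rho>, h, out)" "\<lambda>s. (s, 1)"] r
    by (simp add: inc_def conf_nth_counter conf_update_counter del: read_counter)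
  then show ?thesis unfolding runs_def by blast
qed

lemma runs_dec:
  assumes r: "r < m"
  shows "runs w m (dec r) (\<rho>, h, out) 1 (\<rho>(r := \<rho> r - 1), h, out)"
proof -
  have "act_tape (read_tape (counter_tape (\<rho> r)), if read_tape (counter_tape (\<rho> r)) = 1 then 0 else -1)
      (counter_tape (\<rho> r)) = counter_tape (\<rho> r - 1)"
    by (auto simp: act_tape_def counter_tape_def read_tape_def)
  then have "exec (dec r) (conf w m (\<rho>, h, out)) 1 (conf w m (\<rho>(r := \<rho> r - 1), h, out))"
    using exec_Act[of "Suc r" "conf w m (\<rho>, h, out)" "\<lambda>s. (s, if s = 1 then 0 else -1)"] r
    by (simp add: dec_def conf_nth_counter conf_update_counter del: read_counter)
  then show ?thesis unfolding runs_def by blast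
qed

lemma runs_move: "runs w m (move d) (\<rho>, h, out) 1 (\<rho>, h + d, out)"
proof -
  have "(conf w m (\<rho>, h, out))[0 := act_tape (read_tape (conf w m (\<rho>, h, out) ! 0), d)
      (conf w m (\<rho>, h, out) ! 0)] = conf w m (\<rho>, h + d, out)"
    by (simp add: conf_def act_tape_def read_tape_def)
  then show ?thesis using exec_Act[of 0 "conf w m (\<rho>, h, out)" "\<lambda>s. (s, d)"]
    unfolding runs_def move_def by (intro exI[of _ 1]) simp
qed

lemma word_contents_snoc:
  "(word_contents out)(int (length out) := if b then 2 else 1) = word_contents (out @ [b])"
  by (rule ext) (auto simp: word_contents_def nth_append)

lemma runs_emit: "runs w m (emit m b) (\<rho>, h, out) 1 (\<rho>, h, out @ [b])"
proof -
  have "(conf w m (\<rho>, h, out))[Suc m := act_tape (if b then 2 else 1, 1)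
      (conf w m (\<rho>, h, out) ! Suc m)] = conf w m (\<rho>, h, out @ [b])"
    using word_contents_snoc[of out b]
    by (simp add: conf_def act_tape_def nth_append list_update_append)
  then show ?thesis
    using exec_Act[of "Suc m" "conf w m (\<rho>, h, out)" "\<lambda>s. (if b then 2 else 1, 1)"]
    unfolding runs_def emit_def by (intro exI[of _ 1]) simp
qed

lemma runs_Seq:
  "runs w m c s A s' \<Longrightarrow> runs w m d s' B s'' \<Longrightarrow> runs w m (Seq c d) s (A + B + 1) s''"
proof -
  assume "runs w m c s A s'" "runs w m d s' B s''"
  then obtain a b where "a \<le> A" "exec c (conf w m s) a (conf w m s')"
    "b \<le> B" "exec d (conf w m s') b (conf w m s'')" unfolding runs_def by blast
  then show ?thesis unfolding runs_def by (intro exI[of _ "Suc (a + b)"]) (auto intro: exec_Seq)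
qed

lemma runs_While_stop:
  "i < m + 2 \<Longrightarrow> read_tape (conf w m s ! i) = a \<Longrightarrow> runs w m (While i a c) s 1 s"
  unfolding runs_def by (auto intro!: exI[of _ 1] exec_While_stop)

lemma runs_While_loop:
  "i < m + 2 \<Longrightarrow> read_tape (conf w m s ! i) \<noteq> a \<Longrightarrow> runs w m c s A s' \<Longrightarrow>
   runs w m (While i a c) s' B s'' \<Longrightarrow> runs w m (While i a c) s (A + B + 1) s''"
proof -
  assume i: "i < m + 2" "read_tape (conf w m s ! i) \<noteq> a"
    and "runs w m c s A s'" "runs w m (While i a c) s' B s''"
  then obtain t u where "t \<le> A" "exec c (conf w m s) t (conf w m s')"
    "u \<le> B" "exec (While i a c) (conf w m s') u (conf w m s'')" unfolding runs_def by blast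
  then show ?thesis using i unfolding runs_def
    by (intro exI[of _ "Suc (t + u)"]) (auto intro: exec_While_loop)
qed

lemma runs_While:
  assumes "i < m + 2" "\<And>j. j < k \<Longrightarrow> runs w m c (\<sigma> j) B (\<sigma> (Suc j))"
    "\<And>j. j < k \<Longrightarrow> read_tape (conf w m (\<sigma> j) ! i) \<noteq> a" "read_tape (conf w m (\<sigma> k) ! i) = a"
  shows "runs w m (While i a c) (\<sigma> 0) (k * (B + 1) + 1) (\<sigma> k)"
proof -
  have "runs w m (While i a c) (\<sigma> (k - j)) (j * (B + 1) + 1) (\<sigma> k)" if "j \<le> k" for j
    using that
  proof (induction j)
    case 0
    then show ?case using runs_While_stop[of i m w "\<sigma> k" a c] assms by simp
  next
    case (Suc j)
    then have lt: "k - Suc j < k" and eq: "k - j = Suc (k - Suc j)" by simp_all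
    have "runs w m (While i a c) (\<sigma> (Suc (k - Suc j))) (j * (B + 1) + 1) (\<sigma> k)"
      using Suc eq by simp
    from runs_While_loop[OF assms(1) assms(3)[OF lt] assms(2)[OF lt] this]
    show ?case by (rule runs_cong) simp_all
  qed
  from this[of k] show ?thesis by simp
qed

lemma read_conf: "r < m \<Longrightarrow> read_tape (conf w m s ! Suc r) = (if fst s r = 0 then 1 else 0)"
  by (cases s) (simp add: conf_nth_counter)

lemma runs_loop:
  assumes "r < m" "\<And>j. j < k \<Longrightarrow> runs w m c (\<sigma> j) B (\<sigma> (Suc j))"
    "\<And>j. j < k \<Longrightarrow> fst (\<sigma> j) r \<noteq> 0" "fst (\<sigma> k) r = 0"
  shows "runs w m (loop r c) (\<sigma> 0) (k * (B + 1) + 1) (\<sigma> k)"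
  unfolding loop_def by (rule runs_While) (use assms in \<open>simp_all add: read_conf\<close>)

lemma runs_loop_stop: "r < m \<Longrightarrow> fst s r = 0 \<Longrightarrow> runs w m (loop r c) s 1 s"
  using runs_loop[of r m 0 w c "\<lambda>_. s" 0] by simp

lemma runs_loop_step:
  "r < m \<Longrightarrow> fst s r \<noteq> 0 \<Longrightarrow> runs w m c s A s' \<Longrightarrow> runs w m (loop r c) s' B s'' \<Longrightarrow>
   runs w m (loop r c) s (A + B + 1) s''"
  using runs_While_loop[of "Suc r" m w s 1 c A s' B s''] by (simp add: loop_def read_conf)

lemma runs_Cond:
  "i < m + 2 \<Longrightarrow> runs w m (if read_tape (conf w m s ! i) = a then c else d) s B s' \<Longrightarrow>
   runs w m (Cond i a c d) s (B + 1) s'"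
proof -
  assume i: "i < m + 2" and "runs w m (if read_tape (conf w m s ! i) = a then c else d) s B s'"
  then obtain t where "t \<le> B"
    "exec (if read_tape (conf w m s ! i) = a then c else d) (conf w m s) t (conf w m s')"
    unfolding runs_def by blast
  then show ?thesis using i unfolding runs_def
    by (intro exI[of _ "Suc t"]) (auto intro!: exec_Cond)
qed

lemma runs_ifzero:
  "r < m \<Longrightarrow> runs w m (if fst s r = 0 then c else d) s B s' \<Longrightarrow>
   runs w m (ifzero r c d) s (B + 1) s'"
  using runs_Cond[of "Suc r" m w s 1 c d B s']
  by (cases "fst s r = 0") (simp_all add: ifzero_def read_conf)

text \<open>\<open>transfer\<close> moves the value of a counter to two others, \<open>pour\<close> to one other, and \<open>shift\<close> to the
  position of the head on the input.\<close>

definition transfer :: "nat \<Rightarrow> nat \<Rightarrow> nat \<Rightarrow> com" where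
  "transfer r z f = loop r (Seq (dec r) (Seq (inc z) (inc f)))"
definition pour :: "nat \<Rightarrow> nat \<Rightarrow> com" where "pour f r = loop f (Seq (dec f) (inc r))"
definition shift :: "nat \<Rightarrow> int \<Rightarrow> com" where "shift f d = loop f (Seq (dec f) (move d))"
definition subtract :: "nat \<Rightarrow> nat \<Rightarrow> com" where "subtract f g = loop g (Seq (dec g) (dec f))"
definition clear :: "nat \<Rightarrow> com" where "clear f = loop f (dec f)"
definition add_symbol :: "nat \<Rightarrow> com" where
  "add_symbol z = Cond 0 0 (move 0) (Cond 0 1 (inc z) (Seq (inc z) (inc z)))"

lemma runs_transfer:
  assumes "r < m" "z < m" "f < m" "r \<noteq> z" "r \<noteq> f" "z \<noteq> f"
  shows "runs w m (transfer r z f) (\<rho>, h, out) (\<rho> r * 6 + 1)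
     (\<rho>(r := 0, z := \<rho> z + \<rho> r, f := \<rho> f + \<rho> r), h, out)"
proof -
  define \<sigma> where "\<sigma> j = (\<rho>(r := \<rho> r - j, z := \<rho> z + j, f := \<rho> f + j), h, out)" for j
  have "runs w m (transfer r z f) (\<sigma> 0) (\<rho> r * (5 + 1) + 1) (\<sigma> (\<rho> r))"
    unfolding transfer_def
  proof (rule runs_loop[OF assms(1)])
    fix j assume "j < \<rho> r"
    then show "runs w m (Seq (dec r) (Seq (inc z) (inc f))) (\<sigma> j) 5 (\<sigma> (Suc j))"
      unfolding \<sigma>_def using assms
      by (intro runs_cong[OF runs_Seq[OF runs_dec runs_Seq[OF runs_inc runs_inc]]]) (auto simp: fun_eq_iff)
  qed (use assms in \<open>simp_all add: \<sigma>_def\<close>)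
  then show ?thesis by (simp add: \<sigma>_def)
qed

lemma runs_pour:
  assumes "r < m" "f < m" "r \<noteq> f"
  shows "runs w m (pour f r) (\<rho>, h, out) (\<rho> f * 4 + 1) (\<rho>(f := 0, r := \<rho> r + \<rho> f), h, out)"
proof -
  define \<sigma> where "\<sigma> j = (\<rho>(f := \<rho> f - j, r := \<rho> r + j), h, out)" for j
  have "runs w m (pour f r) (\<sigma> 0) (\<rho> f * (3 + 1) + 1) (\<sigma> (\<rho> f))"
    unfolding pour_def
  proof (rule runs_loop[OF assms(2)])
    fix j assume "j < \<rho> f"
    then show "runs w m (Seq (dec f) (inc r)) (\<sigma> j) 3 (\<sigma> (Suc j))"
      unfolding \<sigma>_def using assms
      by (intro runs_cong[OF runs_Seq[OF runs_dec runs_inc]]) (auto simp: fun_eq_iff)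
  qed (use assms in \<open>simp_all add: \<sigma>_def\<close>)
  then show ?thesis by (simp add: \<sigma>_def)
qed

lemma runs_shift:
  assumes "f < m"
  shows "runs w m (shift f d) (\<rho>, h, out) (\<rho> f * 4 + 1) (\<rho>(f := 0), h + int (\<rho> f) * d, out)"
proof -
  define \<sigma> where "\<sigma> j = (\<rho>(f := \<rho> f - j), h + int j * d, out)" for j
  have "runs w m (shift f d) (\<sigma> 0) (\<rho> f * (3 + 1) + 1) (\<sigma> (\<rho> f))"
    unfolding shift_def
  proof (rule runs_loop[OF assms])
    fix j assume "j < \<rho> f"
    then show "runs w m (Seq (dec f) (move d)) (\<sigma> j) 3 (\<sigma> (Suc j))"
      unfolding \<sigma>_def using assms
      by (intro runs_cong[OF runs_Seq[OF runs_dec runs_move]]) (auto simp: fun_eq_iff algebra_simps)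
  qed (use assms in \<open>simp_all add: \<sigma>_def\<close>)
  then show ?thesis by (simp add: \<sigma>_def)
qed

lemma runs_subtract:
  assumes "f < m" "g < m" "f \<noteq> g"
  shows "runs w m (subtract f g) (\<rho>, h, out) (\<rho> g * 4 + 1) (\<rho>(g := 0, f := \<rho> f - \<rho> g), h, out)"
proof -
  define \<sigma> where "\<sigma> j = (\<rho>(g := \<rho> g - j, f := \<rho> f - j), h, out)" for j
  have "runs w m (subtract f g) (\<sigma> 0) (\<rho> g * (3 + 1) + 1) (\<sigma> (\<rho> g))"
    unfolding subtract_def
  proof (rule runs_loop[OF assms(2)])
    fix j assume "j < \<rho> g"
    then show "runs w m (Seq (dec g) (dec f)) (\<sigma> j) 3 (\<sigma> (Suc j))"
      unfolding \<sigma>_def using assms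
      by (intro runs_cong[OF runs_Seq[OF runs_dec runs_dec]]) (auto simp: fun_eq_iff)
  qed (use assms in \<open>simp_all add: \<sigma>_def\<close>)
  then show ?thesis by (simp add: \<sigma>_def)
qed

lemma runs_clear:
  assumes "f < m"
  shows "runs w m (clear f) (\<rho>, h, out) (\<rho> f * 2 + 1) (\<rho>(f := 0), h, out)"
proof -
  define \<sigma> where "\<sigma> j = (\<rho>(f := \<rho> f - j), h, out)" for j
  have "runs w m (clear f) (\<sigma> 0) (\<rho> f * (1 + 1) + 1) (\<sigma> (\<rho> f))"
    unfolding clear_def
  proof (rule runs_loop[OF assms])
    fix j assume "j < \<rho> f"
    then show "runs w m (dec f) (\<sigma> j) 1 (\<sigma> (Suc j))"
      unfolding \<sigma>_def using assms by (intro runs_cong[OF runs_dec]) (auto simp: fun_eq_iff)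
  qed (use assms in \<open>simp_all add: \<sigma>_def\<close>)
  then show ?thesis by (simp add: \<sigma>_def mult_2_right)
qed

lemma word_contents_less_3: "word_contents w i < 3"
  by (simp add: word_contents_def)

lemma runs_add_symbol:
  assumes "z < m"
  shows "runs w m (add_symbol z) (\<rho>, h, out) 5 (\<rho>(z := \<rho> z + word_contents w h), h, out)"
    (is "runs _ _ _ ?s _ ?t")
proof -
  have read: "read_tape (conf w m ?s ! 0) = word_contents w h" by (simp add: conf_def read_tape_def)
  consider (blank) "word_contents w h = 0" | (zero) "word_contents w h = 1" | (one) "word_contents w h = 2"
    using word_contents_less_3[of w h] by linarith
  then show ?thesis
  proof cases
    case blank
    then have "runs w m (move 0) ?s 4 ?t" by (intro runs_cong[OF runs_move]) auto
    then have "runs w m (add_symbol z) ?s (4 + 1) ?t"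
      unfolding add_symbol_def using read blank by (intro runs_Cond) simp_all
    then show ?thesis by simp
  next
    case zero
    then have "runs w m (inc z) ?s 3 ?t" using assms by (intro runs_cong[OF runs_inc]) auto
    then have "runs w m (Cond 0 1 (inc z) (Seq (inc z) (inc z))) ?s (3 + 1) ?t"
      using read zero by (intro runs_Cond) simp_all
    then have "runs w m (add_symbol z) ?s (3 + 1 + 1) ?t"
      unfolding add_symbol_def using read zero by (intro runs_Cond) simp_all
    then show ?thesis by simp
  next
    case one
    then have "runs w m (Seq (inc z) (inc z)) ?s 3 ?t"
      using assms by (intro runs_cong[OF runs_Seq[OF runs_inc runs_inc]]) auto
    then have "runs w m (Cond 0 1 (inc z) (Seq (inc z) (inc z))) ?s (3 + 1) ?t"
      using read one by (intro runs_Cond) simp_all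
    then have "runs w m (add_symbol z) ?s (3 + 1 + 1) ?t"
      unfolding add_symbol_def using read one by (intro runs_Cond) simp_all
    then show ?thesis by simp
  qed
qed

subsection \<open>Polynomially bounded functions\<close>

definition poly_bounded :: "(nat \<Rightarrow> nat) \<Rightarrow> bool" where
  "poly_bounded g \<longleftrightarrow> (\<exists>k. \<forall>N\<ge>2. g N \<le> N ^ k)"

lemma poly_bounded_const: "poly_bounded (\<lambda>_. c)"
  unfolding poly_bounded_def
  by (intro exI[of _ c] allI impI) (meson le_trans less_exp less_imp_le power_mono zero_le)

lemma poly_bounded_id: "poly_bounded (\<lambda>N. N)"
  unfolding poly_bounded_def by (intro exI[of _ 1]) simp

lemma poly_bounded_mult:
  assumes "poly_bounded g" "poly_bounded h" shows "poly_bounded (\<lambda>N. g N * h N)"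
proof -
  obtain j k where "\<forall>N\<ge>2. g N \<le> N ^ j" "\<forall>N\<ge>2. h N \<le> N ^ k"
    using assms by (auto simp: poly_bounded_def)
  then have "\<forall>N\<ge>2. g N * h N \<le> N ^ (j + k)" by (simp add: power_add mult_mono)
  then show ?thesis unfolding poly_bounded_def by blast
qed

lemma poly_bounded_add:
  assumes "poly_bounded g" "poly_bounded h" shows "poly_bounded (\<lambda>N. g N + h N)"
proof -
  obtain j k where j: "\<forall>N\<ge>2. g N \<le> N ^ j" and k: "\<forall>N\<ge>2. h N \<le> N ^ k"
    using assms by (auto simp: poly_bounded_def)
  have "g N + h N \<le> N ^ (j + k + 1)" if N: "N \<ge> 2" for N
  proof -
    have "N ^ j \<le> N ^ (j + k)" "N ^ k \<le> N ^ (j + k)" using N by (simp_all add: power_increasing)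
    then have "g N + h N \<le> 2 * N ^ (j + k)"
      using j k N by (metis add_mono le_trans mult_2)
    also have "\<dots> \<le> N * N ^ (j + k)" using N by (intro mult_right_mono) auto
    finally show ?thesis by simp
  qed
  then show ?thesis unfolding poly_bounded_def by blast
qed

lemma poly_bounded_comp:
  assumes "poly_bounded g" "poly_bounded h" "\<And>N. 2 \<le> N \<Longrightarrow> 2 \<le> h N"
  shows "poly_bounded (\<lambda>N. g (h N))"
proof -
  obtain j k where j: "\<forall>N\<ge>2. g N \<le> N ^ j" and k: "\<forall>N\<ge>2. h N \<le> N ^ k"
    using assms by (auto simp: poly_bounded_def)
  have "g (h N) \<le> N ^ (k * j)" if N: "N \<ge> 2" for N
  proof -
    have "g (h N) \<le> h N ^ j" using j assms(3)[OF N] by simp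
    also have "\<dots> \<le> (N ^ k) ^ j" using k N by (intro power_mono) auto
    finally show ?thesis by (simp add: power_mult)
  qed
  then show ?thesis unfolding poly_bounded_def by blast
qed

lemmas poly_bounded_intros =
  poly_bounded_const poly_bounded_id poly_bounded_mult poly_bounded_add

subsection \<open>Arithmetic expressions\<close>

text \<open>\<open>Sym a b\<close> is the input symbol at position \<open>a - b\<close>.\<close>

datatype expr = Var nat | Num nat | Len | Plus expr expr | Times expr expr | Minus expr expr
  | Sym expr expr

primrec val :: "bool list \<Rightarrow> (nat \<Rightarrow> nat) \<Rightarrow> expr \<Rightarrow> nat" where
  "val w \<rho> (Var r) = \<rho> r"
| "val w \<rho> (Num c) = c"
| "val w \<rho> Len = length w"
| "val w \<rho> (Plus a b) = val w \<rho> a + val w \<rho> b"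
| "val w \<rho> (Times a b) = val w \<rho> a * val w \<rho> b"
| "val w \<rho> (Minus a b) = val w \<rho> a - val w \<rho> b"
| "val w \<rho> (Sym a b) = word_contents w (int (val w \<rho> a) - int (val w \<rho> b))"

primrec var_bound :: "expr \<Rightarrow> nat" where
  "var_bound (Var r) = Suc r"
| "var_bound (Num c) = 0"
| "var_bound Len = 0"
| "var_bound (Plus a b) = max (var_bound a) (var_bound b)"
| "var_bound (Times a b) = max (var_bound a) (var_bound b)"
| "var_bound (Minus a b) = max (var_bound a) (var_bound b)"
| "var_bound (Sym a b) = max (var_bound a) (var_bound b)"

primrec temps :: "expr \<Rightarrow> nat" where
  "temps (Var r) = 1"
| "temps (Num c) = 0"
| "temps Len = 1"
| "temps (Plus a b) = max (temps a) (temps b)"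
| "temps (Times a b) = 1 + max (temps a) (temps b)"
| "temps (Minus a b) = 2 + max (temps a) (temps b)"
| "temps (Sym a b) = 4 + max (temps a) (temps b)"

text \<open>The counters from \<open>f\<close> on are free.\<close>

primrec add_expr :: "expr \<Rightarrow> nat \<Rightarrow> nat \<Rightarrow> com" where
  "add_expr (Var r) z f = Seq (transfer r z f) (pour f r)"
| "add_expr (Num c) z f = (Seq (inc z) ^^ c) (move 0)"
| "add_expr Len z f = Seq (While 0 0 (Seq (inc z) (Seq (inc f) (move 1)))) (shift f (-1))"
| "add_expr (Plus a b) z f = Seq (add_expr a z f) (add_expr b z f)"
| "add_expr (Times a b) z f =
     Seq (add_expr a f (f + 1)) (loop f (Seq (dec f) (add_expr b z (f + 1))))"
| "add_expr (Minus a b) z f =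
     Seq (add_expr a f (f + 2)) (Seq (add_expr b (f + 1) (f + 2)) (Seq (subtract f (f + 1)) (pour f z)))"
| "add_expr (Sym a b) z f =
     Seq (add_expr a f (f + 4)) (Seq (add_expr b (f + 1) (f + 4))
     (Seq (add_expr a (f + 2) (f + 4)) (Seq (add_expr b (f + 3) (f + 4))
     (Seq (shift f 1) (Seq (shift (f + 1) (-1)) (Seq (add_symbol z)
     (Seq (shift (f + 3) 1) (shift (f + 2) (-1)))))))))"

definition env_bounded :: "bool list \<Rightarrow> (nat \<Rightarrow> nat) \<Rightarrow> nat \<Rightarrow> nat \<Rightarrow> bool" where
  "env_bounded w \<rho> k N \<longleftrightarrow> 2 \<le> N \<and> length w \<le> N \<and> (\<forall>r<k. \<rho> r \<le> N)"

lemma env_bounded_max: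
  "env_bounded w \<rho> (max j k) N \<longleftrightarrow> env_bounded w \<rho> j N \<and> env_bounded w \<rho> k N"
  by (auto simp: env_bounded_def less_max_iff_disj)

lemma env_bounded_mono: "env_bounded w \<rho> k N \<Longrightarrow> j \<le> k \<Longrightarrow> env_bounded w \<rho> j N"
  by (auto simp: env_bounded_def)

definition val_bound :: "expr \<Rightarrow> (nat \<Rightarrow> nat) \<Rightarrow> bool" where
  "val_bound e v \<longleftrightarrow> (\<forall>w \<rho> N. env_bounded w \<rho> (var_bound e) N \<longrightarrow> val w \<rho> e \<le> v N)"

lemma val_boundD: "val_bound e v \<Longrightarrow> env_bounded w \<rho> (var_bound e) N \<Longrightarrow> val w \<rho> e \<le> v N"
  by (simp add: val_bound_def)

lemma ex_val_bound: "\<exists>v. poly_bounded v \<and> val_bound e v"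
proof (induction e)
  case (Var r)
  show ?case by (intro exI[of _ "\<lambda>N. N"]) (auto simp: val_bound_def env_bounded_def poly_bounded_intros)
next
  case (Num c)
  show ?case by (intro exI[of _ "\<lambda>_. c"]) (auto simp: val_bound_def poly_bounded_intros)
next
  case Len
  show ?case by (intro exI[of _ "\<lambda>N. N"]) (auto simp: val_bound_def env_bounded_def poly_bounded_intros)
next
  case (Plus a b)
  then obtain g h where "poly_bounded g" "val_bound a g" "poly_bounded h" "val_bound b h" by blast
  then show ?case unfolding val_bound_def
    by (intro exI[of _ "\<lambda>N. g N + h N"] conjI allI impI poly_bounded_intros)
      (simp_all add: env_bounded_max add_mono)
next
  case (Times a b)
  then obtain g h where "poly_bounded g" "val_bound a g" "poly_bounded h" "val_bound b h" by blast
  then show ?case unfolding val_bound_def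
    by (intro exI[of _ "\<lambda>N. g N * h N"] conjI allI impI poly_bounded_intros)
      (simp_all add: env_bounded_max mult_le_mono)
next
  case (Minus a b)
  then obtain g where "poly_bounded g" "val_bound a g" by blast
  then show ?case unfolding val_bound_def
    by (intro exI[of _ g] conjI allI impI) (simp_all add: env_bounded_max le_trans[OF diff_le_self])
next
  case (Sym a b)
  show ?case by (intro exI[of _ "\<lambda>_. 2"]) (auto simp: val_bound_def word_contents_def poly_bounded_intros)
qed

lemma val_upd [simp]: "var_bound e \<le> r \<Longrightarrow> val w (\<rho>(r := v)) e = val w \<rho> e"
  by (induction e) auto

lemma env_bounded_upd [simp]: "k \<le> r \<Longrightarrow> env_bounded w (\<rho>(r := v)) k N = env_bounded w \<rho> k N"
  by (auto simp: env_bounded_def)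

definition add_expr_time :: "expr \<Rightarrow> (nat \<Rightarrow> nat) \<Rightarrow> bool" where
  "add_expr_time e g \<longleftrightarrow> (\<forall>w m \<rho> z f N ys. var_bound e \<le> z \<longrightarrow> z < f \<longrightarrow> f + temps e \<le> m \<longrightarrow>
     (\<forall>r\<ge>f. \<rho> r = 0) \<longrightarrow> env_bounded w \<rho> (var_bound e) N \<longrightarrow>
     runs w m (add_expr e z f) (\<rho>, 0, ys) (g N) (\<rho>(z := \<rho> z + val w \<rho> e), 0, ys))"

lemma add_expr_timeI:
  assumes "\<And>w m \<rho> z f N ys. var_bound e \<le> z \<Longrightarrow> z < f \<Longrightarrow> f + temps e \<le> m \<Longrightarrow> \<forall>r\<ge>f. \<rho> r = 0 \<Longrightarrow>
    env_bounded w \<rho> (var_bound e) N \<Longrightarrow>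
    runs w m (add_expr e z f) (\<rho>, 0, ys) (g N) (\<rho>(z := \<rho> z + val w \<rho> e), 0, ys)"
  shows "add_expr_time e g"
  using assms unfolding add_expr_time_def by blast

lemma runs_add_expr:
  assumes "add_expr_time e g" "var_bound e \<le> z" "z < f" "f + temps e \<le> m" "\<forall>r\<ge>f. \<rho> r = 0"
    "env_bounded w \<rho> (var_bound e) N"
  shows "runs w m (add_expr e z f) (\<rho>, 0, ys) (g N) (\<rho>(z := \<rho> z + val w \<rho> e), 0, ys)"
  using assms unfolding add_expr_time_def by blast

lemma add_expr_time_Var: "add_expr_time (Var r) (\<lambda>N. N * 10 + 3)"
proof (rule add_expr_timeI)
  fix w m \<rho> z f N and ys :: "bool list"
  assume env: "var_bound (Var r) \<le> z" "z < f" "f + temps (Var r) \<le> m" "\<forall>r\<ge>f. \<rho> r = 0"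
    "env_bounded w \<rho> (var_bound (Var r)) N"
  have distinct: "r < m" "z < m" "f < m" "r \<noteq> z" "r \<noteq> f" "z \<noteq> f" using env by auto
  have "\<rho> f = 0" "\<rho> r \<le> N" using env by (auto simp: env_bounded_def)
  then show "runs w m (add_expr (Var r) z f) (\<rho>, 0, ys) (N * 10 + 3)
      (\<rho>(z := \<rho> z + val w \<rho> (Var r)), 0, ys)"
    unfolding add_expr.simps using distinct
    by (intro runs_cong[OF runs_Seq[OF runs_transfer[OF distinct] runs_pour]]) (auto simp: fun_eq_iff)
qed

lemma add_expr_time_Num: "add_expr_time (Num c) (\<lambda>N. 2 * c + 1)"
proof (rule add_expr_timeI)
  fix w m \<rho> z f N and ys :: "bool list"
  assume env: "z < f" "f + temps (Num c) \<le> m"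
  have "runs w m ((Seq (inc z) ^^ c) (move 0)) (\<rho>, 0, ys) (2 * c + 1) (\<rho>(z := \<rho> z + c), 0, ys)" for \<rho>
  proof (induction c arbitrary: \<rho>)
    case 0
    then show ?case using runs_move[of w m 0 \<rho> 0 ys] by simp
  next
    case (Suc c)
    show ?case unfolding funpow.simps o_def
      by (rule runs_cong[OF runs_Seq[OF runs_inc Suc]]) (use env in auto)
  qed
  then show "runs w m (add_expr (Num c) z f) (\<rho>, 0, ys) (2 * c + 1)
      (\<rho>(z := \<rho> z + val w \<rho> (Num c)), 0, ys)" by simp
qed

lemma add_expr_time_Len: "add_expr_time Len (\<lambda>N. N * 10 + 3)"
proof (rule add_expr_timeI)
  fix w m \<rho> z f N and ys :: "bool list"
  assume env: "z < f" "f + temps Len \<le> m" "\<forall>r\<ge>f. \<rho> r = 0" "env_bounded w \<rho> (var_bound Len) N"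
  then have less: "f < m" "z < m" and free: "\<rho> f = 0" and N: "length w \<le> N"
    by (auto simp: env_bounded_def)
  define \<sigma> where "\<sigma> j = (\<rho>(z := \<rho> z + j, f := j), int j, ys)" for j
  have scan: "runs w m (While 0 0 (Seq (inc z) (Seq (inc f) (move 1)))) (\<sigma> 0)
      (length w * (5 + 1) + 1) (\<sigma> (length w))"
  proof (rule runs_While)
    fix j
    show "runs w m (Seq (inc z) (Seq (inc f) (move 1))) (\<sigma> j) 5 (\<sigma> (Suc j))"
      unfolding \<sigma>_def
      by (rule runs_cong[OF runs_Seq[OF runs_inc runs_Seq[OF runs_inc runs_move]]])
        (use less env in \<open>auto simp: fun_eq_iff\<close>)
  qed (auto simp: \<sigma>_def conf_def read_tape_def word_contents_def)
  have start: "\<sigma> 0 = (\<rho>, 0, ys)" using free by (auto simp: \<sigma>_def fun_eq_iff)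
  show "runs w m (add_expr Len z f) (\<rho>, 0, ys) (N * 10 + 3)
      (\<rho>(z := \<rho> z + val w \<rho> Len), 0, ys)"
    unfolding add_expr.simps start[symmetric]
    by (rule runs_cong[OF runs_Seq[OF scan[unfolded \<sigma>_def[of "length w"]] runs_shift[OF less(1)]]])
      (use env free N in \<open>auto simp: fun_eq_iff\<close>)
qed

lemma add_expr_time_Plus:
  assumes "add_expr_time a g" "add_expr_time b h"
  shows "add_expr_time (Plus a b) (\<lambda>N. g N + h N + 1)"
proof (rule add_expr_timeI)
  fix w m \<rho> z f N and ys :: "bool list"
  assume env: "var_bound (Plus a b) \<le> z" "z < f" "f + temps (Plus a b) \<le> m" "\<forall>r\<ge>f. \<rho> r = 0"
    "env_bounded w \<rho> (var_bound (Plus a b)) N"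
  show "runs w m (add_expr (Plus a b) z f) (\<rho>, 0, ys) (g N + h N + 1)
      (\<rho>(z := \<rho> z + val w \<rho> (Plus a b)), 0, ys)"
    unfolding add_expr.simps
    by (rule runs_cong[OF runs_Seq[OF runs_add_expr[OF assms(1)] runs_add_expr[OF assms(2)]]])
      (use env in \<open>auto simp: env_bounded_max\<close>)
qed

lemma add_expr_time_Times:
  assumes "add_expr_time a g" "add_expr_time b h" "val_bound a v"
  shows "add_expr_time (Times a b) (\<lambda>N. g N + (v N * (h N + 3) + 1) + 1)"
proof (rule add_expr_timeI)
  fix w m \<rho> z f N and ys :: "bool list"
  assume env: "var_bound (Times a b) \<le> z" "z < f" "f + temps (Times a b) \<le> m" "\<forall>r\<ge>f. \<rho> r = 0"
    "env_bounded w \<rho> (var_bound (Times a b)) N"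
  define \<sigma> where "\<sigma> j = (\<rho>(f := val w \<rho> a - j, z := \<rho> z + j * val w \<rho> b), 0::int, ys)" for j
  have first: "runs w m (add_expr a f (f + 1)) (\<rho>, 0, ys) (g N) (\<sigma> 0)"
    unfolding \<sigma>_def
    by (rule runs_cong[OF runs_add_expr[OF assms(1)]]) (use env in \<open>auto simp: env_bounded_max fun_eq_iff\<close>)
  have rounds: "runs w m (loop f (Seq (dec f) (add_expr b z (f + 1)))) (\<sigma> 0)
      (val w \<rho> a * (h N + 2 + 1) + 1) (\<sigma> (val w \<rho> a))"
  proof (rule runs_loop)
    fix j assume "j < val w \<rho> a"
    then show "runs w m (Seq (dec f) (add_expr b z (f + 1))) (\<sigma> j) (h N + 2) (\<sigma> (Suc j))"
      unfolding \<sigma>_def using env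
      by (intro runs_cong[OF runs_Seq[OF runs_dec runs_add_expr[OF assms(2)]]])
        (auto simp: env_bounded_max fun_eq_iff)
  qed (use env in \<open>auto simp: \<sigma>_def\<close>)
  have "val w \<rho> a \<le> v N" using val_boundD[OF assms(3)] env by (simp add: env_bounded_max)
  then have time: "val w \<rho> a * (h N + 2 + 1) \<le> v N * (h N + 3)" by (rule mult_le_mono) simp
  have final: "\<sigma> (val w \<rho> a) = (\<rho>(z := \<rho> z + val w \<rho> (Times a b)), 0, ys)"
    using env by (auto simp: \<sigma>_def fun_eq_iff)
  show "runs w m (add_expr (Times a b) z f) (\<rho>, 0, ys) (g N + (v N * (h N + 3) + 1) + 1)
      (\<rho>(z := \<rho> z + val w \<rho> (Times a b)), 0, ys)"
    unfolding add_expr.simps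
    by (rule runs_cong[OF runs_Seq[OF first rounds] final]) (use time in linarith)
qed

lemma add_expr_time_Minus:
  assumes "add_expr_time a g" "add_expr_time b h" "val_bound a va" "val_bound b vb"
  shows "add_expr_time (Minus a b) (\<lambda>N. g N + (h N + ((vb N * 4 + 1) + (va N * 4 + 1) + 1) + 1) + 1)"
proof (rule add_expr_timeI)
  fix w m \<rho> z f N and ys :: "bool list"
  assume env: "var_bound (Minus a b) \<le> z" "z < f" "f + temps (Minus a b) \<le> m" "\<forall>r\<ge>f. \<rho> r = 0"
    "env_bounded w \<rho> (var_bound (Minus a b)) N"
  define x y where "x = val w \<rho> a" and "y = val w \<rho> b"
  have first: "runs w m (add_expr a f (f + 2)) (\<rho>, 0, ys) (g N) (\<rho>(f := x), 0, ys)"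
    unfolding x_def
    by (rule runs_cong[OF runs_add_expr[OF assms(1)]]) (use env in \<open>auto simp: env_bounded_max\<close>)
  have second: "runs w m (add_expr b (f + 1) (f + 2)) (\<rho>(f := x), 0, ys) (h N) (\<rho>(f := x, f + 1 := y), 0, ys)"
    unfolding y_def
    by (rule runs_cong[OF runs_add_expr[OF assms(2)]]) (use env in \<open>auto simp: env_bounded_max\<close>)
  have difference: "runs w m (subtract f (f + 1)) (\<rho>(f := x, f + 1 := y), 0, ys) (y * 4 + 1)
      (\<rho>(f := x - y), 0, ys)"
    by (rule runs_cong[OF runs_subtract]) (use env in \<open>auto simp: fun_eq_iff\<close>)
  have result: "runs w m (pour f z) (\<rho>(f := x - y), 0, ys) ((x - y) * 4 + 1)
      (\<rho>(z := \<rho> z + val w \<rho> (Minus a b)), 0, ys)"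
    by (rule runs_cong[OF runs_pour]) (use env in \<open>auto simp: fun_eq_iff x_def y_def\<close>)
  have "x \<le> va N" "y \<le> vb N"
    using val_boundD[OF assms(3)] val_boundD[OF assms(4)] env by (simp_all add: env_bounded_max x_def y_def)
  then show "runs w m (add_expr (Minus a b) z f) (\<rho>, 0, ys)
      (g N + (h N + ((vb N * 4 + 1) + (va N * 4 + 1) + 1) + 1) + 1)
      (\<rho>(z := \<rho> z + val w \<rho> (Minus a b)), 0, ys)"
    unfolding add_expr.simps
    by (intro runs_cong[OF runs_Seq[OF first runs_Seq[OF second runs_Seq[OF difference result]]] refl]) simp
qed

lemma add_expr_time_Sym:
  assumes "add_expr_time a g" "add_expr_time b h" "val_bound a va" "val_bound b vb"
  shows "add_expr_time (Sym a b) (\<lambda>N. 2 * g N + 2 * h N + 8 * va N + 8 * vb N + 20)"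
proof (rule add_expr_timeI)
  fix w m \<rho> z f N and ys :: "bool list"
  assume env: "var_bound (Sym a b) \<le> z" "z < f" "f + temps (Sym a b) \<le> m" "\<forall>r\<ge>f. \<rho> r = 0"
    "env_bounded w \<rho> (var_bound (Sym a b)) N"
  define x y where "x = val w \<rho> a" and "y = val w \<rho> b"
  define \<sigma> where "\<sigma> = \<rho>(z := \<rho> z + val w \<rho> (Sym a b))"
  have "runs w m (add_expr a f (f + 4)) (\<rho>, 0, ys) (g N) (\<rho>(f := x), 0, ys)"
    by (rule runs_cong[OF runs_add_expr[OF assms(1)]]) (use env in \<open>auto simp: env_bounded_max x_def\<close>)
  moreover have "runs w m (add_expr b (f + 1) (f + 4)) (\<rho>(f := x), 0, ys) (h N)
      (\<rho>(f := x, f + 1 := y), 0, ys)"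
    by (rule runs_cong[OF runs_add_expr[OF assms(2)]]) (use env in \<open>auto simp: env_bounded_max y_def\<close>)
  moreover have "runs w m (add_expr a (f + 2) (f + 4)) (\<rho>(f := x, f + 1 := y), 0, ys) (g N)
      (\<rho>(f := x, f + 1 := y, f + 2 := x), 0, ys)"
    by (rule runs_cong[OF runs_add_expr[OF assms(1)]]) (use env in \<open>auto simp: env_bounded_max x_def\<close>)
  moreover have "runs w m (add_expr b (f + 3) (f + 4)) (\<rho>(f := x, f + 1 := y, f + 2 := x), 0, ys) (h N)
      (\<rho>(f := x, f + 1 := y, f + 2 := x, f + 3 := y), 0, ys)"
    by (rule runs_cong[OF runs_add_expr[OF assms(2)]]) (use env in \<open>auto simp: env_bounded_max y_def\<close>)
  moreover have "runs w m (shift f 1) (\<rho>(f := x, f + 1 := y, f + 2 := x, f + 3 := y), 0, ys) (x * 4 + 1)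
      (\<rho>(f + 1 := y, f + 2 := x, f + 3 := y), int x, ys)"
    by (rule runs_cong[OF runs_shift]) (use env in \<open>auto simp: fun_eq_iff\<close>)
  moreover have "runs w m (shift (f + 1) (-1)) (\<rho>(f + 1 := y, f + 2 := x, f + 3 := y), int x, ys) (y * 4 + 1)
      (\<rho>(f + 2 := x, f + 3 := y), int x - int y, ys)"
    by (rule runs_cong[OF runs_shift]) (use env in \<open>auto simp: fun_eq_iff\<close>)
  moreover have "runs w m (add_symbol z) (\<rho>(f + 2 := x, f + 3 := y), int x - int y, ys) 5
      (\<sigma>(f + 2 := x, f + 3 := y), int x - int y, ys)"
    by (rule runs_cong[OF runs_add_symbol]) (use env in \<open>auto simp: fun_eq_iff \<sigma>_def x_def y_def\<close>)
  moreover have "runs w m (shift (f + 3) 1) (\<sigma>(f + 2 := x, f + 3 := y), int x - int y, ys) (y * 4 + 1)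
      (\<sigma>(f + 2 := x), int x, ys)"
    by (rule runs_cong[OF runs_shift]) (use env in \<open>auto simp: fun_eq_iff \<sigma>_def\<close>)
  moreover have "runs w m (shift (f + 2) (-1)) (\<sigma>(f + 2 := x), int x, ys) (x * 4 + 1) (\<sigma>, 0, ys)"
    by (rule runs_cong[OF runs_shift]) (use env in \<open>auto simp: fun_eq_iff \<sigma>_def\<close>)
  ultimately have "runs w m (add_expr (Sym a b) z f) (\<rho>, 0, ys)
      (g N + (h N + (g N + (h N + (x * 4 + 1 + (y * 4 + 1 + (5 + (y * 4 + 1 + (x * 4 + 1) + 1) + 1)
        + 1) + 1) + 1) + 1) + 1) + 1) (\<sigma>, 0, ys)"
    unfolding add_expr.simps by (intro runs_Seq)
  moreover have "x \<le> va N" "y \<le> vb N"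
    using val_boundD[OF assms(3)] val_boundD[OF assms(4)] env by (simp_all add: env_bounded_max x_def y_def)
  ultimately show "runs w m (add_expr (Sym a b) z f) (\<rho>, 0, ys)
      (2 * g N + 2 * h N + 8 * va N + 8 * vb N + 20) (\<rho>(z := \<rho> z + val w \<rho> (Sym a b)), 0, ys)"
    unfolding \<sigma>_def by (elim runs_cong) simp_all
qed

lemma ex_add_expr_time: "\<exists>g. poly_bounded g \<and> add_expr_time e g"
proof (induction e)
  case (Var r)
  show ?case by (intro exI[of _ "\<lambda>N. N * 10 + 3"] conjI add_expr_time_Var poly_bounded_intros)
next
  case (Num c)
  show ?case by (intro exI[of _ "\<lambda>N. 2 * c + 1"] conjI add_expr_time_Num poly_bounded_intros)
next
  case Len
  show ?case by (intro exI[of _ "\<lambda>N. N * 10 + 3"] conjI add_expr_time_Len poly_bounded_intros)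
next
  case (Plus a b)
  then obtain g h where time: "poly_bounded g" "add_expr_time a g" "poly_bounded h" "add_expr_time b h" by blast
  show ?case
    by (rule exI, rule conjI[OF _ add_expr_time_Plus[OF time(2,4)]]) (intro poly_bounded_intros time)
next
  case (Times a b)
  then obtain g h where time: "poly_bounded g" "add_expr_time a g" "poly_bounded h" "add_expr_time b h" by blast
  obtain v where v: "poly_bounded v" "val_bound a v" using ex_val_bound by blast
  show ?case
    by (rule exI, rule conjI[OF _ add_expr_time_Times[OF time(2,4) v(2)]]) (intro poly_bounded_intros time v)
next
  case (Minus a b)
  then obtain g h where time: "poly_bounded g" "add_expr_time a g" "poly_bounded h" "add_expr_time b h" by blast
  obtain va vb where v: "poly_bounded va" "val_bound a va" "poly_bounded vb" "val_bound b vb"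
    using ex_val_bound by blast
  show ?case
    by (rule exI, rule conjI[OF _ add_expr_time_Minus[OF time(2,4) v(2,4)]]) (intro poly_bounded_intros time v)
next
  case (Sym a b)
  then obtain g h where time: "poly_bounded g" "add_expr_time a g" "poly_bounded h" "add_expr_time b h" by blast
  obtain va vb where v: "poly_bounded va" "val_bound a va" "poly_bounded vb" "val_bound b vb"
    using ex_val_bound by blast
  show ?case
    by (rule exI, rule conjI[OF _ add_expr_time_Sym[OF time(2,4) v(2,4)]]) (intro poly_bounded_intros time v)
qed

subsection \<open>A language for emitting words\<close>

datatype stm = Emit bool | Nop | Then stm stm | IfZ expr stm stm | For expr stm | EmitBin expr

text \<open>At level \<open>f\<close>, a loop keeps its index in counter \<open>f\<close> and the number of remaining rounds in
  counter \<open>f + 1\<close>.\<close>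

primrec emitted :: "bool list \<Rightarrow> stm \<Rightarrow> nat \<Rightarrow> (nat \<Rightarrow> nat) \<Rightarrow> bool list" where
  "emitted w (Emit b) f \<rho> = [b]"
| "emitted w Nop f \<rho> = []"
| "emitted w (Then s t) f \<rho> = emitted w s f \<rho> @ emitted w t f \<rho>"
| "emitted w (IfZ e s t) f \<rho> = (if val w \<rho> e = 0 then emitted w s f \<rho> else emitted w t f \<rho>)"
| "emitted w (For e s) f \<rho> =
     concat (map (\<lambda>i. emitted w s (f + 2) (\<rho>(f := i, f + 1 := val w \<rho> e - i))) [0..<val w \<rho> e])"
| "emitted w (EmitBin e) f \<rho> = binary (val w \<rho> e)"

primrec wf_stm :: "stm \<Rightarrow> nat \<Rightarrow> bool" where
  "wf_stm (Emit b) f = True"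
| "wf_stm Nop f = True"
| "wf_stm (Then s t) f = (wf_stm s f \<and> wf_stm t f)"
| "wf_stm (IfZ e s t) f = (var_bound e \<le> f \<and> wf_stm s f \<and> wf_stm t f)"
| "wf_stm (For e s) f = (var_bound e \<le> f \<and> wf_stm s (f + 2))"
| "wf_stm (EmitBin e) f = (var_bound e \<le> f)"

primrec counters :: "stm \<Rightarrow> nat \<Rightarrow> nat" where
  "counters (Emit b) f = f"
| "counters Nop f = f"
| "counters (Then s t) f = max (counters s f) (counters t f)"
| "counters (IfZ e s t) f = max (f + 1 + temps e) (max (counters s f) (counters t f))"
| "counters (For e s) f = max (f + 2 + temps e) (counters s (f + 2))"
| "counters (EmitBin e) f = f + 3 + temps e"

definition halve :: "nat \<Rightarrow> com" where
  "halve f = loop f (Seq (dec f) (ifzero f (inc (f + 2)) (Seq (dec f) (inc (f + 1)))))"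

definition emit_digit :: "nat \<Rightarrow> nat \<Rightarrow> com" where
  "emit_digit m f = Seq (halve f) (Seq (ifzero (f + 2) (emit m False) (Seq (dec (f + 2)) (emit m True)))
     (pour (f + 1) f))"

primrec compile :: "nat \<Rightarrow> stm \<Rightarrow> nat \<Rightarrow> com" where
  "compile m (Emit b) f = emit m b"
| "compile m Nop f = move 0"
| "compile m (Then s t) f = Seq (compile m s f) (compile m t f)"
| "compile m (IfZ e s t) f = Seq (add_expr e f (f + 1))
     (ifzero f (compile m s f) (Seq (clear f) (compile m t f)))"
| "compile m (For e s) f = Seq (add_expr e (f + 1) (f + 2))
     (Seq (loop (f + 1) (Seq (compile m s (f + 2)) (Seq (inc f) (dec (f + 1))))) (clear f))"
| "compile m (EmitBin e) f = Seq (add_expr e f (f + 1)) (loop f (emit_digit m f))"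

lemma runs_halve_body:
  assumes "f + 2 < m" "0 < a"
  shows "runs w m (Seq (dec f) (ifzero f (inc (f + 2)) (Seq (dec f) (inc (f + 1)))))
     (\<rho>(f := a, f + 1 := b, f + 2 := 0), h, ys) 6
     (if a = 1 then (\<rho>(f := 0, f + 1 := b, f + 2 := 1), h, ys)
      else (\<rho>(f := a - 2, f + 1 := b + 1, f + 2 := 0), h, ys))" (is "runs w m _ _ _ ?t")
proof -
  let ?s = "(\<rho>(f := a - 1, f + 1 := b, f + 2 := 0), h, ys)"
  have first: "runs w m (dec f) (\<rho>(f := a, f + 1 := b, f + 2 := 0), h, ys) 1 ?s"
    by (rule runs_cong[OF runs_dec]) (use assms in \<open>auto simp: fun_eq_iff\<close>)
  have branch: "runs w m (if fst ?s f = 0 then inc (f + 2) else Seq (dec f) (inc (f + 1))) ?s 3 ?t"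
  proof (cases "a = 1")
    case True
    have "runs w m (inc (f + 2)) ?s 3 ?t"
      by (rule runs_cong[OF runs_inc]) (use True assms in \<open>auto simp: fun_eq_iff\<close>)
    then show ?thesis using True by simp
  next
    case False
    have "runs w m (Seq (dec f) (inc (f + 1))) ?s 3 ?t"
      by (rule runs_cong[OF runs_Seq[OF runs_dec runs_inc]]) (use False assms in \<open>auto simp: fun_eq_iff\<close>)
    then show ?thesis using False assms by simp
  qed
  show ?thesis
    by (rule runs_cong[OF runs_Seq[OF first runs_ifzero[OF _ branch]] refl]) (use assms in simp_all)
qed

lemma runs_halve:
  assumes "f + 2 < m"
  shows "runs w m (halve f) (\<rho>(f := a, f + 1 := b, f + 2 := 0), h, ys) (8 * a + 1)
     (\<rho>(f := 0, f + 1 := b + a div 2, f + 2 := a mod 2), h, ys)"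
proof (induction a arbitrary: b rule: less_induct)
  case (less a)
  show ?case
  proof (cases "a = 0")
    case zero: True
    show ?thesis
      unfolding zero halve_def by (rule runs_cong[OF runs_loop_stop]) (use assms in auto)
  next
    case False
    have rest: "runs w m (halve f) (if a = 1 then (\<rho>(f := 0, f + 1 := b, f + 2 := 1), h, ys)
        else (\<rho>(f := a - 2, f + 1 := b + 1, f + 2 := 0), h, ys)) (8 * (a - 2) + 1)
        (\<rho>(f := 0, f + 1 := b + a div 2, f + 2 := a mod 2), h, ys)"
    proof (cases "a = 1")
      case one: True
      have "runs w m (halve f) (\<rho>(f := 0, f + 1 := b, f + 2 := 1), h, ys) 1 (\<rho>(f := 0, f + 1 := b, f + 2 := 1), h, ys)"
        unfolding halve_def by (rule runs_loop_stop) (use assms in auto)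
      then show ?thesis using one by simp
    next
      case two: False
      have "2 \<le> a" using False two by simp
      then have quotient: "b + 1 + (a - 2) div 2 = b + a div 2" "(a - 2) mod 2 = a mod 2"
        by (simp_all add: le_div_geq le_mod_geq)
      have "runs w m (halve f) (\<rho>(f := a - 2, f + 1 := b + 1, f + 2 := 0), h, ys) (8 * (a - 2) + 1)
          (\<rho>(f := 0, f + 1 := b + 1 + (a - 2) div 2, f + 2 := (a - 2) mod 2), h, ys)"
        by (rule less) (use False in simp)
      then show ?thesis unfolding quotient if_not_P[OF two] .
    qed
    show ?thesis unfolding halve_def
      by (rule runs_cong[OF runs_loop_step[OF _ _ runs_halve_body rest[unfolded halve_def]]])
        (use assms False in auto)
  qed
qed

lemma runs_emit_digit:
  assumes "f + 2 < m" "\<rho> (f + 1) = 0" "\<rho> (f + 2) = 0"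
  shows "runs w m (emit_digit m f) (\<rho>(f := a), h, ys) (16 * a + 10) (\<rho>(f := a div 2), h, ys @ [odd a])"
proof -
  have start: "\<rho>(f := a) = \<rho>(f := a, f + 1 := 0, f + 2 := 0)" using assms by (auto simp: fun_eq_iff)
  let ?s = "(\<rho>(f := 0, f + 1 := 0 + a div 2, f + 2 := a mod 2), h, ys)"
  let ?t = "(\<rho>(f := 0, f + 1 := a div 2, f + 2 := 0), h, ys @ [odd a])"
  have branch: "runs w m (if fst ?s (f + 2) = 0 then emit m False else Seq (dec (f + 2)) (emit m True)) ?s 3 ?t"
  proof (cases "even a")
    case True
    have "runs w m (emit m False) ?s 3 ?t"
      by (rule runs_cong[OF runs_emit]) (use True in \<open>auto simp: fun_eq_iff\<close>)
    then show ?thesis using True by simp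
  next
    case False
    have "runs w m (Seq (dec (f + 2)) (emit m True)) ?s 3 ?t"
      by (rule runs_cong[OF runs_Seq[OF runs_dec runs_emit]])
        (use False assms in \<open>auto simp: fun_eq_iff odd_iff_mod_2_eq_one\<close>)
    then show ?thesis using False by (simp add: odd_iff_mod_2_eq_one)
  qed
  have digit: "runs w m (ifzero (f + 2) (emit m False) (Seq (dec (f + 2)) (emit m True))) ?s (3 + 1) ?t"
    by (rule runs_ifzero[OF _ branch]) (use assms in simp)
  have quotient: "runs w m (pour (f + 1) f) ?t (a div 2 * 4 + 1)
      (\<rho>(f := a div 2), h, ys @ [odd a])"
    by (rule runs_cong[OF runs_pour]) (use assms in \<open>auto simp: fun_eq_iff\<close>)
  show ?thesis unfolding emit_digit_def
    by (subst start, rule runs_cong[OF runs_Seq[OF runs_halve[OF assms(1)] runs_Seq[OF digit quotient]] refl]) simp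
qed

lemma runs_emit_binary:
  assumes "f + 2 < m" "\<rho> (f + 1) = 0" "\<rho> (f + 2) = 0" "a \<le> k"
  shows "runs w m (loop f (emit_digit m f)) (\<rho>(f := a), h, ys) (a * (16 * k + 11) + 1)
     (\<rho>(f := 0), h, ys @ binary a)"
  using assms(4)
proof (induction a arbitrary: ys rule: less_induct)
  case (less a)
  show ?case
  proof (cases "a = 0")
    case True
    show ?thesis
      by (rule runs_cong[OF runs_loop_stop]) (use True assms in \<open>auto simp: binary.simps\<close>)
  next
    case False
    have rest: "runs w m (loop f (emit_digit m f)) (\<rho>(f := a div 2), h, ys @ [odd a])
        (a div 2 * (16 * k + 11) + 1) (\<rho>(f := 0), h, (ys @ [odd a]) @ binary (a div 2))"
      by (rule less.IH) (use False less.prems in auto)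
    have "a div 2 + 1 \<le> a" using False by linarith
    define X where "X = 16 * k + 11"
    have "(a div 2 + 1) * X \<le> a * X" using \<open>a div 2 + 1 \<le> a\<close> by (rule mult_le_mono1)
    moreover have "16 * a + 11 \<le> X" using less.prems by (simp add: X_def)
    ultimately have "16 * a + 10 + (a div 2 * X + 1) + 1 \<le> a * X + 1"
      unfolding add_mult_distrib by linarith
    then have "16 * a + 10 + (a div 2 * (16 * k + 11) + 1) + 1 \<le> a * (16 * k + 11) + 1"
      unfolding X_def .
    then show ?thesis
      by (rule runs_cong[OF runs_loop_step[OF _ _ runs_emit_digit[OF assms(1-3)] rest], rotated 3])
        (use False assms binary.simps[of a] in auto)
  qed
qed

definition compile_time :: "stm \<Rightarrow> nat \<Rightarrow> (nat \<Rightarrow> nat) \<Rightarrow> bool" where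
  "compile_time s f g \<longleftrightarrow> (\<forall>w m \<rho> N ys. counters s f \<le> m \<longrightarrow> (\<forall>r\<ge>f. \<rho> r = 0) \<longrightarrow> env_bounded w \<rho> f N \<longrightarrow>
     runs w m (compile m s f) (\<rho>, 0, ys) (g N) (\<rho>, 0, ys @ emitted w s f \<rho>))"

lemma compile_timeI:
  assumes "\<And>w m \<rho> N ys. counters s f \<le> m \<Longrightarrow> \<forall>r\<ge>f. \<rho> r = 0 \<Longrightarrow> env_bounded w \<rho> f N \<Longrightarrow>
    runs w m (compile m s f) (\<rho>, 0, ys) (g N) (\<rho>, 0, ys @ emitted w s f \<rho>)"
  shows "compile_time s f g"
  using assms unfolding compile_time_def by blast

lemma runs_compile:
  assumes "compile_time s f g" "counters s f \<le> m" "\<forall>r\<ge>f. \<rho> r = 0" "env_bounded w \<rho> f N"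
  shows "runs w m (compile m s f) (\<rho>, 0, ys) (g N) (\<rho>, 0, ys @ emitted w s f \<rho>)"
  using assms unfolding compile_time_def by blast

lemma compile_time_Then:
  assumes "compile_time s f g" "compile_time t f h"
  shows "compile_time (Then s t) f (\<lambda>N. g N + h N + 1)"
proof (rule compile_timeI)
  fix w m \<rho> N and ys :: "bool list"
  assume env: "counters (Then s t) f \<le> m" "\<forall>r\<ge>f. \<rho> r = 0" "env_bounded w \<rho> f N"
  show "runs w m (compile m (Then s t) f) (\<rho>, 0, ys) (g N + h N + 1) (\<rho>, 0, ys @ emitted w (Then s t) f \<rho>)"
    unfolding compile.simps
    by (rule runs_cong[OF runs_Seq[OF runs_compile[OF assms(1)] runs_compile[OF assms(2)]]]) (use env in auto)
qed

lemma compile_time_IfZ: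
  assumes "compile_time s f g" "compile_time t f h" "add_expr_time e k" "val_bound e v" "var_bound e \<le> f"
  shows "compile_time (IfZ e s t) f (\<lambda>N. k N + (g N + (2 * v N + 1 + h N + 1) + 1) + 1)"
proof (rule compile_timeI)
  fix w m \<rho> N and ys :: "bool list"
  assume env: "counters (IfZ e s t) f \<le> m" "\<forall>r\<ge>f. \<rho> r = 0" "env_bounded w \<rho> f N"
  note bounded = env_bounded_mono[OF env(3) assms(5)]
  let ?s = "(\<rho>(f := val w \<rho> e), 0, ys)" and ?B = "g N + (2 * v N + 1 + h N + 1)"
  have free: "\<rho>(f := 0) = \<rho>" using env by auto
  have condition: "runs w m (add_expr e f (f + 1)) (\<rho>, 0, ys) (k N) ?s"
    by (rule runs_cong[OF runs_add_expr[OF assms(3)]]) (use env bounded assms in auto)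
  have "runs w m (if fst ?s f = 0 then compile m s f else Seq (clear f) (compile m t f)) ?s ?B
      (\<rho>, 0, ys @ emitted w (IfZ e s t) f \<rho>)"
  proof (cases "val w \<rho> e = 0")
    case True
    have "runs w m (compile m s f) (\<rho>, 0, ys) ?B (\<rho>, 0, ys @ emitted w s f \<rho>)"
      by (rule runs_cong[OF runs_compile[OF assms(1)]]) (use env in auto)
    then show ?thesis using True free env(2)[rule_format, of f] by simp
  next
    case False
    have clear: "runs w m (clear f) ?s (2 * v N + 1) (\<rho>, 0, ys)"
      by (rule runs_cong[OF runs_clear]) (use env free val_boundD[OF assms(4) bounded] in auto)
    have "runs w m (Seq (clear f) (compile m t f)) ?s ?B (\<rho>, 0, ys @ emitted w t f \<rho>)"
      by (rule runs_cong[OF runs_Seq[OF clear runs_compile[OF assms(2)]]]) (use env in auto)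
    then show ?thesis using False by simp
  qed
  then have branch: "runs w m (ifzero f (compile m s f) (Seq (clear f) (compile m t f))) ?s (?B + 1)
      (\<rho>, 0, ys @ emitted w (IfZ e s t) f \<rho>)"
    by (rule runs_ifzero[rotated]) (use env in auto)
  show "runs w m (compile m (IfZ e s t) f) (\<rho>, 0, ys) (k N + (?B + 1) + 1)
      (\<rho>, 0, ys @ emitted w (IfZ e s t) f \<rho>)"
    unfolding compile.simps by (rule runs_Seq[OF condition branch])
qed

lemma compile_time_For:
  assumes "compile_time s (f + 2) g" "add_expr_time e k" "val_bound e v" "var_bound e \<le> f"
  shows "compile_time (For e s) f (\<lambda>N. k N + ((v N * (g (N + v N) + 5) + 1) + (2 * v N + 1) + 1) + 1)"
proof (rule compile_timeI)
  fix w m \<rho> N and ys :: "bool list"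
  assume env: "counters (For e s) f \<le> m" "\<forall>r\<ge>f. \<rho> r = 0" "env_bounded w \<rho> f N"
  note bounded = env_bounded_mono[OF env(3) assms(4)]
  define n where "n = val w \<rho> e"
  have n: "n \<le> v N" using val_boundD[OF assms(3) bounded] by (simp add: n_def)
  define \<sigma> where "\<sigma> j = (\<rho>(f := j, f + 1 := n - j), 0::int,
    ys @ concat (map (\<lambda>i. emitted w s (f + 2) (\<rho>(f := i, f + 1 := n - i))) [0..<j]))" for j
  have init: "runs w m (add_expr e (f + 1) (f + 2)) (\<rho>, 0, ys) (k N) (\<sigma> 0)"
    unfolding \<sigma>_def
    by (rule runs_cong[OF runs_add_expr[OF assms(2)]]) (use env bounded assms in \<open>auto simp: fun_eq_iff n_def\<close>)
  have rounds: "runs w m (loop (f + 1) (Seq (compile m s (f + 2)) (Seq (inc f) (dec (f + 1))))) (\<sigma> 0)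
      (n * (g (N + v N) + 4 + 1) + 1) (\<sigma> n)"
  proof (rule runs_loop)
    fix j assume j: "j < n"
    have bounded': "env_bounded w (\<rho>(f := j, f + 1 := n - j)) (f + 2) (N + v N)"
      using env(3) j n by (auto simp: env_bounded_def less_Suc_eq trans_le_add1)
    show "runs w m (Seq (compile m s (f + 2)) (Seq (inc f) (dec (f + 1)))) (\<sigma> j)
        (g (N + v N) + 4) (\<sigma> (Suc j))"
      unfolding \<sigma>_def
      by (rule runs_cong[OF runs_Seq[OF runs_compile[OF assms(1) _ _ bounded'] runs_Seq[OF runs_inc runs_dec]]])
        (use env j in \<open>auto simp: fun_eq_iff\<close>)
  qed (use env in \<open>auto simp: \<sigma>_def\<close>)
  have final: "runs w m (clear f) (\<sigma> n) (2 * v N + 1) (\<rho>, 0, ys @ emitted w (For e s) f \<rho>)"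
    unfolding \<sigma>_def
    by (rule runs_cong[OF runs_clear]) (use env n in \<open>auto simp: fun_eq_iff n_def\<close>)
  have "n * (g (N + v N) + 4 + 1) \<le> v N * (g (N + v N) + 5)" using n by (rule mult_le_mono) simp
  then show "runs w m (compile m (For e s) f) (\<rho>, 0, ys)
      (k N + ((v N * (g (N + v N) + 5) + 1) + (2 * v N + 1) + 1) + 1) (\<rho>, 0, ys @ emitted w (For e s) f \<rho>)"
    unfolding compile.simps by (intro runs_cong[OF runs_Seq[OF init runs_Seq[OF rounds final]] refl]) linarith
qed

lemma compile_time_EmitBin:
  assumes "add_expr_time e k" "val_bound e v" "var_bound e \<le> f"
  shows "compile_time (EmitBin e) f (\<lambda>N. k N + (v N * (16 * v N + 11) + 1) + 1)"
proof (rule compile_timeI)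
  fix w m \<rho> N and ys :: "bool list"
  assume env: "counters (EmitBin e) f \<le> m" "\<forall>r\<ge>f. \<rho> r = 0" "env_bounded w \<rho> f N"
  note bounded = env_bounded_mono[OF env(3) assms(3)]
  have number: "runs w m (add_expr e f (f + 1)) (\<rho>, 0, ys) (k N) (\<rho>(f := val w \<rho> e), 0, ys)"
    by (rule runs_cong[OF runs_add_expr[OF assms(1)]]) (use env bounded assms in auto)
  have digits: "runs w m (loop f (emit_digit m f)) (\<rho>(f := val w \<rho> e), 0, ys)
      (val w \<rho> e * (16 * v N + 11) + 1) (\<rho>(f := 0), 0, ys @ binary (val w \<rho> e))"
    by (rule runs_emit_binary) (use env val_boundD[OF assms(2) bounded] in auto)
  have "val w \<rho> e * (16 * v N + 11) \<le> v N * (16 * v N + 11)"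
    using val_boundD[OF assms(2) bounded] by (rule mult_le_mono1)
  then show "runs w m (compile m (EmitBin e) f) (\<rho>, 0, ys) (k N + (v N * (16 * v N + 11) + 1) + 1)
      (\<rho>, 0, ys @ emitted w (EmitBin e) f \<rho>)"
    unfolding compile.simps
    by (intro runs_cong[OF runs_Seq[OF number digits]]) (use env in \<open>auto simp: fun_eq_iff\<close>)
qed

lemma ex_compile_time: "wf_stm s f \<Longrightarrow> \<exists>g. poly_bounded g \<and> compile_time s f g"
proof (induction s arbitrary: f)
  case (Emit b)
  have "compile_time (Emit b) f (\<lambda>_. 1)" by (rule compile_timeI) (auto intro!: runs_cong[OF runs_emit])
  then show ?case using poly_bounded_const by blast
next
  case Nop
  have "compile_time Nop f (\<lambda>_. 1)" by (rule compile_timeI) (auto intro!: runs_cong[OF runs_move])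
  then show ?case using poly_bounded_const by blast
next
  case (Then s t)
  then obtain g h where time: "poly_bounded g" "compile_time s f g" "poly_bounded h" "compile_time t f h"
    using wf_stm.simps(3) by blast
  show ?case
    by (rule exI, rule conjI[OF _ compile_time_Then[OF time(2,4)]]) (intro poly_bounded_intros time)
next
  case (IfZ e s t)
  then obtain g h where time: "poly_bounded g" "compile_time s f g" "poly_bounded h" "compile_time t f h"
    using wf_stm.simps(4) by blast
  obtain k v where e: "poly_bounded k" "add_expr_time e k" "poly_bounded v" "val_bound e v"
    using ex_add_expr_time ex_val_bound by blast
  have "var_bound e \<le> f" using IfZ.prems by simp
  then show ?case
    by (intro exI[of _ "\<lambda>N. k N + (g N + (2 * v N + 1 + h N + 1) + 1) + 1"] conjI
        compile_time_IfZ[OF time(2,4) e(2,4)] poly_bounded_intros time e)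
next
  case (For e s)
  then obtain g where time: "poly_bounded g" "compile_time s (f + 2) g" using wf_stm.simps(5) by blast
  obtain k v where e: "poly_bounded k" "add_expr_time e k" "poly_bounded v" "val_bound e v"
    using ex_add_expr_time ex_val_bound by blast
  have "poly_bounded (\<lambda>N. g (N + v N))" by (intro poly_bounded_comp[OF time(1)] poly_bounded_intros e) simp
  moreover have "var_bound e \<le> f" using For.prems by simp
  ultimately show ?case
    by (intro exI[of _ "\<lambda>N. k N + ((v N * (g (N + v N) + 5) + 1) + (2 * v N + 1) + 1) + 1"] conjI
        compile_time_For[OF time(2) e(2,4)] poly_bounded_intros e)
next
  case (EmitBin e)
  obtain k v where e: "poly_bounded k" "add_expr_time e k" "poly_bounded v" "val_bound e v"
    using ex_add_expr_time ex_val_bound by blast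
  have "var_bound e \<le> f" using EmitBin.prems by simp
  then show ?case
    by (intro exI[of _ "\<lambda>N. k N + (v N * (16 * v N + 11) + 1) + 1"] conjI
        compile_time_EmitBin[OF e(2,4)] poly_bounded_intros e)
qed

lemma wf_com_add_expr: "wf_com (add_expr e z f)"
proof (induction e arbitrary: z f)
  case (Num c)
  show ?case by (induction c) (auto simp: inc_def move_def)
qed (auto simp: inc_def dec_def move_def loop_def transfer_def pour_def shift_def subtract_def add_symbol_def)

lemma wf_com_compile: "wf_com (compile m s f)"
  by (induction s arbitrary: f) (auto simp: inc_def dec_def move_def loop_def emit_def ifzero_def
    clear_def pour_def halve_def emit_digit_def wf_com_add_expr)

primrec mark :: "nat \<Rightarrow> com" where
  "mark 0 = move 0"
| "mark (Suc r) = Seq (mark r) (Act (Suc r) (\<lambda>s. (1, 0)))"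

lemma exec_mark:
  "r \<le> m \<Longrightarrow> \<exists>t\<le>2 * r + 1. exec (mark r) ((word_contents w, 0) # replicate (m + 1) (word_contents [], 0)) t
     ((word_contents w, 0) # replicate r (counter_tape 0) @ replicate (m + 1 - r) (word_contents [], 0))"
proof (induction r)
  case 0
  show ?case
    using exec_Act[of 0 "(word_contents w, 0) # replicate (m + 1) (word_contents [], 0)" "\<lambda>s. (s, 0)"]
    by (intro exI[of _ 1]) (auto simp: move_def act_tape_def read_tape_def)
next
  case (Suc r)
  let ?ts = "(word_contents w, 0) # replicate r (counter_tape 0) @ replicate (m + 1 - r) (word_contents [], 0)"
  obtain t where t: "t \<le> 2 * r + 1"
    "exec (mark r) ((word_contents w, 0) # replicate (m + 1) (word_contents [], 0)) t ?ts"
    using Suc by auto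
  have c0: "act_tape (1, 0) (word_contents [], 0) = counter_tape 0"
    by (auto simp: act_tape_def counter_tape_def word_contents_def fun_eq_iff)
  have nth: "?ts ! Suc r = (word_contents [], 0)" using Suc.prems by (simp add: nth_append)
  define B :: "tape list" where "B = replicate (m - r) (word_contents [], 0)"
  have ts: "?ts = (word_contents w, 0) # replicate r (counter_tape 0) @ (word_contents [], 0) # B"
    using Suc.prems by (simp add: B_def Suc_diff_le)
  have upd: "?ts[Suc r := counter_tape 0] = (word_contents w, 0) # replicate (Suc r) (counter_tape 0) @
      replicate (m + 1 - Suc r) (word_contents [], 0)"
    unfolding ts by (simp add: list_update_append B_def replicate_app_Cons_same)
  have "exec (Act (Suc r) (\<lambda>s. (1, 0))) ?ts 1 (?ts[Suc r := act_tape (1, 0) (?ts ! Suc r)])"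
    using exec_Act[of "Suc r" ?ts "\<lambda>s. (1, 0)"] Suc.prems by simp
  then have "exec (Act (Suc r) (\<lambda>s. (1, 0))) ?ts 1 ((word_contents w, 0) # replicate (Suc r) (counter_tape 0) @
      replicate (m + 1 - Suc r) (word_contents [], 0))"
    unfolding nth c0 upd .
  from exec_Seq[OF t(2) this] show ?case using t(1)
    by (intro exI[of _ "Suc (t + 1)"]) (simp del: replicate.simps)
qed

lemma exec_emitted:
  assumes s: "compile_time s 0 g" and m: "m = counters s 0"
  shows "\<exists>t\<le>2 * m + 2 + g (length w + 2).
    exec (Seq (mark m) (compile m s 0)) ((word_contents w, 0) # replicate (m + 1) (word_contents [], 0)) t
      (conf w m (\<lambda>_. 0, 0, emitted w s 0 (\<lambda>_. 0)))"
proof -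
  have "(word_contents w, 0) # replicate m (counter_tape 0) @ replicate (m + 1 - m) (word_contents [], 0) =
      conf w m (\<lambda>_. 0, 0, [])"
    by (simp add: conf_def map_replicate_const)
  then obtain t where t: "t \<le> 2 * m + 1"
    "exec (mark m) ((word_contents w, 0) # replicate (m + 1) (word_contents [], 0)) t (conf w m (\<lambda>_. 0, 0, []))"
    using exec_mark[of m m w] by auto
  have "env_bounded w (\<lambda>_. 0) 0 (length w + 2)" by (simp add: env_bounded_def)
  then have "runs w m (compile m s 0) (\<lambda>_. 0, 0, []) (g (length w + 2)) (\<lambda>_. 0, 0, [] @ emitted w s 0 (\<lambda>_. 0))"
    by (intro runs_compile[OF s]) (simp_all add: m)
  then obtain u where u: "u \<le> g (length w + 2)"
    "exec (compile m s 0) (conf w m (\<lambda>_. 0, 0, [])) u (conf w m (\<lambda>_. 0, 0, emitted w s 0 (\<lambda>_. 0)))"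
    unfolding runs_def by auto
  show ?thesis using exec_Seq[OF t(2) u(2)] t(1) u(1) by (intro exI[of _ "Suc (t + u)"]) simp
qed

theorem polytime_computable_emitted:
  assumes "wf_stm s 0"
  shows "polytime_computable (\<lambda>w. emitted w s 0 (\<lambda>_. 0))"
proof -
  define m where "m = counters s 0"
  obtain g k where g: "compile_time s 0 g" and k: "\<And>N. N \<ge> 2 \<Longrightarrow> g N \<le> N ^ k"
    using ex_compile_time[OF assms] unfolding poly_bounded_def by blast
  have "wf_com (mark r)" for r by (induction r) (auto simp: move_def)
  then have "wf_com (Seq (mark m) (compile m s 0))" by (simp add: wf_com_compile)
  then obtain M where M: "wf_tm M" "deterministic M" "num_tapes M = m + 2"
    and simulates: "\<And>ts t us. ternary (m + 2) ts \<Longrightarrow> exec (Seq (mark m) (compile m s 0)) ts t us \<Longrightarrow>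
        \<exists>d. (tm_step M ^^ t) (0, ts) d \<and> halted M d \<and> snd d = us"
    by (rule tm_of_com[where n = "m + 2"]) auto
  define p :: "nat poly" where "p = [:2, 1:] ^ k + [:2 * m + 2:]"
  have "\<exists>t d. t \<le> poly p (length w) \<and> (tm_step M ^^ t) (init_config M w) d \<and>
      halted M d \<and> fst (last (snd d)) = word_contents (emitted w s 0 (\<lambda>_. 0))" for w
  proof -
    let ?ts = "(word_contents w, 0) # replicate (m + 1) (word_contents [], 0)"
    have init: "init_config M w = (0, ?ts)" by (simp add: init_config_def M)
    have "ternary (m + 2) ?ts" by (auto simp: ternary_def word_contents_def)
    moreover obtain t where t: "t \<le> 2 * m + 2 + g (length w + 2)"
      and "exec (Seq (mark m) (compile m s 0)) ?ts t (conf w m (\<lambda>_. 0, 0, emitted w s 0 (\<lambda>_. 0)))"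
      using exec_emitted[OF g m_def] by blast
    ultimately obtain d where d: "(tm_step M ^^ t) (0, ?ts) d" "halted M d"
      "snd d = conf w m (\<lambda>_. 0, 0, emitted w s 0 (\<lambda>_. 0))" using simulates by blast
    have "g (length w + 2) \<le> (length w + 2) ^ k" by (rule k) simp
    then have "t \<le> poly p (length w)" using t by (simp add: p_def poly_power add.commute)
    moreover have "fst (last (snd d)) = word_contents (emitted w s 0 (\<lambda>_. 0))" by (simp add: d(3) conf_def)
    ultimately show ?thesis using d init by metis
  qed
  then show ?thesis unfolding polytime_computable_def using M by blast
qed

subsection \<open>Finite case distinctions\<close>

text \<open>A program can branch on the value of \<open>T\<close>, provided that the values of the variables satisfy \<open>R\<close>.\<close>

definition branchable ::
  "nat \<Rightarrow> (bool list \<Rightarrow> (nat \<Rightarrow> nat) \<Rightarrow> bool) \<Rightarrow> (bool list \<Rightarrow> (nat \<Rightarrow> nat) \<Rightarrow> 'a) \<Rightarrow> bool" where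
  "branchable f R T \<longleftrightarrow> (\<forall>s. (\<forall>c. wf_stm (s c) f) \<longrightarrow>
     (\<exists>u. wf_stm u f \<and> (\<forall>w \<rho>. R w \<rho> \<longrightarrow> emitted w u f \<rho> = emitted w (s (T w \<rho>)) f \<rho>)))"

lemma branchable_cong:
  "branchable f R X \<Longrightarrow> (\<And>w \<rho>. R w \<rho> \<Longrightarrow> X w \<rho> = Y w \<rho>) \<Longrightarrow> branchable f R Y"
  unfolding branchable_def by simp

lemma branchable_const: "branchable f R (\<lambda>w \<rho>. c)"
  unfolding branchable_def by blast

lemma branchable_map:
  fixes g :: "'a \<Rightarrow> 'b"
  assumes "branchable f R X"
  shows "branchable f R (\<lambda>w \<rho>. g (X w \<rho>))"
  unfolding branchable_def
proof (intro allI impI)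
  fix s :: "'b \<Rightarrow> stm" assume "\<forall>c. wf_stm (s c) f"
  then show "\<exists>u. wf_stm u f \<and> (\<forall>w \<rho>. R w \<rho> \<longrightarrow> emitted w u f \<rho> = emitted w (s (g (X w \<rho>))) f \<rho>)"
    using assms[unfolded branchable_def, rule_format, of "\<lambda>c. s (g c)"] by blast
qed

lemma branchable_Pair:
  fixes X :: "bool list \<Rightarrow> (nat \<Rightarrow> nat) \<Rightarrow> 'a" and Y :: "bool list \<Rightarrow> (nat \<Rightarrow> nat) \<Rightarrow> 'b"
  assumes "branchable f R X" "branchable f R Y"
  shows "branchable f R (\<lambda>w \<rho>. (X w \<rho>, Y w \<rho>))"
  unfolding branchable_def
proof (intro allI impI)
  fix s :: "'a \<times> 'b \<Rightarrow> stm" assume s: "\<forall>c. wf_stm (s c) f"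
  have "\<forall>c. \<exists>u. wf_stm u f \<and> (\<forall>w \<rho>. R w \<rho> \<longrightarrow> emitted w u f \<rho> = emitted w (s (c, Y w \<rho>)) f \<rho>)"
    using assms(2)[unfolded branchable_def, rule_format, of "\<lambda>d. s (c, d)" for c] s by blast
  then obtain t where t: "\<And>c. wf_stm (t c) f"
    "\<And>c w \<rho>. R w \<rho> \<Longrightarrow> emitted w (t c) f \<rho> = emitted w (s (c, Y w \<rho>)) f \<rho>" by metis
  then show "\<exists>u. wf_stm u f \<and> (\<forall>w \<rho>. R w \<rho> \<longrightarrow> emitted w u f \<rho> = emitted w (s (X w \<rho>, Y w \<rho>)) f \<rho>)"
    using assms(1)[unfolded branchable_def, rule_format, of t] by metis
qed

lemma branchable_not: "branchable f R P \<Longrightarrow> branchable f R (\<lambda>w \<rho>. \<not> P w \<rho>)"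
  by (rule branchable_map)

lemma branchable_conj:
  assumes "branchable f R P" "branchable f R Q"
  shows "branchable f R (\<lambda>w \<rho>. P w \<rho> \<and> Q w \<rho>)"
  using branchable_map[OF branchable_Pair[OF assms], of "\<lambda>(p, q). p \<and> q"] by simp

lemma branchable_disj:
  assumes "branchable f R P" "branchable f R Q"
  shows "branchable f R (\<lambda>w \<rho>. P w \<rho> \<or> Q w \<rho>)"
  using branchable_map[OF branchable_Pair[OF assms], of "\<lambda>(p, q). p \<or> q"] by simp

lemma branchable_if:
  assumes "branchable f R P" "branchable f R X" "branchable f R Y"
  shows "branchable f R (\<lambda>w \<rho>. if P w \<rho> then X w \<rho> else Y w \<rho>)"
  using branchable_map[OF branchable_Pair[OF assms(1) branchable_Pair[OF assms(2,3)]], of "\<lambda>(p, x, y). if p then x else y"]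
  by simp

lemma branchable_le:
  assumes "var_bound a \<le> f" "var_bound b \<le> f"
  shows "branchable f R (\<lambda>w \<rho>. val w \<rho> a \<le> val w \<rho> b)"
  unfolding branchable_def
proof (intro allI impI)
  fix s :: "bool \<Rightarrow> stm" assume "\<forall>c. wf_stm (s c) f"
  then show "\<exists>u. wf_stm u f \<and> (\<forall>w \<rho>. R w \<rho> \<longrightarrow> emitted w u f \<rho> = emitted w (s (val w \<rho> a \<le> val w \<rho> b)) f \<rho>)"
    using assms by (intro exI[of _ "IfZ (Minus a b) (s True) (s False)"]) simp
qed

lemma branchable_eq:
  assumes "var_bound a \<le> f" "var_bound b \<le> f"
  shows "branchable f R (\<lambda>w \<rho>. val w \<rho> a = val w \<rho> b)"
  using branchable_conj[OF branchable_le[OF assms] branchable_le[OF assms(2,1)], of R]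
  by (rule branchable_cong) auto

lemma branchable_val:
  assumes e: "var_bound e \<le> f" and less: "\<And>w \<rho>. R w \<rho> \<Longrightarrow> val w \<rho> e < n"
  shows "branchable f R (\<lambda>w \<rho>. val w \<rho> e)"
proof (rule branchable_cong)
  show "branchable f R (\<lambda>w \<rho>. min (val w \<rho> e) n)"
  proof (induction n)
    case (Suc n)
    have "branchable f R (\<lambda>w \<rho>. val w \<rho> e \<le> val w \<rho> (Num n))" using e by (intro branchable_le) simp_all
    then have "branchable f R (\<lambda>w \<rho>. if val w \<rho> e \<le> n then min (val w \<rho> e) n else Suc n)"
      by (intro branchable_if Suc branchable_const) simp
    then show ?case by (rule branchable_cong) auto
  qed (simp add: branchable_const)
  show "min (val w \<rho> e) n = val w \<rho> e" if "R w \<rho>" for w \<rho> using less[OF that] by simp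
qed

lemma branchable_emit:
  assumes "branchable f R P"
  obtains u where "wf_stm u f" "\<And>w \<rho>. R w \<rho> \<Longrightarrow> emitted w u f \<rho> = [P w \<rho>]"
  using assms[unfolded branchable_def, rule_format, of Emit] by auto

subsection \<open>Emitting graphs\<close>

text \<open>Nested loops run through the numbers that are given by their digits in a mixed radix system; the
  digits are stored in the counters \<open>f\<close>, \<open>f + 2\<close>, \<open>f + 4\<close>, ...\<close>

abbreviation const_val :: "bool list \<Rightarrow> expr \<Rightarrow> nat" where "const_val w e \<equiv> val w (\<lambda>_. 0) e"

primrec nest :: "expr list \<Rightarrow> stm \<Rightarrow> stm" where
  "nest [] s = s"
| "nest (e # es) s = For e (nest es s)"

primrec radix_expr :: "expr list \<Rightarrow> nat \<Rightarrow> expr \<Rightarrow> expr" where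
  "radix_expr [] f k = k"
| "radix_expr (e # es) f k = radix_expr es (f + 2) (Plus (Times k e) (Var f))"

definition radix_val :: "bool list \<Rightarrow> expr list \<Rightarrow> nat \<Rightarrow> (nat \<Rightarrow> nat) \<Rightarrow> nat" where
  "radix_val w es f \<rho> = val w \<rho> (radix_expr es f (Num 0))"

definition radix_digits :: "bool list \<Rightarrow> expr list \<Rightarrow> nat \<Rightarrow> (nat \<Rightarrow> nat) \<Rightarrow> bool" where
  "radix_digits w es f \<rho> \<longleftrightarrow> (\<forall>i<length es. \<rho> (f + 2 * i) < const_val w (es ! i))"

definition radix_range :: "bool list \<Rightarrow> expr list \<Rightarrow> nat" where
  "radix_range w es = prod_list (map (const_val w) es)"

lemma val_closed: "var_bound e = 0 \<Longrightarrow> val w \<rho> e = const_val w e"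
  by (induction e) auto

lemma val_radix_expr_cong:
  "val w \<rho> k = val w \<rho> k' \<Longrightarrow> val w \<rho> (radix_expr es f k) = val w \<rho> (radix_expr es f k')"
  by (induction es arbitrary: f k k') simp_all

lemma var_bound_radix_expr:
  "\<forall>e\<in>set es. var_bound e = 0 \<Longrightarrow> var_bound k \<le> f \<Longrightarrow> var_bound (radix_expr es f k) \<le> f + 2 * length es"
proof (induction es arbitrary: f k)
  case (Cons e es)
  then show ?case using Cons.IH[of "Plus (Times k e) (Var f)" "f + 2"] by simp
qed simp

lemma radix_digits_Cons:
  "radix_digits w (e # es) f \<rho> \<longleftrightarrow> \<rho> f < const_val w e \<and> radix_digits w es (f + 2) \<rho>"
proof -
  have "(\<forall>i<length (e # es). \<rho> (f + 2 * i) < const_val w ((e # es) ! i)) \<longleftrightarrow>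
      \<rho> f < const_val w e \<and> (\<forall>i<length es. \<rho> (f + 2 * Suc i) < const_val w (es ! i))"
    by (simp only: length_Cons All_less_Suc2 nth_Cons_0 nth_Cons_Suc mult_0_right add_0_right)
  then show ?thesis by (simp add: radix_digits_def)
qed

lemma wf_nest:
  "\<forall>e\<in>set es. var_bound e = 0 \<Longrightarrow> wf_stm s (f + 2 * length es) \<Longrightarrow> wf_stm (nest es s) f"
  by (induction es arbitrary: f) (auto simp: add.assoc)

lemma concat_map_upt_blocks:
  "concat (map (\<lambda>i. concat (map F [(a + i) * m..<(a + i + 1) * m])) [0..<n]) = concat (map F [a * m..<(a + n) * m])"
proof (induction n)
  case (Suc n)
  have "(a + Suc n) * m = (a + n) * m + m" "(a + n + 1) * m = (a + n) * m + m" by (simp_all add: algebra_simps)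
  then have "[a * m..<(a + Suc n) * m] = [a * m..<(a + n) * m] @ [(a + n) * m..<(a + n + 1) * m]"
    by (simp only:) (rule upt_add_eq_append, simp)
  then show ?case using Suc by simp
qed simp

lemma emitted_nest:
  assumes "\<forall>e\<in>set es. var_bound e = 0"
    and "\<And>\<rho>'. (\<And>i. i < f \<Longrightarrow> \<rho>' i = \<rho> i) \<Longrightarrow> radix_digits w es f \<rho>' \<Longrightarrow>
      emitted w s (f + 2 * length es) \<rho>' = F (val w \<rho>' (radix_expr es f (Num k)))"
  shows "emitted w (nest es s) f \<rho> = concat (map F [k * radix_range w es..<(k + 1) * radix_range w es])"
  using assms
proof (induction es arbitrary: f \<rho> k)
  case Nil
  have "emitted w s f \<rho> = F k" using Nil.prems(2)[of \<rho>] by (simp add: radix_digits_def)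
  moreover have "[k * 1..<(k + 1) * 1] = [k]" by simp
  ultimately show ?case by (simp add: radix_range_def)
next
  case (Cons e es)
  define n m where "n = const_val w e" and "m = radix_range w es"
  have e: "val w \<rho>' e = n" for \<rho>' using Cons.prems(1) val_closed[of e w \<rho>'] by (simp add: n_def)
  have body: "emitted w (nest es s) (f + 2) (\<rho>(f := i, f + 1 := n - i)) =
      concat (map F [(k * n + i) * m..<(k * n + i + 1) * m])" if i: "i < n" for i
    unfolding m_def
  proof (rule Cons.IH)
    fix \<rho>'
    assume same: "\<And>j. j < f + 2 \<Longrightarrow> \<rho>' j = (\<rho>(f := i, f + 1 := n - i)) j"
      and digits: "radix_digits w es (f + 2) \<rho>'"
    have digit: "\<rho>' f = i" using same[of f] by simp
    then have "val w \<rho>' (radix_expr (e # es) f (Num k)) = val w \<rho>' (radix_expr es (f + 2) (Num (k * n + i)))"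
      by (simp add: e) (rule val_radix_expr_cong, simp add: e)
    moreover have "\<rho>' j = \<rho> j" if "j < f" for j using same[of j] that by simp
    then have "emitted w s (f + 2 * length (e # es)) \<rho>' = F (val w \<rho>' (radix_expr (e # es) f (Num k)))"
      using digits digit i by (intro Cons.prems(2)) (simp_all add: radix_digits_Cons n_def)
    ultimately show "emitted w s (f + 2 + 2 * length es) \<rho>' = F (val w \<rho>' (radix_expr es (f + 2) (Num (k * n + i))))"
      by simp
  qed (use Cons.prems(1) in simp)
  have "emitted w (nest (e # es) s) f \<rho> =
      concat (map (\<lambda>i. emitted w (nest es s) (f + 2) (\<rho>(f := i, f + 1 := n - i))) [0..<n])"
    by (simp add: e)
  also have "\<dots> = concat (map (\<lambda>i. concat (map F [(k * n + i) * m..<(k * n + i + 1) * m])) [0..<n])"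
    by (intro arg_cong[of _ _ concat] map_cong refl body) simp
  also have "\<dots> = concat (map F [k * n * m..<(k * n + n) * m])" by (rule concat_map_upt_blocks)
  finally show ?case by (simp add: radix_range_def n_def m_def algebra_simps)
qed

lemma radix_digits_below_cong:
  assumes "\<And>i. i < f + 2 * length es \<Longrightarrow> \<rho>' i = \<rho> i"
  shows "radix_digits w es f \<rho>' \<longleftrightarrow> radix_digits w es f \<rho>"
  using assms unfolding radix_digits_def by simp

lemma val_below_cong: "(\<And>i. i < var_bound e \<Longrightarrow> \<rho>' i = \<rho> i) \<Longrightarrow> val w \<rho>' e = val w \<rho> e"
  by (induction e) auto

lemma emitted_matrix:
  fixes F :: "nat \<Rightarrow> nat \<Rightarrow> bool"
  assumes es: "\<forall>e\<in>set es. var_bound e = 0" and f: "f = 2 * length es"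
    and u: "\<And>\<rho>. radix_digits w es 0 \<rho> \<Longrightarrow> radix_digits w es f \<rho> \<Longrightarrow>
      emitted w u (f + f) \<rho> = [F (radix_val w es 0 \<rho>) (radix_val w es f \<rho>)]"
  shows "emitted w (nest es (nest es u)) 0 \<rho> =
    concat (map (\<lambda>i. map (F i) [0..<radix_range w es]) [0..<radix_range w es])"
proof -
  have bound: "var_bound (radix_expr es 0 (Num 0)) \<le> f" using var_bound_radix_expr[OF es, of "Num 0" 0] f by simp
  have inner: "emitted w (nest es u) (0 + f) \<sigma> = map (F (val w \<sigma> (radix_expr es 0 (Num 0)))) [0..<radix_range w es]"
    if outer_digits: "radix_digits w es 0 \<sigma>" for \<sigma>
  proof -
    have "emitted w (nest es u) f \<sigma> = concat (map (\<lambda>j. [F (val w \<sigma> (radix_expr es 0 (Num 0))) j])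
        [0 * radix_range w es..<(0 + 1) * radix_range w es])"
    proof (rule emitted_nest[OF es])
      fix \<rho>' assume same: "\<And>i. i < f \<Longrightarrow> \<rho>' i = \<sigma> i" and digits: "radix_digits w es f \<rho>'"
      have "radix_digits w es 0 \<rho>'" using outer_digits radix_digits_below_cong[of 0 es \<rho>' \<sigma> w] same f by simp
      moreover have "radix_val w es 0 \<rho>' = val w \<sigma> (radix_expr es 0 (Num 0))"
        unfolding radix_val_def by (rule val_below_cong) (use bound same in simp)
      ultimately show "emitted w u (f + 2 * length es) \<rho>' =
          [F (val w \<sigma> (radix_expr es 0 (Num 0))) (val w \<rho>' (radix_expr es f (Num 0)))]"
        using u[OF _ digits] by (simp add: radix_val_def f)
    qed
    then show ?thesis by (simp add: concat_map_singleton)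
  qed
  have "emitted w (nest es (nest es u)) 0 \<rho> = concat (map (\<lambda>i. map (F i) [0..<radix_range w es])
      [0 * radix_range w es..<(0 + 1) * radix_range w es])"
    by (rule emitted_nest[OF es]) (use inner f in simp)
  then show ?thesis by simp
qed

theorem polytime_computable_encode_instance:
  assumes es: "\<forall>e\<in>set es. var_bound e = 0" and k: "var_bound k = 0" and f: "f = 2 * length es"
    and verts: "\<And>w. verts (G w) = {..<radix_range w es}"
    and adjacent: "branchable (f + f) (\<lambda>w \<rho>. radix_digits w es 0 \<rho> \<and> radix_digits w es f \<rho>)
      (\<lambda>w \<rho>. {radix_val w es 0 \<rho>, radix_val w es f \<rho>} \<in> edges (G w))"
  shows "polytime_computable (\<lambda>w. encode_instance (G w, const_val w k))"
proof -
  obtain u where u: "wf_stm u (f + f)"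
    "\<And>w \<rho>. radix_digits w es 0 \<rho> \<and> radix_digits w es f \<rho> \<Longrightarrow>
      emitted w u (f + f) \<rho> = [{radix_val w es 0 \<rho>, radix_val w es f \<rho>} \<in> edges (G w)]"
    using branchable_emit[OF adjacent] by metis
  define size where "size = foldr Times es (Num 1)"
  define s where "s = Then (For size (Emit True)) (Then (Emit False) (Then (nest es (nest es u)) (EmitBin k)))"
  have size: "var_bound size = 0 \<and> const_val w size = radix_range w es" for w
    using es unfolding size_def radix_range_def by (induction es) auto
  have "wf_stm (nest es (nest es u)) 0" using u(1) es f by (intro wf_nest) simp_all
  then have wf: "wf_stm s 0" using size k by (simp add: s_def)
  have "emitted w s 0 (\<lambda>_. 0) = encode_instance (G w, const_val w k)" for w
  proof -
    have "emitted w (nest es (nest es u)) 0 (\<lambda>_. 0) =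
        concat (map (\<lambda>i. map (\<lambda>j. {i, j} \<in> edges (G w)) [0..<radix_range w es]) [0..<radix_range w es])"
      by (rule emitted_matrix[OF es f]) (use u(2) in blast)
    then show ?thesis
      by (simp add: s_def size encode_instance_def verts Let_def concat_map_singleton map_replicate_const)
  qed
  then show ?thesis using polytime_computable_emitted[OF wf] by simp
qed

lemma expr_of_poly: "\<exists>e. var_bound e = 0 \<and> (\<forall>w \<rho>. val w \<rho> e = poly p (length w))"
proof (induction p rule: pCons_induct)
  case 0
  show ?case by (intro exI[of _ "Num 0"]) simp
next
  case (pCons a p)
  then obtain e where "var_bound e = 0" "\<forall>w \<rho>. val w \<rho> e = poly p (length w)" by blast
  then show ?case by (intro exI[of _ "Plus (Num a) (Times Len e)"]) simp
qed

section \<open>Line graphs\<close>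

locale incidence =
  fixes ends :: "'e \<Rightarrow> 'p set"
  assumes card_ends: "card (ends e) = 2" and ends_inject: "ends e = ends f \<Longrightarrow> e = f"
begin

lemma finite_ends [simp]: "finite (ends e)"
  by (rule card_ge_0_finite) (simp add: card_ends)

lemma ends_eq: "p \<in> ends e \<Longrightarrow> q \<in> ends e \<Longrightarrow> p \<noteq> q \<Longrightarrow> ends e = {p, q}"
  using card_ends[of e] by (auto simp: card_2_iff)

lemma common_end_unique:
  assumes "e \<noteq> f" "p \<in> ends e" "p \<in> ends f" "q \<in> ends e" "q \<in> ends f"
  shows "p = q"
  using assms ends_eq[of p _ q] ends_inject by metis

definition incident :: "'e set \<Rightarrow> 'p \<Rightarrow> 'e set" where "incident E p = {e \<in> E. p \<in> ends e}"

lemma finite_incident [simp]: "finite E \<Longrightarrow> finite (incident E p)"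
  by (simp add: incident_def)

lemma sum_card_incident:
  assumes "finite F" "finite P" "\<And>e. e \<in> F \<Longrightarrow> ends e \<subseteq> P"
  shows "(\<Sum>p\<in>P. card (incident F p)) = 2 * card F"
proof -
  have "(\<Sum>p\<in>P. card (incident F p)) = (\<Sum>p\<in>P. \<Sum>e\<in>F. if p \<in> ends e then 1 else 0)"
    using assms(1) by (intro sum.cong refl) (simp add: incident_def sum.If_cases Int_def)
  also have "\<dots> = (\<Sum>e\<in>F. \<Sum>p\<in>P. if p \<in> ends e then 1 else 0)" by (rule sum.swap)
  also have "\<dots> = (\<Sum>e\<in>F. 2)"
  proof (intro sum.cong refl)
    fix e assume "e \<in> F"
    then have "P \<inter> {p. p \<in> ends e} = ends e" using assms(3) by blast
    then show "(\<Sum>p\<in>P. if p \<in> ends e then 1 else 0) = (2::nat)"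
      using assms(2) card_ends[of e] by (simp add: sum.If_cases)
  qed
  finally show ?thesis by simp
qed

end

text \<open>The vertices of the line graph of the edge set \<open>E\<close> are numbers, and \<open>\<epsilon> u\<close> is the edge with number
  \<open>u\<close>. A number whose edge does not belong to \<open>E\<close> is an isolated vertex.\<close>

locale numbered_line_graph = incidence ends for ends :: "'e \<Rightarrow> 'p::countable set" +
  fixes n :: nat and \<epsilon> :: "nat \<Rightarrow> 'e" and E :: "'e set"
  assumes inj: "inj_on \<epsilon> {..<n}" and sub: "E \<subseteq> \<epsilon> ` {..<n}"
begin

definition G :: "nat ugraph" where
  "G = \<lparr>verts = {..<n}, edges = {{u, v} | u v. u < n \<and> v < n \<and> u \<noteq> v \<and> \<epsilon> u \<in> E \<and> \<epsilon> v \<in> E \<and>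
     ends (\<epsilon> u) \<inter> ends (\<epsilon> v) \<noteq> {}}\<rparr>"

lemma finite_E: "finite E"
  using finite_subset[OF sub] by simp

lemma finite_incident_E [simp]: "finite (incident E p)"
  using finite_E by simp

lemma \<epsilon>_eq_iff: "u < n \<Longrightarrow> v < n \<Longrightarrow> \<epsilon> u = \<epsilon> v \<longleftrightarrow> u = v"
  using inj by (auto simp: inj_on_def)

lemma edge_G_iff: "{u, v} \<in> edges G \<longleftrightarrow> u < n \<and> v < n \<and> u \<noteq> v \<and> \<epsilon> u \<in> E \<and> \<epsilon> v \<in> E \<and>
    ends (\<epsilon> u) \<inter> ends (\<epsilon> v) \<noteq> {}"
  unfolding G_def by (auto simp: doubleton_eq_iff)

lemma edge_GE:
  assumes "a \<in> edges G"
  obtains u v where "a = {u, v}" "{u, v} \<in> edges G"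
proof -
  obtain u v where "a = {u, v}" using assms unfolding G_def by auto
  then show ?thesis using assms that by metis
qed

lemma verts_G [simp]: "verts G = {..<n}"
  by (simp add: G_def)

lemma simple_graph_G: "simple_graph G"
  unfolding simple_graph_def
proof (intro conjI ballI)
  fix a assume "a \<in> edges G"
  then obtain u v where "a = {u, v}" "{u, v} \<in> edges G" by (rule edge_GE)
  then show "a \<subseteq> verts G" "card a = 2" unfolding edge_G_iff by auto
qed simp

text \<open>In the root graph, an isolated vertex becomes an edge between two vertices of its own.\<close>

definition root_edge :: "nat \<Rightarrow> ('p + nat \<times> bool) set" where
  "root_edge u = (if \<epsilon> u \<in> E then Inl ` ends (\<epsilon> u) else {Inr (u, False), Inr (u, True)})"

lemma card_root_edge: "card (root_edge u) = 2"
  by (simp add: root_edge_def card_image card_ends)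

lemma root_edge_eq_iff:
  assumes "u < n" "v < n"
  shows "root_edge u = root_edge v \<longleftrightarrow> u = v"
proof
  assume eq: "root_edge u = root_edge v"
  show "u = v"
  proof (cases "\<epsilon> u \<in> E \<and> \<epsilon> v \<in> E")
    case True
    then have "ends (\<epsilon> u) = ends (\<epsilon> v)" using eq by (simp add: root_edge_def inj_image_eq_iff)
    then show ?thesis using ends_inject \<epsilon>_eq_iff[OF assms] by blast
  next
    case False
    then show ?thesis using eq by (auto simp: root_edge_def doubleton_eq_iff split: if_splits)
  qed
qed simp

lemma root_edge_meet_iff:
  "u \<noteq> v \<Longrightarrow> root_edge u \<inter> root_edge v \<noteq> {} \<longleftrightarrow> \<epsilon> u \<in> E \<and> \<epsilon> v \<in> E \<and> ends (\<epsilon> u) \<inter> ends (\<epsilon> v) \<noteq> {}"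
  by (auto simp: root_edge_def)

lemma is_line_graph_G: "is_line_graph G"
proof -
  define \<phi> where "\<phi> u = to_nat ` root_edge u" for u
  define H :: "nat ugraph" where "H = \<lparr>verts = \<Union> (\<phi> ` {..<n}), edges = \<phi> ` {..<n}\<rparr>"
  have inj_to_nat: "inj (to_nat :: 'p + nat \<times> bool \<Rightarrow> nat)" by simp
  have card: "card (\<phi> u) = 2" for u unfolding \<phi>_def by (simp add: card_image card_root_edge)
  have "finite (\<phi> u)" for u by (rule card_ge_0_finite) (simp add: card)
  then have "simple_graph H" unfolding simple_graph_def H_def using card by auto
  moreover have \<phi>_eq: "\<phi> u = \<phi> v \<longleftrightarrow> u = v" if "u < n" "v < n" for u v
    using root_edge_eq_iff[OF that] unfolding \<phi>_def by (simp add: inj_image_eq_iff)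
  have \<phi>_meet: "\<phi> u \<inter> \<phi> v = to_nat ` (root_edge u \<inter> root_edge v)" for u v
    unfolding \<phi>_def by (rule image_Int[OF inj_to_nat, symmetric])
  have "graph_iso G (line_graph H)"
    unfolding graph_iso_def
  proof (intro exI[of _ \<phi>] conjI ballI)
    show "bij_betw \<phi> (verts G) (verts (line_graph H))"
      using \<phi>_eq by (auto simp: bij_betw_def inj_on_def line_graph_def H_def)
    fix u v assume "u \<in> verts G" "v \<in> verts G"
    then have uv: "u < n" "v < n" by simp_all
    then have "{\<phi> u, \<phi> v} \<in> edges (line_graph H) \<longleftrightarrow> \<phi> u \<noteq> \<phi> v \<and> \<phi> u \<inter> \<phi> v \<noteq> {}"
      unfolding line_graph_def H_def by (auto simp: doubleton_eq_iff)
    also have "\<dots> \<longleftrightarrow> u \<noteq> v \<and> root_edge u \<inter> root_edge v \<noteq> {}" using \<phi>_eq uv by (simp add: \<phi>_meet)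
    finally show "{u, v} \<in> edges G \<longleftrightarrow> {\<phi> u, \<phi> v} \<in> edges (line_graph H)"
      using root_edge_meet_iff[of u v] uv unfolding edge_G_iff by auto
  qed
  ultimately show ?thesis unfolding is_line_graph_def by blast
qed

lemma degree_of_eq_card_neighbours:
  "degree_of G u = card {v. {u, v} \<in> edges G}"
proof -
  have "{a \<in> edges G. u \<in> a} = (\<lambda>v. {u, v}) ` {v. {u, v} \<in> edges G}"
  proof (intro equalityI subsetI)
    fix a assume "a \<in> {a \<in> edges G. u \<in> a}"
    then have a: "a \<in> edges G" "u \<in> a" by simp_all
    obtain x y where "a = {x, y}" "{x, y} \<in> edges G" using edge_GE[OF a(1)] by blast
    then have "a = {x, y}" "{x, y} \<in> edges G" "u = x \<or> u = y" using a(2) by auto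
    then show "a \<in> (\<lambda>v. {u, v}) ` {v. {u, v} \<in> edges G}" by (auto simp: insert_commute)
  qed auto
  then show ?thesis unfolding degree_of_def by (simp add: card_image inj_on_def doubleton_eq_iff)
qed

lemma degree_of_G:
  assumes "u < n"
  shows "degree_of G u = (if \<epsilon> u \<in> E then \<Sum>p\<in>ends (\<epsilon> u). card (incident E p) - 1 else 0)"
proof (cases "\<epsilon> u \<in> E")
  case True
  let ?others = "\<lambda>p. incident E p - {\<epsilon> u}"
  have "\<epsilon> ` {v. {u, v} \<in> edges G} = (\<Union>p\<in>ends (\<epsilon> u). ?others p)"
  proof (intro equalityI subsetI)
    fix e assume "e \<in> \<epsilon> ` {v. {u, v} \<in> edges G}"
    then show "e \<in> (\<Union>p\<in>ends (\<epsilon> u). ?others p)"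
      using \<epsilon>_eq_iff unfolding edge_G_iff incident_def by auto
  next
    fix e assume e: "e \<in> (\<Union>p\<in>ends (\<epsilon> u). ?others p)"
    then obtain v where "v < n" "e = \<epsilon> v" using sub by (auto simp: incident_def)
    then show "e \<in> \<epsilon> ` {v. {u, v} \<in> edges G}"
      using e assms True unfolding edge_G_iff incident_def by auto
  qed
  moreover have "inj_on \<epsilon> {v. {u, v} \<in> edges G}"
    using \<epsilon>_eq_iff unfolding edge_G_iff by (auto simp: inj_on_def)
  ultimately have "degree_of G u = card (\<Union>p\<in>ends (\<epsilon> u). ?others p)"
    unfolding degree_of_eq_card_neighbours by (metis card_image)
  also have "\<dots> = (\<Sum>p\<in>ends (\<epsilon> u). card (?others p))"
    using common_end_unique by (intro card_UN_disjoint) (auto simp: incident_def finite_E)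
  also have "\<dots> = (\<Sum>p\<in>ends (\<epsilon> u). card (incident E p) - 1)"
    using True by (intro sum.cong refl) (simp add: incident_def finite_E)
  finally show ?thesis using True by simp
next
  case False
  then have "{v. {u, v} \<in> edges G} = {}" unfolding edge_G_iff by auto
  then show ?thesis using False by (simp add: degree_of_eq_card_neighbours)
qed

lemma max_degree_G:
  assumes degree_le: "\<And>p. card (incident E p) \<le> d"
    and e: "e \<in> E" "\<And>p. p \<in> ends e \<Longrightarrow> card (incident E p) = d"
  shows "max_degree G = 2 * (d - 1)"
proof -
  have "degree_of G u \<le> 2 * (d - 1)" if "u < n" for u
  proof (cases "\<epsilon> u \<in> E")
    case True
    have "(\<Sum>p\<in>ends (\<epsilon> u). card (incident E p) - 1) \<le> of_nat (card (ends (\<epsilon> u))) * (d - 1)"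
      using degree_le by (intro sum_bounded_above diff_le_mono)
    then show ?thesis using degree_of_G[OF that] True by (simp add: card_ends)
  qed (simp add: degree_of_G[OF that])
  moreover obtain u where u: "u < n" "\<epsilon> u = e" using e(1) sub by auto
  then have "degree_of G u = 2 * (d - 1)" using degree_of_G[OF u(1)] e by (simp add: card_ends)
  then have "2 * (d - 1) \<in> degree_of G ` verts G" using u by (metis imageI lessThan_iff verts_G)
  ultimately show ?thesis unfolding max_degree_def by (intro Max_eqI) auto
qed

definition points :: "'p set" where "points = (\<Union>e\<in>E. ends e)"

definition capacity :: nat where "capacity = (\<Sum>p\<in>points. min 2 (card (incident E p)))"

lemma finite_points: "finite points"
  using finite_E by (simp add: points_def)

lemma incident_outside_points: "p \<notin> points \<Longrightarrow> incident E p = {}"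
  by (auto simp: points_def incident_def)

lemma card_Union_matching:
  assumes "matching G M"
  shows "card (\<Union>M) = 2 * card M"
proof -
  have M: "M \<subseteq> edges G" and disjoint: "\<And>a b. a \<in> M \<Longrightarrow> b \<in> M \<Longrightarrow> a \<noteq> b \<Longrightarrow> a \<inter> b = {}"
    using assms by (auto simp: matching_def)
  have two: "card a = 2" "finite a" if "a \<in> M" for a
    using that M simple_graph_G card_ge_0_finite[of a] by (auto simp: simple_graph_def)
  have "card (\<Union>M) = (\<Sum>a\<in>M. card a)"
    by (rule card_Union_disjoint) (use disjoint two in \<open>auto simp: pairwise_def disjnt_def\<close>)
  also have "\<dots> = (\<Sum>a\<in>M. 2)" using two by (intro sum.cong) auto
  finally show ?thesis by simp
qed

text \<open>Where at most two edges of \<open>F\<close> meet in a point, a cycle of the line graph comes from a cycle of the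
  root graph. It is given as a periodic sequence.\<close>

lemma line_graph_cycleE:
  assumes F: "F \<subseteq> E" "\<And>p. card (incident F p) \<le> 2"
    and cycle: "is_cycle (induced_subgraph G S) vs" and S: "\<And>u. u \<in> S \<Longrightarrow> u < n \<and> \<epsilon> u \<in> F"
  obtains e p and m :: nat where "0 < m" "\<And>i. incident F (p i) = {e i, e (Suc i)}" "\<And>i. e i \<noteq> e (Suc i)"
    "\<And>i. ends (e (Suc i)) = {p i, p (Suc i)}" "\<And>i. e (i + m) = e i"
proof -
  define m where "m = length vs"
  define e where "e i = \<epsilon> (vs ! (i mod m))" for i
  have m: "3 \<le> m" and vs: "distinct vs" "set vs \<subseteq> S"
    and edge: "\<And>i. i < m \<Longrightarrow> {vs ! i, vs ! (Suc i mod m)} \<in> edges G"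
    using cycle unfolding is_cycle_def m_def induced_subgraph_def by auto
  have less: "i mod m < m" for i using m by simp
  have in_S: "vs ! (i mod m) \<in> S" for i using vs(2) less[of i] by (metis m_def nth_mem subsetD)
  have e_F: "e i \<in> F" for i using S[OF in_S[of i]] by (simp add: e_def)
  have e_eq: "e i = e j \<longleftrightarrow> i mod m = j mod m" for i j
    using \<epsilon>_eq_iff S[OF in_S[of i]] S[OF in_S[of j]] nth_eq_iff_index_eq[OF vs(1)] less[of i] less[of j]
    unfolding e_def m_def by blast
  have not_cong: "i mod m \<noteq> (i + k) mod m" if "0 < k" "k < m" for i k
  proof
    assume "i mod m = (i + k) mod m"
    then have "m dvd k" using mod_eq_dvd_iff_nat[of i "i + k" m] by auto
    then show False using that by (auto dest: dvd_imp_le)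
  qed
  have e_Suc: "e i \<noteq> e (Suc i)" and e_Suc2: "e i \<noteq> e (Suc (Suc i))" for i
    using not_cong[of 1 i] not_cong[of 2 i] m by (simp_all add: e_eq)
  have "\<exists>p. p \<in> ends (e i) \<and> p \<in> ends (e (Suc i))" for i
    using edge[OF less[of i]] unfolding edge_G_iff e_def by (auto simp: mod_Suc_eq)
  then obtain p where p: "\<And>i. p i \<in> ends (e i)" "\<And>i. p i \<in> ends (e (Suc i))" by metis
  have inc: "incident F (p i) = {e i, e (Suc i)}" for i
  proof -
    have "finite (incident F (p i))" using finite_subset[OF F(1) finite_E] by simp
    moreover have "{e i, e (Suc i)} \<subseteq> incident F (p i)" using e_F p by (auto simp: incident_def)
    moreover have "card {e i, e (Suc i)} = 2" using e_Suc[of i] by simp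
    ultimately show ?thesis using F(2)[of "p i"] by (metis card_seteq)
  qed
  have "p i \<noteq> p (Suc i)" for i using inc[of i] inc[of "Suc i"] e_Suc2[of i] e_Suc[of "Suc i"]
    by (metis doubleton_eq_iff)
  then have ends: "ends (e (Suc i)) = {p i, p (Suc i)}" for i using ends_eq p(1)[of "Suc i"] p(2)[of i] by metis
  show ?thesis using that[of m p e] m inc e_Suc ends by (simp add: e_eq)
qed

end

section \<open>Acyclic matchings in line graphs of bipartite graphs\<close>

locale bipartite_line_graph = numbered_line_graph ends n \<epsilon> E
  for ends :: "'e \<Rightarrow> 'p::countable set" and n \<epsilon> E +
  fixes colour :: "'p \<Rightarrow> nat"
  assumes colour_le: "colour p \<le> 1"
    and colour_other: "p \<in> ends e \<Longrightarrow> q \<in> ends e \<Longrightarrow> p \<noteq> q \<Longrightarrow> colour q = 1 - colour p"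
begin

text \<open>An acyclic matching is a set of paths with an even number of edges each, and all pairs of a
  path are centred at points of the same colour. A nonzero label is the colour of these points
  plus one.\<close>

definition labelling :: "('e \<Rightarrow> nat) \<Rightarrow> bool" where
  "labelling l \<longleftrightarrow> (\<forall>e. l e \<le> 2) \<and> (\<forall>e. l e \<noteq> 0 \<longrightarrow> e \<in> E) \<and>
     (\<forall>p. card (incident E p) = 1 \<longrightarrow> (\<forall>e\<in>incident E p. l e = 2 - colour p)) \<and>
     (\<forall>p. 2 \<le> card (incident E p) \<longrightarrow>
        (\<exists>e f. e \<noteq> f \<and> {e \<in> incident E p. l e \<noteq> 0} = {e, f} \<and> l e = l f))"

definition descending :: "('e \<Rightarrow> nat) \<Rightarrow> ('p \<Rightarrow> nat) \<Rightarrow> bool" where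
  "descending l h \<longleftrightarrow> (\<forall>p. 2 \<le> card (incident E p) \<longrightarrow>
     (\<exists>e\<in>incident E p. l e \<noteq> 0 \<and> (\<exists>q\<in>ends e. h q < h p)))"

lemma colour_cases: "colour p = 0 \<or> colour p = 1"
  using colour_le[of p] by linarith

lemma ex1_end_of_colour:
  assumes "c \<le> 1"
  shows "\<exists>!p. p \<in> ends e \<and> colour p = c"
proof -
  obtain p q where pq: "ends e = {p, q}" "p \<noteq> q" using card_ends[of e] by (auto simp: card_2_iff)
  then have "colour q = 1 - colour p" by (intro colour_other[of _ e]) simp_all
  then show ?thesis using pq assms colour_cases[of p] by (auto simp: le_Suc_eq)
qed

end

subsection \<open>From matchings to labellings\<close>

locale saturated_matching = bipartite_line_graph +
  fixes M :: "nat set set"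
  assumes acyclic_matching_M: "acyclic_matching G M" and saturated: "4 * card M = capacity"
begin

definition matched :: "'a set" where "matched = \<epsilon> ` \<Union>M"

definition partner :: "'a \<Rightarrow> 'a \<Rightarrow> bool" where
  "partner e f \<longleftrightarrow> e \<noteq> f \<and> (\<exists>u v. {u, v} \<in> M \<and> e = \<epsilon> u \<and> f = \<epsilon> v)"

definition centre :: "'a \<Rightarrow> 'b" where
  "centre e = (SOME p. \<exists>f. partner e f \<and> p \<in> ends e \<and> p \<in> ends f)"

definition label :: "'a \<Rightarrow> nat" where
  "label e = (if e \<in> matched then 1 + colour (centre e) else 0)"

lemma matching_M: "M \<subseteq> edges G" "a \<in> M \<Longrightarrow> b \<in> M \<Longrightarrow> a \<noteq> b \<Longrightarrow> a \<inter> b = {}"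
  using acyclic_matching_M by (auto simp: acyclic_matching_def matching_def)

lemma Union_M_less: "\<Union>M \<subseteq> {..<n}"
  using matching_M simple_graph_G by (auto simp: simple_graph_def)

lemma partner_sym: "partner e f \<Longrightarrow> partner f e"
  unfolding partner_def by (metis insert_commute)

lemma partner_matched: "partner e f \<Longrightarrow> f \<in> matched"
  unfolding partner_def matched_def by blast

lemma matchedE:
  assumes "e \<in> matched"
  obtains f p where "e \<in> E" "partner e f" "p \<in> ends e" "p \<in> ends f"
proof -
  obtain u a where u: "e = \<epsilon> u" "u \<in> a" "a \<in> M" using assms by (auto simp: matched_def)
  obtain x y where xy: "a = {x, y}" "{x, y} \<in> edges G" using matching_M u(3) edge_GE[of a] by blast
  obtain v where v: "a = {u, v}" "{u, v} \<in> edges G" using xy u(2) by (auto simp: insert_commute)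
  then have "partner e (\<epsilon> v)" "ends e \<inter> ends (\<epsilon> v) \<noteq> {}" "e \<in> E"
    using u \<epsilon>_eq_iff unfolding partner_def edge_G_iff by auto
  then show ?thesis using that by blast
qed

lemma matched_subset: "matched \<subseteq> E"
  using matchedE by blast

lemma finite_matched: "finite matched"
  using finite_subset[OF matched_subset finite_E] .

lemma card_matched: "card matched = 2 * card M"
proof -
  have "matching G M" using acyclic_matching_M by (simp add: acyclic_matching_def)
  then show ?thesis
    unfolding matched_def using card_Union_matching card_image[OF inj_on_subset[OF inj Union_M_less]] by simp
qed

text \<open>Three matched edges at a point would form a triangle.\<close>

lemma card_incident_matched_le: "card (incident matched p) \<le> 2"
proof (rule ccontr)
  assume "\<not> card (incident matched p) \<le> 2"
  then obtain T where T: "T \<subseteq> incident matched p" "card T = 3"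
    using obtain_subset_with_card_n[of 3 "incident matched p"] by (metis not_less_eq_eq numeral_2_eq_2 numeral_3_eq_3)
  then obtain e f g where efg: "T = {e, f, g}" "e \<noteq> f" "f \<noteq> g" "e \<noteq> g" unfolding card_3_iff by blast
  then have "e \<in> matched" "f \<in> matched" "g \<in> matched" and p: "p \<in> ends e" "p \<in> ends f" "p \<in> ends g"
    using T(1) by (auto simp: incident_def)
  then obtain u v w where uvw: "e = \<epsilon> u" "f = \<epsilon> v" "g = \<epsilon> w" "u \<in> \<Union>M" "v \<in> \<Union>M" "w \<in> \<Union>M"
    unfolding matched_def by blast
  then have "\<epsilon> u \<in> E" "\<epsilon> v \<in> E" "\<epsilon> w \<in> E" "u < n" "v < n" "w < n"
    using matched_subset Union_M_less by (auto simp: matched_def)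
  then have edges: "{u, v} \<in> edges G" "{v, w} \<in> edges G" "{w, u} \<in> edges G"
    unfolding edge_G_iff using p efg uvw by auto
  have "is_cycle (induced_subgraph G (\<Union>M)) [u, v, w]"
    unfolding is_cycle_def
  proof (intro conjI allI impI)
    show "distinct [u, v, w]" using efg uvw by auto
    show "set [u, v, w] \<subseteq> verts (induced_subgraph G (\<Union> M))"
      using \<open>u < n\<close> \<open>v < n\<close> \<open>w < n\<close> uvw(4-6) by (simp add: induced_subgraph_def)
    fix i assume "i < length [u, v, w]"
    then consider "i = 0" | "i = 1" | "i = 2" by fastforce
    then show "{[u, v, w] ! i, [u, v, w] ! (Suc i mod length [u, v, w])} \<in> edges (induced_subgraph G (\<Union> M))"
      by cases (use edges uvw(4-6) in \<open>simp_all add: induced_subgraph_def\<close>)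
  qed simp
  then show False using acyclic_matching_M by (auto simp: acyclic_matching_def acyclic_graph_def)
qed

lemma card_incident_matched: "card (incident matched p) = min 2 (card (incident E p))"
proof -
  have at_most: "card (incident matched p) \<le> min 2 (card (incident E p))" for p
    using card_incident_matched_le[of p] card_mono[OF finite_incident_E, of "incident matched p" p] matched_subset
    by (auto simp: incident_def)
  have "(\<Sum>p\<in>points. card (incident matched p)) = 2 * card matched"
    by (rule sum_card_incident[OF finite_matched finite_points]) (use matched_subset in \<open>auto simp: points_def\<close>)
  then have "(\<Sum>p\<in>points. card (incident matched p)) = (\<Sum>p\<in>points. min 2 (card (incident E p)))"
    using saturated card_matched by (simp add: capacity_def)
  then have "card (incident matched p) = min 2 (card (incident E p))" if "p \<in> points"
    by (rule sum_mono_inv[OF _ at_most that finite_points])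
  then show ?thesis using incident_outside_points[of p] at_most[of p] by (cases "p \<in> points") simp_all
qed

lemma partner_unique:
  assumes "partner e f" "partner e g"
  shows "f = g"
proof -
  obtain u v where uv: "{u, v} \<in> M" "e = \<epsilon> u" "f = \<epsilon> v" using assms(1) by (auto simp: partner_def)
  obtain x y where xy: "{x, y} \<in> M" "e = \<epsilon> x" "g = \<epsilon> y" using assms(2) by (auto simp: partner_def)
  have "u < n" "x < n" using uv(1) xy(1) Union_M_less by auto
  then have "u = x" using uv(2) xy(2) \<epsilon>_eq_iff by blast
  then have "{u, v} = {x, y}" using matching_M(2)[OF uv(1) xy(1)] by blast
  then show ?thesis using \<open>u = x\<close> uv(3) xy(3) by (auto simp: doubleton_eq_iff)
qed

lemma centre_shared:
  assumes "e \<in> matched"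
  obtains f where "partner e f" "centre e \<in> ends e" "centre e \<in> ends f"
proof -
  have "\<exists>p f. partner e f \<and> p \<in> ends e \<and> p \<in> ends f" using matchedE[OF assms] by blast
  from someI_ex[OF this] show ?thesis using that unfolding centre_def by blast
qed

lemma centre_eq:
  assumes "partner e f" "e \<in> matched" "p \<in> ends e" "p \<in> ends f"
  shows "centre e = p"
proof -
  obtain g where g: "partner e g" "centre e \<in> ends e" "centre e \<in> ends g" using centre_shared[OF assms(2)] .
  moreover have "g = f" using partner_unique g(1) assms(1) by blast
  moreover have "e \<noteq> f" using assms(1) by (simp add: partner_def)
  ultimately show ?thesis using common_end_unique[of e f "centre e" p] assms(3,4) by blast
qed

lemma label_off_centre:
  assumes "e \<in> matched" "p \<in> ends e" "centre e \<noteq> p"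
  shows "label e = 2 - colour p"
proof -
  have "centre e \<in> ends e" using centre_shared[OF assms(1)] by blast
  then have "colour (centre e) = 1 - colour p" using colour_other[of p e "centre e"] assms by metis
  then show ?thesis using assms(1) colour_cases[of p] by (auto simp: label_def)
qed

lemma label_at_leaf:
  assumes leaf: "card (incident E p) = 1" and e: "e \<in> incident E p"
  shows "label e = 2 - colour p"
proof -
  have single: "incident E p = {e}" using leaf e by (metis card_1_singletonE singletonD)
  have "card (incident matched p) = 1" using card_incident_matched[of p] leaf by simp
  then have "incident matched p \<noteq> {}" by auto
  then have "e \<in> matched" using single matched_subset by (auto simp: incident_def)
  moreover have "centre e \<noteq> p"
  proof
    assume "centre e = p"
    then obtain f where "partner e f" "p \<in> ends f" using centre_shared[OF \<open>e \<in> matched\<close>] by blast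
    then have "f \<in> incident E p" "e \<noteq> f"
      using partner_matched matched_subset by (auto simp: incident_def partner_def)
    then show False using single by simp
  qed
  ultimately show ?thesis using e by (intro label_off_centre) (simp_all add: incident_def)
qed

lemma label_eq_at_inner_point:
  assumes pair: "incident matched p = {e, f}" "e \<noteq> f"
  shows "label e = label f"
proof -
  have e: "e \<in> matched" "p \<in> ends e" and f: "f \<in> matched" "p \<in> ends f" using pair(1) by (auto simp: incident_def)
  have centred: "centre y = p" if "centre x = p" "{x, y} = {e, f}" "x \<noteq> y" for x y
  proof -
    have x: "x \<in> matched" "p \<in> ends x" and y: "y \<in> matched" "p \<in> ends y"
      using that e f by (auto simp: doubleton_eq_iff)
    obtain g where g: "partner x g" "centre x \<in> ends g" using centre_shared[OF x(1)] by blast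
    then have "g \<in> incident matched p" using partner_matched that(1) by (auto simp: incident_def)
    then have "g \<in> {x, y}" using pair(1) that(2) by simp
    moreover have "g \<noteq> x" using g(1) by (auto simp: partner_def)
    ultimately have "g = y" by simp
    then show ?thesis using centre_eq[OF partner_sym[OF g(1)]] x y by simp
  qed
  show ?thesis
  proof (cases "centre e = p")
    case True
    then have "centre f = p" using centred[of e f] pair(2) by simp
    then show ?thesis using True e f by (simp add: label_def)
  next
    case False
    then have "centre f \<noteq> p" using centred[of f e] pair(2) by (metis insert_commute)
    then show ?thesis using label_off_centre[OF e False] label_off_centre[OF f] by simp
  qed
qed

lemma labelling_label: "labelling label"
  unfolding labelling_def
proof (intro conjI allI impI ballI)
  fix e show "label e \<le> 2" using colour_le[of "centre e"] by (simp add: label_def)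
  show "label e \<noteq> 0 \<Longrightarrow> e \<in> E" using matched_subset by (auto simp: label_def split: if_splits)
next
  fix p e assume "card (incident E p) = 1" "e \<in> incident E p"
  then show "label e = 2 - colour p" by (rule label_at_leaf)
next
  fix p assume "2 \<le> card (incident E p)"
  then have "card (incident matched p) = 2" using card_incident_matched[of p] by simp
  then obtain e f where "incident matched p = {e, f}" "e \<noteq> f" by (meson card_2_iff)
  moreover have "{e \<in> incident E p. label e \<noteq> 0} = incident matched p"
    using matched_subset by (auto simp: incident_def label_def)
  ultimately show "\<exists>e f. e \<noteq> f \<and> {e \<in> incident E p. label e \<noteq> 0} = {e, f} \<and> label e = label f"
    using label_eq_at_inner_point by blast
qed

end

subsection \<open>From labellings to matchings\<close>

locale descending_labelling = bipartite_line_graph +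
  fixes l :: "'a \<Rightarrow> nat" and h :: "'b \<Rightarrow> nat"
  assumes labelling_l: "labelling l" and descending_h: "descending l h"
begin

definition labelled :: "'a set" where "labelled = {e \<in> E. l e \<noteq> 0}"

definition centre :: "'a \<Rightarrow> 'b" where "centre e = (THE p. p \<in> ends e \<and> colour p = l e - 1)"

definition M :: "nat set set" where
  "M = {{u, v} | u v. u < n \<and> v < n \<and> u \<noteq> v \<and> \<epsilon> u \<in> labelled \<and> \<epsilon> v \<in> labelled \<and> centre (\<epsilon> u) = centre (\<epsilon> v)}"

lemma finite_labelled: "finite labelled"
  using finite_E by (simp add: labelled_def)

lemma incident_labelled: "incident labelled p = {e \<in> incident E p. l e \<noteq> 0}"
  by (auto simp: incident_def labelled_def)

lemma label_at_leaf: "card (incident E p) = 1 \<Longrightarrow> e \<in> incident E p \<Longrightarrow> l e = 2 - colour p"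
  using labelling_l unfolding labelling_def by blast

lemma labelled_pair_at_inner_point:
  assumes "2 \<le> card (incident E p)"
  obtains e f where "incident labelled p = {e, f}" "e \<noteq> f" "l e = l f"
  using assms labelling_l unfolding labelling_def incident_labelled by metis

lemma card_incident_pos: "e \<in> incident E p \<Longrightarrow> 1 \<le> card (incident E p)"
  by (metis One_nat_def Suc_leI card_gt_0_iff empty_iff finite_incident_E)

lemma card_incident_labelled: "card (incident labelled p) = min 2 (card (incident E p))"
proof -
  consider (isolated) "card (incident E p) = 0" | (leaf) "card (incident E p) = 1" | (inner) "2 \<le> card (incident E p)" by linarith
  then show ?thesis
  proof cases
    case isolated
    then have "incident E p = {}" by simp
    then have "incident labelled p = {}" by (simp only: incident_labelled) blast
    then show ?thesis using isolated by simp
  next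
    case leaf
    then obtain e where e: "incident E p = {e}" by (rule card_1_singletonE)
    then have "l e \<noteq> 0" using label_at_leaf[OF leaf, of e] colour_le[of p] by simp
    then have "incident labelled p = {e}" using e by (auto simp: incident_labelled)
    then show ?thesis using leaf by simp
  next
    case inner
    then obtain e f where "incident labelled p = {e, f}" "e \<noteq> f" by (rule labelled_pair_at_inner_point)
    then show ?thesis using inner by simp
  qed
qed

lemma card_labelled: "2 * card labelled = capacity"
proof -
  have "2 * card labelled = (\<Sum>p\<in>points. card (incident labelled p))"
    by (rule sum_card_incident[OF finite_labelled finite_points, symmetric]) (auto simp: points_def labelled_def)
  then show ?thesis by (simp add: card_incident_labelled capacity_def)
qed

lemma
  assumes "e \<in> labelled"
  shows centre_end: "centre e \<in> ends e" and colour_centre: "colour (centre e) = l e - 1"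
    and centre_eq: "p \<in> ends e \<Longrightarrow> colour p = l e - 1 \<Longrightarrow> centre e = p"
proof -
  have "l e - 1 \<le> 1" using labelling_l by (auto simp: labelling_def le_diff_conv numeral_2_eq_2)
  note unique = ex1_end_of_colour[OF this]
  show "centre e \<in> ends e" "colour (centre e) = l e - 1" using theI'[OF unique] by (simp_all add: centre_def)
  then show "p \<in> ends e \<Longrightarrow> colour p = l e - 1 \<Longrightarrow> centre e = p" using unique by blast
qed

lemma centre_inner_point:
  assumes e: "e \<in> labelled"
  shows "2 \<le> card (incident E (centre e))"
proof (rule ccontr)
  assume "\<not> ?thesis"
  moreover have inc: "e \<in> incident E (centre e)" using centre_end[OF e] e by (auto simp: incident_def labelled_def)
  ultimately have "card (incident E (centre e)) = 1" using card_incident_pos[OF inc] by simp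
  then have "l e = 2 - colour (centre e)" using label_at_leaf inc by blast
  moreover have "l e \<noteq> 0" using e by (simp add: labelled_def)
  ultimately show False using colour_centre[OF e] colour_le[of "centre e"] by arith
qed

lemma labelled_partner:
  assumes e: "e \<in> labelled"
  obtains f where "incident labelled (centre e) = {e, f}" "e \<noteq> f" "f \<in> labelled" "centre f = centre e"
proof -
  have "e \<in> incident labelled (centre e)" using centre_end[OF e] e by (simp add: incident_def)
  moreover obtain a b where "incident labelled (centre e) = {a, b}" "a \<noteq> b" "l a = l b"
    by (rule labelled_pair_at_inner_point[OF centre_inner_point[OF e]])
  ultimately obtain f where f: "incident labelled (centre e) = {e, f}" "e \<noteq> f" "l e = l f"
    by (metis insertE insert_commute singletonD)
  then have "f \<in> labelled" "centre e \<in> ends f" by (auto simp: incident_def)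
  moreover have "centre f = centre e" by (rule centre_eq) (use calculation colour_centre[OF e] f(3) in simp_all)
  ultimately show ?thesis using that f by blast
qed

lemma Union_M: "\<Union>M = {u. u < n \<and> \<epsilon> u \<in> labelled}"
proof (intro equalityI subsetI)
  fix u assume u: "u \<in> {u. u < n \<and> \<epsilon> u \<in> labelled}"
  then obtain f where f: "\<epsilon> u \<noteq> f" "f \<in> labelled" "centre f = centre (\<epsilon> u)" using labelled_partner[of "\<epsilon> u"] by auto
  then have "f \<in> E" by (simp add: labelled_def)
  then obtain v where "v < n" "f = \<epsilon> v" using sub by auto
  then have "{u, v} \<in> M" using u f unfolding M_def by auto
  then show "u \<in> \<Union>M" by blast
qed (auto simp: M_def)

lemma partner_unique:
  assumes "u < n" "v < n" "w < n" "\<epsilon> u \<in> labelled" "\<epsilon> v \<in> labelled" "\<epsilon> w \<in> labelled" "u \<noteq> v" "u \<noteq> w"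
    "centre (\<epsilon> v) = centre (\<epsilon> u)" "centre (\<epsilon> w) = centre (\<epsilon> u)"
  shows "v = w"
proof -
  obtain f where f: "incident labelled (centre (\<epsilon> u)) = {\<epsilon> u, f}" using labelled_partner[OF assms(4)] by blast
  have "\<epsilon> v \<in> {\<epsilon> u, f}" "\<epsilon> w \<in> {\<epsilon> u, f}"
    unfolding f[symmetric] incident_def
    using assms(5,6) centre_end[OF assms(5)] centre_end[OF assms(6)] unfolding assms(9,10) by simp_all
  then have "\<epsilon> v = \<epsilon> w" using \<epsilon>_eq_iff[OF assms(1,2)] \<epsilon>_eq_iff[OF assms(1,3)] assms(7,8) by auto
  then show ?thesis using \<epsilon>_eq_iff[OF assms(2,3)] by simp
qed

lemma M_memberE:
  assumes "a \<in> M" "z \<in> a"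
  obtains w where "a = {z, w}" "z < n" "w < n" "z \<noteq> w" "\<epsilon> z \<in> labelled" "\<epsilon> w \<in> labelled"
    "centre (\<epsilon> w) = centre (\<epsilon> z)"
proof -
  obtain u v where uv: "a = {u, v}" "u < n" "v < n" "u \<noteq> v" "\<epsilon> u \<in> labelled" "\<epsilon> v \<in> labelled"
    "centre (\<epsilon> u) = centre (\<epsilon> v)" using assms(1) unfolding M_def by blast
  then consider "z = u" | "z = v" using assms(2) by blast
  then show ?thesis by cases (use uv that[of v] that[of u] in \<open>auto simp: insert_commute\<close>)
qed

lemma matching_M: "matching G M"
  unfolding matching_def
proof (intro conjI ballI impI subsetI)
  fix a assume a: "a \<in> M"
  then obtain z where "z \<in> a" unfolding M_def by blast
  with a obtain w where w: "a = {z, w}" "z < n" "w < n" "z \<noteq> w" "\<epsilon> z \<in> labelled" "\<epsilon> w \<in> labelled"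
    "centre (\<epsilon> w) = centre (\<epsilon> z)" by (rule M_memberE)
  have "centre (\<epsilon> z) \<in> ends (\<epsilon> z) \<inter> ends (\<epsilon> w)" using centre_end[OF w(5)] centre_end[OF w(6)] w(7) by simp
  then show "a \<in> edges G" unfolding w(1) edge_G_iff using w by (auto simp: labelled_def)
next
  fix a b assume "a \<in> M" "b \<in> M" "a \<noteq> b"
  then show "a \<inter> b = {}" using partner_unique by (metis M_memberE disjoint_iff)
qed

lemma card_M: "4 * card M = capacity"
proof -
  have "\<epsilon> ` \<Union>M = labelled" using sub by (auto simp: Union_M labelled_def)
  moreover have "inj_on \<epsilon> (\<Union>M)" by (rule inj_on_subset[OF inj]) (auto simp: Union_M)
  ultimately have "card (\<Union>M) = card labelled" by (metis card_image)
  then show ?thesis using card_Union_matching[OF matching_M] card_labelled by simp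
qed

text \<open>At a lowest point of a cycle the height cannot descend.\<close>

lemma acyclic_M: "acyclic_graph (induced_subgraph G (\<Union>M))"
  unfolding acyclic_graph_def
proof
  assume "\<exists>vs. is_cycle (induced_subgraph G (\<Union>M)) vs"
  then obtain vs where cycle: "is_cycle (induced_subgraph G (\<Union>M)) vs" ..
  show False
  proof (rule line_graph_cycleE[OF _ _ cycle])
    show "labelled \<subseteq> E" by (auto simp: labelled_def)
    show "card (incident labelled p) \<le> 2" for p by (simp add: card_incident_labelled)
    show "u < n \<and> \<epsilon> u \<in> labelled" if "u \<in> \<Union>M" for u using that by (simp add: Union_M)
    fix e p and m :: nat
    assume m: "0 < m" and inc: "\<And>i. incident labelled (p i) = {e i, e (Suc i)}" and ne: "\<And>i. e i \<noteq> e (Suc i)"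
      and ends: "\<And>i. ends (e (Suc i)) = {p i, p (Suc i)}" and period: "\<And>i. e (i + m) = e i"
    obtain j where lowest: "\<And>i. h (p j) \<le> h (p i)"
      using ex_has_least_nat[of "\<lambda>_. True" 0 "h \<circ> p"] by auto
    have "card (incident labelled (p j)) = 2" using inc[of j] ne[of j] by simp
    then have "2 \<le> card (incident E (p j))" by (simp add: card_incident_labelled min_def split: if_splits)
    then obtain f q where f: "f \<in> incident labelled (p j)" and q: "q \<in> ends f" "h q < h (p j)"
      using descending_h unfolding descending_def incident_labelled by blast
    have "e (Suc (j + m - 1)) = e j" using period(1)[of j] m by simp
    then have "ends (e j) = {p (j + m - 1), p (Suc (j + m - 1))}" using ends[of "j + m - 1"] by simp
    then obtain i where "q = p i" using f q(1) inc[of j] ends[of j] by auto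
    then show False using lowest[of i] q(2) by simp
  qed
qed

end

lemma (in bipartite_line_graph) ex_labelling_if_saturated:
  assumes "acyclic_matching G M" "4 * card M = capacity"
  shows "\<exists>l. labelling l"
proof -
  interpret saturated_matching ends n \<epsilon> E colour M by unfold_locales (use assms in auto)
  show ?thesis using labelling_label by blast
qed

lemma (in bipartite_line_graph) saturated_if_descending_labelling:
  assumes "labelling l" "descending l h"
  shows "\<exists>M. acyclic_matching G M \<and> 4 * card M = capacity"
proof -
  interpret descending_labelling ends n \<epsilon> E colour l h by unfold_locales (use assms in auto)
  show ?thesis using matching_M acyclic_M card_M by (auto simp: acyclic_matching_def)
qed

section \<open>Subgraphs of the square lattice\<close>

type_synonym point = "nat \<times> nat"

definition right_of :: "point \<Rightarrow> point" where "right_of p = (Suc (fst p), snd p)"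
definition below :: "point \<Rightarrow> point" where "below p = (fst p, Suc (snd p))"

text \<open>The edge \<open>(p, d)\<close> leads from \<open>p\<close> to the right or, if \<open>d\<close> holds, downwards.\<close>

type_synonym ledge = "point \<times> bool"

definition near :: "ledge \<Rightarrow> point" where "near e = fst e"
definition far :: "ledge \<Rightarrow> point" where "far e = (if snd e then below (fst e) else right_of (fst e))"
definition ends :: "ledge \<Rightarrow> point set" where "ends e = {near e, far e}"
definition lattice_colour :: "point \<Rightarrow> nat" where "lattice_colour p = (fst p + snd p) mod 2"

lemmas ends_defs = ends_def near_def far_def right_of_def below_def

interpretation lattice: incidence ends
proof
  show "card (ends e) = 2" for e by (simp add: ends_defs card_insert_if prod_eq_iff)
  show "e = f" if "ends e = ends f" for e f
    using that by (cases e; cases f) (auto simp: ends_defs prod_eq_iff doubleton_eq_iff split: if_splits)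
qed

locale lattice_line_graph = numbered_line_graph ends n \<epsilon> E for n \<epsilon> E +
  assumes card_incident_le_3: "card (lattice.incident E p) \<le> 3"

sublocale lattice_line_graph \<subseteq> bipartite_line_graph ends n \<epsilon> E lattice_colour
proof
  show "lattice_colour p \<le> 1" for p by (auto simp: lattice_colour_def)
  show "lattice_colour q = 1 - lattice_colour p" if "p \<in> ends e" "q \<in> ends e" "p \<noteq> q" for p q e
    using that by (auto simp: ends_defs lattice_colour_def split: if_splits) presburger+
qed

subsection \<open>Planarity\<close>

text \<open>Every vertex of the line graph is drawn at the midpoint of the lattice edge it stands for, on a
  scale on which the lattice points are two units apart. All segments at a lattice point stay inside a
  diamond around it; two diamonds meet in a common corner at most.\<close>

definition edge_pos :: "ledge \<Rightarrow> complex" where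
  "edge_pos e = (if snd e then Complex (2 * real (fst (fst e))) (2 * real (snd (fst e)) + 1)
     else Complex (2 * real (fst (fst e)) + 1) (2 * real (snd (fst e))))"

definition point_pos :: "point \<Rightarrow> complex" where
  "point_pos p = Complex (2 * real (fst p)) (2 * real (snd p))"

definition unit_corners :: "complex set" where "unit_corners = {1, - 1, \<i>, - \<i>}"

definition unit_diamond :: "complex set" where "unit_diamond = {z. \<bar>Re z\<bar> + \<bar>Im z\<bar> \<le> 1}"

lemma double_neq_odd: "2 * real i + 1 \<noteq> 2 * real j"
proof
  assume "2 * real i + 1 = 2 * real j"
  then have "real (2 * i + 1) = real (2 * j)" by simp
  then have "2 * i + 1 = 2 * j" by (simp only: of_nat_eq_iff)
  then show False by presburger
qed

lemma edge_pos_eq_iff: "edge_pos e = edge_pos f \<longleftrightarrow> e = f"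
  using double_neq_odd double_neq_odd[THEN not_sym]
  by (cases e; cases f) (auto simp: edge_pos_def prod_eq_iff split: if_splits)

lemma edge_pos_corner: "p \<in> ends e \<Longrightarrow> edge_pos e - point_pos p \<in> unit_corners"
  by (auto simp: ends_defs edge_pos_def point_pos_def unit_corners_def complex_eq_iff)

lemma unit_corners_iff:
  "z \<in> unit_corners \<longleftrightarrow> Im z = 0 \<and> \<bar>Re z\<bar> = 1 \<or> Re z = 0 \<and> \<bar>Im z\<bar> = 1"
  by (auto simp: unit_corners_def complex_eq_iff abs_if split: if_splits)

lemma edge_pos_diamond:
  assumes "edge_pos e - point_pos p \<in> unit_diamond"
  shows "edge_pos e - point_pos p \<in> unit_corners"
proof -
  have odd_diff: "1 \<le> \<bar>2 * real i + 1 - 2 * real j\<bar>" for i j :: nat by (cases "i < j") auto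
  obtain x y d where e: "e = ((x, y), d)" by (metis prod.collapse)
  show ?thesis
    using assms odd_diff[of x "fst p"] odd_diff[of y "snd p"]
    by (cases d) (auto simp: e edge_pos_def point_pos_def unit_diamond_def unit_corners_iff)
qed

lemma diamonds_meet:
  assumes z: "z - point_pos p \<in> unit_diamond" "z - point_pos q \<in> unit_diamond" and ne: "p \<noteq> q"
  shows "z - point_pos p \<in> unit_corners"
proof -
  have apart: "i \<noteq> j \<Longrightarrow> 2 \<le> \<bar>2 * real i - 2 * real j\<bar>" for i j :: nat
    by (cases i j rule: linorder_cases) auto
  have "fst p \<noteq> fst q \<or> snd p \<noteq> snd q" using ne by (simp add: prod_eq_iff)
  then show ?thesis
  proof
    assume "fst p \<noteq> fst q"
    then have "2 \<le> \<bar>Re (z - point_pos p)\<bar> + \<bar>Re (z - point_pos q)\<bar>"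
      using apart[of "fst p" "fst q"] by (simp add: point_pos_def)
    then have "\<bar>Re (z - point_pos p)\<bar> = 1" "\<bar>Im (z - point_pos p)\<bar> = 0"
      using z unfolding unit_diamond_def mem_Collect_eq by linarith+
    then show ?thesis by (simp add: unit_corners_iff)
  next
    assume "snd p \<noteq> snd q"
    then have "2 \<le> \<bar>Im (z - point_pos p)\<bar> + \<bar>Im (z - point_pos q)\<bar>"
      using apart[of "snd p" "snd q"] by (simp add: point_pos_def)
    then have "\<bar>Im (z - point_pos p)\<bar> = 1" "\<bar>Re (z - point_pos p)\<bar> = 0"
      using z unfolding unit_diamond_def mem_Collect_eq by linarith+
    then show ?thesis by (simp add: unit_corners_iff)
  qed
qed

lemma in_segmentE:
  fixes z :: complex
  assumes "z \<in> closed_segment a b"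
  obtains t where "0 \<le> t" "t \<le> 1" "Re z = (1 - t) * Re a + t * Re b" "Im z = (1 - t) * Im a + t * Im b"
proof -
  obtain t where "0 \<le> t" "t \<le> 1" "z = (1 - t) *\<^sub>R a + t *\<^sub>R b" using assms by (auto simp: in_segment)
  then show ?thesis by (intro that[of t]) simp_all
qed

lemma unit_segment_subset_diamond:
  assumes "a \<in> unit_corners" "b \<in> unit_corners" "z \<in> closed_segment a b"
  shows "z \<in> unit_diamond"
proof -
  obtain t where "0 \<le> t" "t \<le> 1" "Re z = (1 - t) * Re a + t * Re b" "Im z = (1 - t) * Im a + t * Im b"
    using in_segmentE[OF assms(3)] .
  then show ?thesis using assms(1,2) by (auto simp: unit_corners_def unit_diamond_def abs_if)
qed

lemma unit_segment_corner:
  assumes "a \<in> unit_corners" "b \<in> unit_corners" "z \<in> unit_corners" "z \<in> closed_segment a b"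
  shows "z = a \<or> z = b"
proof -
  obtain t where t: "Re z = (1 - t) * Re a + t * Re b" "Im z = (1 - t) * Im a + t * Im b"
    using in_segmentE[OF assms(4)] .
  show ?thesis using assms(1,2) t assms(3) unfolding unit_corners_iff[of z] complex_eq_iff
    by (auto simp: unit_corners_def)
qed

lemma unit_segments_meet:
  assumes "a \<in> unit_corners" "b \<in> unit_corners" "c \<in> unit_corners" "a \<noteq> b" "a \<noteq> c" "b \<noteq> c"
    "z \<in> closed_segment a b" "z \<in> closed_segment a c"
  shows "z = a"
proof -
  obtain t where t: "Re z = (1 - t) * Re a + t * Re b" "Im z = (1 - t) * Im a + t * Im b"
    using in_segmentE[OF assms(7)] .
  obtain s where s: "Re z = (1 - s) * Re a + s * Re c" "Im z = (1 - s) * Im a + s * Im c"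
    using in_segmentE[OF assms(8)] .
  show ?thesis using assms(1-6) t s unfolding complex_eq_iff[of z] by (auto simp: unit_corners_def)
qed

lemma closed_segment_diff: "(z :: complex) \<in> closed_segment a b \<Longrightarrow> z - c \<in> closed_segment (a - c) (b - c)"
  using closed_segment_translation_eq[of "- c" z a b] by simp

lemma segment_subset_diamond:
  "p \<in> ends e \<Longrightarrow> p \<in> ends f \<Longrightarrow> z \<in> closed_segment (edge_pos e) (edge_pos f) \<Longrightarrow> z - point_pos p \<in> unit_diamond"
  by (rule unit_segment_subset_diamond[OF edge_pos_corner edge_pos_corner closed_segment_diff])

lemma segment_corner:
  assumes "p \<in> ends e" "p \<in> ends f" "z \<in> closed_segment (edge_pos e) (edge_pos f)"
    "z - point_pos p \<in> unit_corners"
  shows "z = edge_pos e \<or> z = edge_pos f"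
  using unit_segment_corner[OF edge_pos_corner[OF assms(1)] edge_pos_corner[OF assms(2)] assms(4)
      closed_segment_diff[OF assms(3)]] by simp

lemma segments_meet:
  assumes "p \<in> ends e" "p \<in> ends f" "p \<in> ends g" "e \<noteq> f" "e \<noteq> g" "f \<noteq> g"
    "z \<in> closed_segment (edge_pos e) (edge_pos f)" "z \<in> closed_segment (edge_pos e) (edge_pos g)"
  shows "z = edge_pos e"
proof -
  have "z - point_pos p = edge_pos e - point_pos p"
    by (rule unit_segments_meet[OF edge_pos_corner[OF assms(1)] edge_pos_corner[OF assms(2)]
          edge_pos_corner[OF assms(3)]])
      (use assms(4-6) closed_segment_diff[OF assms(7)] closed_segment_diff[OF assms(8)] in
        \<open>simp_all add: edge_pos_eq_iff\<close>)
  then show ?thesis by simp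
qed

context lattice_line_graph
begin

lemma segments_at_point_meet:
  assumes E: "e \<in> E" "f \<in> E" "e' \<in> E" "f' \<in> E" and ne: "e \<noteq> f" "e' \<noteq> f'" "{e, f} \<noteq> {e', f'}"
    and p: "p \<in> ends e" "p \<in> ends f" "p \<in> ends e'" "p \<in> ends f'"
    and z: "z \<in> closed_segment (edge_pos e) (edge_pos f)" "z \<in> closed_segment (edge_pos e') (edge_pos f')"
  shows "z = edge_pos e \<or> z = edge_pos f"
proof -
  have "{e, f, e', f'} \<subseteq> incident E p" using E p by (auto simp: incident_def)
  from card_mono[OF finite_incident_E this] have "card {e, f, e', f'} \<le> 3"
    using card_incident_le_3[of p] by simp
  moreover have "card {e, f, e', f'} = 4" if "e \<noteq> e'" "e \<noteq> f'" "f \<noteq> e'" "f \<noteq> f'"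
    using that ne(1,2) by simp
  ultimately consider (ee) "e = e'" | (ef) "e = f'" | (fe) "f = e'" | (ff) "f = f'" by fastforce
  then show ?thesis
  proof cases
    case ee
    then show ?thesis using segments_meet[of p e f f' z] p ne z by auto
  next
    case ef
    then show ?thesis using segments_meet[of p e f e' z] p ne z by (auto simp: closed_segment_commute[of "edge_pos e'"])
  next
    case fe
    then show ?thesis using segments_meet[of p f e f' z] p ne z by (auto simp: closed_segment_commute[of "edge_pos e"])
  next
    case ff
    then show ?thesis using segments_meet[of p f e e' z] p ne z
      by (auto simp: closed_segment_commute[of "edge_pos e"] closed_segment_commute[of "edge_pos e'"])
  qed
qed

definition vertex_pos :: "nat \<Rightarrow> complex" where "vertex_pos u = edge_pos (\<epsilon> u)"

definition edge_path :: "nat set \<Rightarrow> real \<Rightarrow> complex" where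
  "edge_path a = linepath (vertex_pos (Min a)) (vertex_pos (Max a))"

lemma vertex_pos_eq_iff: "u < n \<Longrightarrow> v < n \<Longrightarrow> vertex_pos u = vertex_pos v \<longleftrightarrow> u = v"
  by (simp add: vertex_pos_def edge_pos_eq_iff \<epsilon>_eq_iff)

lemma edge_pathE:
  assumes "a \<in> edges G"
  obtains u v p where "a = {u, v}" "edge_path a = linepath (vertex_pos u) (vertex_pos v)" "u < n" "v < n" "u \<noteq> v"
    "\<epsilon> u \<in> E" "\<epsilon> v \<in> E" "p \<in> ends (\<epsilon> u)" "p \<in> ends (\<epsilon> v)"
proof -
  obtain x y where "a = {x, y}" "{x, y} \<in> edges G" using edge_GE[OF assms] .
  then have "a = {Min a, Max a}" by (auto simp: min_def max_def)
  then have "{Min a, Max a} \<in> edges G" using assms by simp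
  then show ?thesis using that[of "Min a" "Max a"] \<open>a = {Min a, Max a}\<close> unfolding edge_G_iff edge_path_def by blast
qed

lemma arc_edge_path:
  assumes "a \<in> edges G"
  shows "arc (edge_path a)" "{pathstart (edge_path a), pathfinish (edge_path a)} = vertex_pos ` a"
    "path_image (edge_path a) \<inter> vertex_pos ` verts G = vertex_pos ` a"
proof -
  obtain u v p where a: "a = {u, v}" "edge_path a = linepath (vertex_pos u) (vertex_pos v)"
    and uv: "u < n" "v < n" "u \<noteq> v" and p: "p \<in> ends (\<epsilon> u)" "p \<in> ends (\<epsilon> v)" by (rule edge_pathE[OF assms])
  show "arc (edge_path a)" "{pathstart (edge_path a), pathfinish (edge_path a)} = vertex_pos ` a"
    using a uv vertex_pos_eq_iff by (simp_all add: arc_linepath)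
  have "x = u \<or> x = v" if "x < n" "vertex_pos x \<in> closed_segment (vertex_pos u) (vertex_pos v)" for x
  proof -
    have "vertex_pos x - point_pos p \<in> unit_corners"
      using that(2) segment_subset_diamond[OF p] edge_pos_diamond unfolding vertex_pos_def by blast
    then have "vertex_pos x = vertex_pos u \<or> vertex_pos x = vertex_pos v"
      using that(2) segment_corner[OF p] unfolding vertex_pos_def by blast
    then show ?thesis using vertex_pos_eq_iff that(1) uv by simp
  qed
  then show "path_image (edge_path a) \<inter> vertex_pos ` verts G = vertex_pos ` a" using a uv by auto
qed

lemma edge_paths_meet:
  assumes a: "a \<in> edges G" and b: "b \<in> edges G" and ne: "a \<noteq> b"
  shows "path_image (edge_path a) \<inter> path_image (edge_path b) \<subseteq> vertex_pos ` verts G"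
proof
  fix z assume z: "z \<in> path_image (edge_path a) \<inter> path_image (edge_path b)"
  obtain u v p where uv: "a = {u, v}" "edge_path a = linepath (vertex_pos u) (vertex_pos v)" "u < n" "v < n" "u \<noteq> v"
    "\<epsilon> u \<in> E" "\<epsilon> v \<in> E" and p: "p \<in> ends (\<epsilon> u)" "p \<in> ends (\<epsilon> v)" by (rule edge_pathE[OF a])
  obtain x y q where xy: "b = {x, y}" "edge_path b = linepath (vertex_pos x) (vertex_pos y)" "x < n" "y < n" "x \<noteq> y"
    "\<epsilon> x \<in> E" "\<epsilon> y \<in> E" and q: "q \<in> ends (\<epsilon> x)" "q \<in> ends (\<epsilon> y)" by (rule edge_pathE[OF b])
  have z': "z \<in> closed_segment (edge_pos (\<epsilon> u)) (edge_pos (\<epsilon> v))" "z \<in> closed_segment (edge_pos (\<epsilon> x)) (edge_pos (\<epsilon> y))"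
    using z uv xy by (auto simp: vertex_pos_def)
  have "z = edge_pos (\<epsilon> u) \<or> z = edge_pos (\<epsilon> v)"
  proof (cases "p = q")
    case True
    have "\<epsilon> u \<noteq> \<epsilon> v" "\<epsilon> x \<noteq> \<epsilon> y" "{\<epsilon> u, \<epsilon> v} \<noteq> {\<epsilon> x, \<epsilon> y}"
      using ne uv xy \<epsilon>_eq_iff by (auto simp: doubleton_eq_iff)
    then show ?thesis using segments_at_point_meet[of "\<epsilon> u" "\<epsilon> v" "\<epsilon> x" "\<epsilon> y" p z] uv xy p q z' True by blast
  next
    case False
    then show ?thesis
      using diamonds_meet[OF segment_subset_diamond[OF p z'(1)] segment_subset_diamond[OF q z'(2)]]
        segment_corner[OF p z'(1)] by blast
  qed
  then show "z \<in> vertex_pos ` verts G" using uv by (auto simp: vertex_pos_def)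
qed

lemma planar_G: "planar G"
proof -
  have "inj_on vertex_pos (verts G)" using vertex_pos_eq_iff by (auto simp: inj_on_def)
  then show ?thesis unfolding planar_def
    using arc_edge_path edge_paths_meet by (intro exI[of _ vertex_pos] exI[of _ edge_path]) blast
qed

end
subsection \<open>Labels around a point\<close>

text \<open>A label is \<open>None\<close> where the edge is missing.\<close>

type_synonym label = "nat option"

definition present :: "label list \<Rightarrow> nat list" where "present ls = List.map_filter id ls"

definition point_rule :: "nat \<Rightarrow> label list \<Rightarrow> bool" where
  "point_rule c ls \<longleftrightarrow> (case filter (\<lambda>a. a \<noteq> 0) (present ls) of [] \<Rightarrow> present ls = []
     | [a] \<Rightarrow> present ls = [2 - c] | [a, b] \<Rightarrow> a = b | _ \<Rightarrow> False)"

definition left_label :: "(ledge \<Rightarrow> label) \<Rightarrow> point \<Rightarrow> label" where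
  "left_label L p = (case fst p of 0 \<Rightarrow> None | Suc x \<Rightarrow> L ((x, snd p), False))"
definition upper_label :: "(ledge \<Rightarrow> label) \<Rightarrow> point \<Rightarrow> label" where
  "upper_label L p = (case snd p of 0 \<Rightarrow> None | Suc y \<Rightarrow> L ((fst p, y), True))"

definition point_labels :: "(ledge \<Rightarrow> label) \<Rightarrow> point \<Rightarrow> label list" where
  "point_labels L p = [left_label L p, upper_label L p, L (p, False), L (p, True)]"

definition ledges_at :: "point \<Rightarrow> ledge list" where
  "ledges_at p = (case fst p of 0 \<Rightarrow> [] | Suc x \<Rightarrow> [((x, snd p), False)]) @
     (case snd p of 0 \<Rightarrow> [] | Suc y \<Rightarrow> [((fst p, y), True)]) @ [(p, False), (p, True)]"

lemma left_label_right_of [simp]: "left_label L (right_of p) = L (p, False)"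
  by (simp add: left_label_def right_of_def)

lemma upper_label_below [simp]: "upper_label L (below p) = L (p, True)"
  by (simp add: upper_label_def below_def)

lemma left_label_eq_None:
  assumes "dom L = dom K"
  shows "left_label L p = None \<longleftrightarrow> left_label K p = None"
proof -
  have "L e = None \<longleftrightarrow> K e = None" for e using assms by (metis domIff)
  then show ?thesis by (simp add: left_label_def split: nat.split)
qed

lemma upper_label_eq_None:
  assumes "dom L = dom K"
  shows "upper_label L p = None \<longleftrightarrow> upper_label K p = None"
proof -
  have "L e = None \<longleftrightarrow> K e = None" for e using assms by (metis domIff)
  then show ?thesis by (simp add: upper_label_def split: nat.split)
qed

lemma left_labelE:
  assumes "left_label L p \<noteq> None"
  obtains q where "p = right_of q"
proof -
  obtain a where "fst p = Suc a" using assms by (cases "fst p") (auto simp: left_label_def)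
  then show thesis by (intro that[of "(a, snd p)"]) (simp add: right_of_def prod_eq_iff)
qed

lemma upper_labelE:
  assumes "upper_label L p \<noteq> None"
  obtains q where "p = below q"
proof -
  obtain a where "snd p = Suc a" using assms by (cases "snd p") (auto simp: upper_label_def)
  then show thesis by (intro that[of "(fst p, a)"]) (simp add: below_def prod_eq_iff)
qed

lemma distinct_ledges_at: "distinct (ledges_at p)"
  by (cases p) (auto simp: ledges_at_def split: nat.splits)

lemma set_ledges_at: "e \<in> set (ledges_at p) \<longleftrightarrow> p \<in> ends e"
  by (cases p; cases e) (auto simp: ledges_at_def ends_defs split: nat.splits if_splits)

lemma incident_eq_set: "lattice.incident E p = set (filter (\<lambda>e. e \<in> E) (ledges_at p))"
  by (auto simp: lattice.incident_def set_ledges_at)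

lemma card_incident_eq_length: "card (lattice.incident E p) = length (filter (\<lambda>e. e \<in> E) (ledges_at p))"
  unfolding incident_eq_set by (rule distinct_card) (simp add: distinct_ledges_at)

lemma present_point_labels: "present (point_labels L p) = map (the \<circ> L) (filter (\<lambda>e. e \<in> dom L) (ledges_at p))"
  by (cases "fst p"; cases "snd p")
    (simp_all add: present_def map_filter_def point_labels_def ledges_at_def left_label_def upper_label_def dom_def)

lemma card_incident_dom: "card (lattice.incident (dom L) p) = length (present (point_labels L p))"
  by (simp add: card_incident_eq_length present_point_labels)

lemma point_rule_iff:
  assumes es: "distinct es" "present ls = map l es" and c: "c \<le> 1"
  shows "point_rule c ls \<longleftrightarrow> (length es = 1 \<longrightarrow> (\<forall>e\<in>set es. l e = 2 - c)) \<and>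
    (2 \<le> length es \<longrightarrow> (\<exists>e f. e \<noteq> f \<and> {e \<in> set es. l e \<noteq> 0} = {e, f} \<and> l e = l f))"
proof -
  define ks where "ks = filter (\<lambda>e. l e \<noteq> 0) es"
  have ks: "set ks = {e \<in> set es. l e \<noteq> 0}" "distinct ks" "length ks \<le> length es"
    using es(1) by (simp_all add: ks_def)
  have pair: "(\<exists>e f. e \<noteq> f \<and> set ks = {e, f} \<and> l e = l f) \<longleftrightarrow> (\<exists>e f. ks = [e, f] \<and> l e = l f)"
  proof
    assume "\<exists>e f. e \<noteq> f \<and> set ks = {e, f} \<and> l e = l f"
    then obtain e f where ef: "e \<noteq> f" "set ks = {e, f}" "l e = l f" by blast
    then have "length ks = 2" using distinct_card[OF ks(2)] by simp
    then obtain a b where "ks = [a, b]" by (auto simp: length_Suc_conv numeral_2_eq_2)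
    then have "l a = l b" using ef by (auto simp: doubleton_eq_iff)
    then show "\<exists>e f. ks = [e, f] \<and> l e = l f" using \<open>ks = [a, b]\<close> by blast
  next
    assume "\<exists>e f. ks = [e, f] \<and> l e = l f"
    then obtain e f where "ks = [e, f]" "l e = l f" by blast
    then show "\<exists>e f. e \<noteq> f \<and> set ks = {e, f} \<and> l e = l f"
      using ks(2) by (intro exI[of _ e] exI[of _ f]) simp
  qed
  have rule: "point_rule c ls \<longleftrightarrow> (case map l ks of [] \<Rightarrow> es = []
      | [a] \<Rightarrow> map l es = [2 - c] | [a, b] \<Rightarrow> a = b | _ \<Rightarrow> False)"
    by (simp add: point_rule_def es(2) ks_def filter_map comp_def split: list.split)
  consider (empty) "es = []" | (single) e where "es = [e]" | (many) "2 \<le> length es"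
    by (cases es rule: remdups_adj.cases) auto
  then show ?thesis
  proof cases
    case single
    moreover have "2 - c \<noteq> 0" using c by simp
    ultimately show ?thesis unfolding rule by (cases "l e = 0") (simp_all add: ks_def)
  next
    case many
    then have ne: "es \<noteq> []" "map l es \<noteq> [2 - c]" by (auto simp: map_eq_Cons_conv)
    have "point_rule c ls \<longleftrightarrow> (\<exists>e f. ks = [e, f] \<and> l e = l f)"
      unfolding rule using ne by (auto split: list.split)
    then show ?thesis unfolding ks(1)[symmetric] pair using many by simp
  qed (auto simp: rule ks_def)
qed

context lattice_line_graph
begin

definition edge_label :: "(ledge \<Rightarrow> nat) \<Rightarrow> ledge \<Rightarrow> label" where
  "edge_label l e = (if e \<in> E then Some (l e) else None)"

lemma labelling_iff_point_rule:
  "labelling l \<longleftrightarrow> (\<forall>e. l e \<le> 2) \<and> (\<forall>e. l e \<noteq> 0 \<longrightarrow> e \<in> E) \<and>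
     (\<forall>p. point_rule (lattice_colour p) (point_labels (edge_label l) p))"
proof -
  have "point_rule (lattice_colour p) (point_labels (edge_label l) p) \<longleftrightarrow>
      (card (incident E p) = 1 \<longrightarrow> (\<forall>e\<in>incident E p. l e = 2 - lattice_colour p)) \<and>
      (2 \<le> card (incident E p) \<longrightarrow> (\<exists>e f. e \<noteq> f \<and> {e \<in> incident E p. l e \<noteq> 0} = {e, f} \<and> l e = l f))" for p
    unfolding card_incident_eq_length unfolding incident_eq_set
  proof (rule point_rule_iff)
    show "distinct (filter (\<lambda>e. e \<in> E) (ledges_at p))" by (simp add: distinct_ledges_at)
    have "dom (edge_label l) = E" by (auto simp: edge_label_def split: if_splits)
    then show "present (point_labels (edge_label l) p) = map l (filter (\<lambda>e. e \<in> E) (ledges_at p))"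
      unfolding present_point_labels by (simp add: edge_label_def)
  qed (rule colour_le)
  then show ?thesis unfolding labelling_def by (simp only: all_conj_distrib)
qed

end

section \<open>The cells of the crossbar\<close>

text \<open>A cell is a block of 6 times 18 lattice points, listed row by row. A mask tells which edges
  leave a point: 1 for the edge to the right, 2 for the edge downwards. In a cell of type \<open>Pass\<close> a
  row wire and a column wire cross; in a cell of type \<open>Add\<close> the bit of the column is added to the bit
  of the row, and both bits must not be 1. A row wire consists of two lines, which enter a cell at its
  first two points on the left and carry a bit and its complement; a column wire enters a cell at its
  third point on the top. The cells at the top and bottom of the crossbar join the wires of two
  neighbouring columns.\<close>

datatype cell_type = Empty | Pass | Add | CupL | CupR | CapL | CapR | Term

text \<open>The labels of the edges that leave a point to the right and downwards, and a potential of the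
  point.\<close>

type_synonym code = "nat \<times> nat \<times> nat"

definition pass_mask :: "nat list" where
  "pass_mask =
     [1, 2, 2, 0, 3, 1, 2, 2, 2, 0, 2, 3, 2, 3, 2, 0, 2, 2, 2, 3, 1, 2, 2, 2, 3, 2, 2, 2, 2,
     2, 3, 2, 2, 2, 2, 2, 2, 3, 1, 2, 2, 2, 2, 3, 3, 2, 2, 2, 2, 2, 0, 2, 2, 2, 2, 2, 2, 2,
     2, 2, 2, 3, 1, 2, 2, 2, 2, 3, 1, 2, 2, 2, 2, 3, 3, 2, 2, 2, 2, 2, 0, 2, 2, 2, 2, 2, 0,
     1, 0, 2, 2, 1, 1, 1, 1, 0, 1, 1, 2, 0, 0, 0, 0, 0, 2, 0, 0, 0]"

definition add_mask :: "nat list" where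
  "add_mask =
     [1, 2, 2, 0, 3, 1, 2, 2, 2, 0, 2, 3, 2, 2, 2, 2, 2, 2, 2, 3, 1, 2, 2, 2, 3, 1, 1, 2, 2,
     2, 3, 1, 3, 2, 2, 2, 3, 0, 3, 2, 2, 2, 3, 3, 1, 2, 2, 2, 2, 2, 2, 2, 2, 2, 2, 3, 1, 2,
     2, 2, 2, 3, 3, 2, 2, 2, 2, 2, 2, 2, 2, 2, 2, 2, 0, 2, 2, 2, 2, 2, 0, 2, 2, 2, 2, 2, 0,
     1, 0, 2, 2, 1, 1, 1, 1, 0, 1, 1, 2, 0, 0, 0, 0, 0, 2, 0, 0, 0]"

definition pass_codes00 :: "code list" where
  "pass_codes00 =
     [(2,0,0), (0,2,1), (0,1,13), (0,0,0), (2,2,26), (2,0,27), (0,1,0), (0,2,2), (0,1,12), (0,0,0),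
     (0,2,25), (1,1,23), (0,1,1), (0,2,3), (0,1,11), (0,0,0), (0,2,24), (0,1,22), (0,1,2), (0,2,4),
     (1,0,10), (0,1,9), (0,2,23), (0,1,21), (0,1,3), (0,2,5), (0,2,0), (0,1,8), (0,2,22), (0,1,20),
     (0,1,4), (0,2,4), (0,2,1), (0,1,7), (0,2,21), (0,1,19), (0,1,5), (2,0,3), (0,0,2), (0,1,6),
     (0,2,20), (0,1,18), (0,1,6), (2,2,2), (0,2,1), (0,1,5), (0,2,19), (0,1,17), (0,1,7), (0,2,3),
     (0,0,0), (0,1,4), (0,2,18), (0,1,16), (0,1,8), (0,2,4), (0,1,0), (0,1,3), (0,2,17), (0,1,15),
     (0,1,9), (0,2,5), (1,0,1), (0,0,2), (0,2,16), (0,1,14), (0,1,10), (2,0,6), (2,0,7), (0,2,8),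
     (0,2,15), (0,1,13), (0,1,11), (1,1,2), (0,1,1), (0,2,9), (0,2,14), (0,1,12), (0,1,12), (0,1,3),
     (0,0,0), (0,2,10), (0,2,13), (0,1,11), (0,1,13), (0,1,4), (0,0,0), (2,0,11), (0,0,12), (0,1,10),
     (0,1,14), (1,0,5), (1,0,6), (1,0,7), (1,0,8), (0,0,9), (1,0,15), (1,0,16), (0,1,17), (0,0,0),
     (0,0,0), (0,0,0), (0,0,0), (0,0,0), (0,1,18), (0,0,0), (0,0,0), (0,0,0)]"

definition pass_codes01 :: "code list" where
  "pass_codes01 =
     [(2,0,0), (0,2,1), (0,2,6), (0,0,0), (2,2,26), (2,0,27), (0,1,0), (0,2,2), (0,2,5), (0,0,0),
     (0,2,25), (1,1,23), (0,1,1), (2,0,3), (0,0,4), (0,0,0), (0,2,24), (0,1,22), (0,1,2), (1,1,5),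
     (1,0,6), (0,1,7), (0,2,23), (0,1,21), (1,0,3), (0,0,4), (0,2,0), (0,1,8), (0,2,22), (0,1,20),
     (2,2,5), (0,2,4), (0,2,1), (0,1,7), (0,2,21), (0,1,19), (0,2,6), (2,0,3), (0,0,2), (0,1,6),
     (0,2,20), (0,1,18), (0,2,7), (2,2,2), (0,2,1), (0,1,5), (0,2,19), (0,1,17), (0,2,8), (0,2,3),
     (0,0,0), (0,1,4), (0,2,18), (0,1,16), (0,2,9), (0,2,4), (0,1,0), (0,1,3), (0,2,17), (0,1,15),
     (0,2,10), (0,2,5), (1,0,1), (0,0,2), (0,2,16), (0,1,14), (0,2,11), (2,0,6), (2,0,7), (0,2,8),
     (0,2,15), (0,1,13), (0,2,12), (1,1,2), (0,1,1), (0,2,9), (0,2,14), (0,1,12), (0,2,13), (0,1,3),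
     (0,0,0), (0,2,10), (0,2,13), (0,1,11), (0,2,14), (0,1,4), (0,0,0), (2,0,11), (0,0,12), (0,1,10),
     (0,2,15), (1,0,5), (1,0,6), (1,0,7), (1,0,8), (0,0,9), (2,0,16), (2,0,17), (0,2,18), (0,0,0),
     (0,0,0), (0,0,0), (0,0,0), (0,0,0), (0,2,19), (0,0,0), (0,0,0), (0,0,0)]"

definition pass_codes10 :: "code list" where
  "pass_codes10 =
     [(1,0,0), (0,1,1), (0,1,6), (0,0,0), (1,1,19), (1,0,20), (0,2,0), (0,1,2), (0,1,5), (0,0,0),
     (0,1,18), (2,2,30), (0,2,1), (1,0,3), (0,0,4), (0,0,0), (0,1,17), (0,2,29), (0,2,2), (2,2,5),
     (2,0,6), (0,2,6), (0,1,16), (0,2,28), (2,0,3), (0,0,4), (0,2,0), (0,2,5), (0,1,15), (0,2,27),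
     (1,1,8), (0,1,7), (0,2,1), (0,2,4), (0,1,14), (0,2,26), (0,1,9), (0,1,6), (2,0,2), (0,0,3),
     (0,1,13), (0,2,25), (0,1,10), (0,1,5), (2,2,1), (0,2,2), (0,1,12), (0,2,24), (0,1,11), (0,1,4),
     (0,0,0), (0,2,3), (0,1,11), (0,2,23), (0,1,12), (0,1,3), (0,1,0), (0,2,4), (0,1,10), (0,2,22),
     (0,1,13), (1,0,2), (0,0,1), (0,2,5), (0,1,9), (0,2,21), (0,1,14), (2,2,8), (2,0,7), (0,0,6),
     (0,1,8), (0,2,20), (0,1,15), (0,2,9), (1,1,1), (0,1,2), (0,1,7), (0,2,19), (0,1,16), (0,2,10),
     (0,0,0), (0,1,3), (0,1,6), (0,2,18), (0,1,17), (0,2,11), (0,0,0), (1,0,4), (0,0,5), (0,2,17),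
     (0,1,18), (2,0,12), (2,0,13), (2,0,14), (2,0,15), (0,0,16), (1,0,19), (1,0,20), (0,1,21), (0,0,0),
     (0,0,0), (0,0,0), (0,0,0), (0,0,0), (0,1,22), (0,0,0), (0,0,0), (0,0,0)]"

definition pass_codes11 :: "code list" where
  "pass_codes11 =
     [(1,0,0), (0,1,1), (0,2,10), (0,0,0), (1,1,19), (1,0,20), (0,2,0), (0,1,2), (0,2,9), (0,0,0),
     (0,1,18), (2,2,30), (0,2,1), (0,1,3), (0,2,8), (0,0,0), (0,1,17), (0,2,29), (0,2,2), (0,1,4),
     (2,0,7), (0,2,6), (0,1,16), (0,2,28), (0,2,3), (0,1,5), (0,2,0), (0,2,5), (0,1,15), (0,2,27),
     (0,2,4), (0,1,6), (0,2,1), (0,2,4), (0,1,14), (0,2,26), (0,2,5), (0,1,6), (2,0,2), (0,0,3),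
     (0,1,13), (0,2,25), (0,2,6), (0,1,5), (2,2,1), (0,2,2), (0,1,12), (0,2,24), (0,2,7), (0,1,4),
     (0,0,0), (0,2,3), (0,1,11), (0,2,23), (0,2,8), (0,1,3), (0,1,0), (0,2,4), (0,1,10), (0,2,22),
     (0,2,9), (1,0,2), (0,0,1), (0,2,5), (0,1,9), (0,2,21), (0,2,10), (2,2,8), (2,0,7), (0,0,6), (0,1,8),
     (0,2,20), (0,2,11), (0,2,9), (1,1,1), (0,1,2), (0,1,7), (0,2,19), (0,2,12), (0,2,10), (0,0,0),
     (0,1,3), (0,1,6), (0,2,18), (0,2,13), (0,2,11), (0,0,0), (1,0,4), (0,0,5), (0,2,17), (0,2,14),
     (2,0,12), (2,0,13), (2,0,14), (2,0,15), (0,0,16), (2,0,15), (2,0,16), (0,2,17), (0,0,0), (0,0,0),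
     (0,0,0), (0,0,0), (0,0,0), (0,2,18), (0,0,0), (0,0,0), (0,0,0)]"

definition add_codes00 :: "code list" where
  "add_codes00 =
     [(2,0,0), (0,2,1), (0,1,5), (0,0,0), (2,2,22), (2,0,23), (0,1,0), (0,2,2), (0,1,4), (0,0,0),
     (0,2,21), (1,1,35), (0,1,1), (0,2,3), (0,1,3), (0,1,0), (0,2,20), (0,1,34), (0,1,2), (0,2,4),
     (1,0,2), (0,0,1), (0,2,19), (0,1,33), (0,1,3), (2,0,5), (2,0,6), (0,2,7), (0,2,18), (0,1,32),
     (1,0,4), (1,0,5), (0,1,6), (0,2,6), (0,2,17), (0,1,31), (1,1,1), (0,0,0), (0,1,7), (0,2,5),
     (0,2,16), (0,1,30), (0,1,2), (1,1,9), (0,0,8), (0,2,4), (0,2,15), (0,1,29), (0,1,3), (0,1,10),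
     (0,2,0), (0,2,3), (0,2,14), (0,1,28), (0,1,4), (0,1,11), (2,0,1), (0,0,2), (0,2,13), (0,1,27),
     (0,1,5), (0,1,12), (2,2,2), (0,2,3), (0,2,12), (0,1,26), (0,1,6), (0,1,13), (0,2,1), (0,2,4),
     (0,2,11), (0,1,25), (0,1,7), (0,1,14), (0,0,0), (0,2,5), (0,2,10), (0,1,24), (0,1,8), (0,1,15),
     (0,0,0), (0,2,6), (0,2,9), (0,1,23), (0,1,9), (0,1,16), (0,0,0), (2,0,7), (0,0,8), (0,1,22),
     (0,1,10), (1,0,17), (1,0,18), (1,0,19), (1,0,20), (0,0,21), (1,0,11), (1,0,12), (0,1,13), (0,0,0),
     (0,0,0), (0,0,0), (0,0,0), (0,0,0), (0,1,14), (0,0,0), (0,0,0), (0,0,0)]"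

definition add_codes01 :: "code list" where
  "add_codes01 =
     [(2,0,0), (0,2,1), (0,2,8), (0,0,0), (1,1,31), (1,0,32), (0,1,0), (0,2,2), (0,2,7), (0,0,0),
     (0,1,30), (2,2,26), (0,1,1), (0,2,3), (0,2,6), (0,1,0), (0,1,29), (0,2,25), (0,1,2), (2,0,4),
     (0,0,5), (0,1,1), (0,1,28), (0,2,24), (1,0,3), (1,0,4), (1,0,3), (0,0,2), (0,1,27), (0,2,23),
     (1,1,2), (1,0,3), (1,0,4), (0,1,5), (0,1,26), (0,2,22), (1,0,1), (0,0,0), (1,1,7), (0,0,6),
     (0,1,25), (0,2,21), (2,2,5), (0,2,4), (1,0,8), (0,1,9), (0,1,24), (0,2,20), (0,2,6), (0,2,3),
     (0,2,0), (0,1,10), (0,1,23), (0,2,19), (0,2,7), (2,0,2), (0,0,1), (0,1,11), (0,1,22), (0,2,18),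
     (0,2,8), (2,2,3), (0,2,2), (0,1,12), (0,1,21), (0,2,17), (0,2,9), (0,2,4), (0,2,1), (0,1,13),
     (0,1,20), (0,2,16), (0,2,10), (0,2,5), (0,0,0), (0,1,14), (0,1,19), (0,2,15), (0,2,11), (0,2,6),
     (0,0,0), (0,1,15), (0,1,18), (0,2,14), (0,2,12), (0,2,7), (0,0,0), (1,0,16), (0,0,17), (0,2,13),
     (0,2,13), (2,0,8), (2,0,9), (2,0,10), (2,0,11), (0,0,12), (2,0,14), (2,0,15), (0,2,16), (0,0,0),
     (0,0,0), (0,0,0), (0,0,0), (0,0,0), (0,2,17), (0,0,0), (0,0,0), (0,0,0)]"

definition add_codes10 :: "code list" where
  "add_codes10 =
     [(1,0,0), (0,1,1), (0,1,5), (0,0,0), (1,1,32), (1,0,33), (0,2,0), (0,1,2), (0,1,4), (0,0,0),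
     (0,1,31), (2,2,26), (0,2,1), (0,1,3), (0,1,3), (0,1,0), (0,1,30), (0,2,25), (0,2,2), (0,1,4),
     (1,0,2), (0,0,1), (0,1,29), (0,2,24), (0,2,3), (1,0,5), (1,0,6), (0,1,7), (0,1,28), (0,2,23),
     (2,0,4), (2,0,5), (0,2,6), (0,1,8), (0,1,27), (0,2,22), (1,1,1), (0,0,0), (0,2,6), (0,1,9),
     (0,1,26), (0,2,21), (0,1,2), (2,2,4), (0,0,5), (0,1,10), (0,1,25), (0,2,20), (0,1,3), (0,2,3),
     (0,2,0), (0,1,11), (0,1,24), (0,2,19), (0,1,4), (2,0,2), (0,0,1), (0,1,12), (0,1,23), (0,2,18),
     (0,1,5), (2,2,3), (0,2,2), (0,1,13), (0,1,22), (0,2,17), (0,1,6), (0,2,4), (0,2,1), (0,1,14),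
     (0,1,21), (0,2,16), (0,1,7), (0,2,5), (0,0,0), (0,1,15), (0,1,20), (0,2,15), (0,1,8), (0,2,6),
     (0,0,0), (0,1,16), (0,1,19), (0,2,14), (0,1,9), (0,2,7), (0,0,0), (1,0,17), (0,0,18), (0,2,13),
     (0,1,10), (2,0,8), (2,0,9), (2,0,10), (2,0,11), (0,0,12), (1,0,11), (1,0,12), (0,1,13), (0,0,0),
     (0,0,0), (0,0,0), (0,0,0), (0,0,0), (0,1,14), (0,0,0), (0,0,0), (0,0,0)]"

definition cell_mask :: "cell_type \<Rightarrow> nat list" where
  "cell_mask t = (case t of Empty \<Rightarrow> replicate 108 0 | Pass \<Rightarrow> pass_mask | Add \<Rightarrow> add_mask
   | CupL \<Rightarrow> (replicate 108 0)[98 := 3, 99 := 1, 100 := 1, 101 := 1, 104 := 2]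
   | CupR \<Rightarrow> (replicate 108 0)[96 := 1, 97 := 1, 98 := 2, 104 := 2]
   | CapL \<Rightarrow> (replicate 108 0)[2 := 1, 3 := 1, 4 := 1, 5 := 1]
   | CapR \<Rightarrow> (replicate 108 0)[0 := 1, 1 := 1]
   | Term \<Rightarrow> (replicate 108 0)[0 := 1, 6 := 2])"

definition cell_codes :: "cell_type \<Rightarrow> nat \<Rightarrow> nat \<Rightarrow> code list" where
  "cell_codes t c x = (case t of Empty \<Rightarrow> replicate 108 (0, 0, 0)
   | Pass \<Rightarrow> if c = 0 then (if x = 0 then pass_codes00 else pass_codes01)
       else (if x = 0 then pass_codes10 else pass_codes11)
   | Add \<Rightarrow> if c = 0 then (if x = 0 then add_codes00 else add_codes01) else add_codes10
   | CupL \<Rightarrow> (replicate 108 (0, 0, 0))[98 := (1 + x, 1 + x, 101), 99 := (1 + x, 0, 102), 100 := (1 + x, 0, 103),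
       101 := (1 + x, 0, 104), 104 := (0, 1 + x, 100)]
   | CupR \<Rightarrow> (replicate 108 (0, 0, 0))[96 := (1 + x, 0, 100), 97 := (1 + x, 0, 101), 98 := (0, 1 + x, 102),
       104 := (0, 1 + x, 103)]
   | CapL \<Rightarrow> (replicate 108 (0, 0, 0))[2 := (1 + x, 0, 100), 3 := (1 + x, 0, 101), 4 := (1 + x, 0, 102),
       5 := (1 + x, 0, 103)]
   | CapR \<Rightarrow> (replicate 108 (0, 0, 0))[0 := (1 + x, 0, 100), 1 := (1 + x, 0, 101), 2 := (0, 0, 102)]
   | Term \<Rightarrow> (replicate 108 (0, 0, 0))[0 := (1, 0, 0), 6 := (0, 2, 0)])"

lemma length_cell_mask [simp]: "length (cell_mask t) = 108"
  by (cases t) (simp_all add: cell_mask_def pass_mask_def add_mask_def)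

lemma length_cell_codes [simp]: "length (cell_codes t c x) = 108"
  by (cases t) (simp_all add: cell_codes_def pass_codes00_def pass_codes01_def pass_codes10_def
    pass_codes11_def add_codes00_def add_codes01_def add_codes10_def)

definition edge_on :: "cell_type \<Rightarrow> nat \<Rightarrow> bool \<Rightarrow> bool" where
  "edge_on t j d \<longleftrightarrow> (if d then 2 \<le> cell_mask t ! j else odd (cell_mask t ! j))"

subsection \<open>Sweeping a cell\<close>

text \<open>The points of a cell are visited row by row. A frontier consists of the labels of the next 18
  edges to the left of the rows, beginning with the edge to the left of the current point and
  ending with edges that leave the completed rows to the right, and of the labels of the edges that
  enter the next six points from above.\<close>

type_synonym frontier = "label list \<times> label list"

definition advance :: "bool \<Rightarrow> label \<Rightarrow> label \<Rightarrow> frontier \<Rightarrow> frontier" where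
  "advance row_end r d s = (if row_end then tl (fst s) @ [r] else r # tl (fst s), tl (snd s) @ [d])"

definition current_labels :: "frontier \<Rightarrow> label \<Rightarrow> label \<Rightarrow> label list" where
  "current_labels s r d = [hd (fst s), hd (snd s), r, d]"

fun sweep :: "(nat \<times> label \<times> label) list \<Rightarrow> frontier \<Rightarrow> label list list \<times> frontier" where
  "sweep [] s = ([], s)"
| "sweep ((j, r, d) # outs) s =
     (let (ls, t) = sweep outs (advance (j mod 6 = 5) r d s) in (current_labels s r d # ls, t))"

definition label_choices :: "bool \<Rightarrow> label list" where
  "label_choices b = (if b then [Some 0, Some 1, Some 2] else [None])"

definition cell_colour :: "nat \<Rightarrow> nat" where "cell_colour j = (j mod 6 + j div 6) mod 2"

fun scan :: "(nat \<times> nat) list \<Rightarrow> frontier list \<Rightarrow> frontier list" where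
  "scan [] S = S"
| "scan ((j, m) # ms) S = (let c = cell_colour j; row_end = (j mod 6 = 5) in
     scan ms (remdups [advance row_end r d s. s \<leftarrow> S, r \<leftarrow> label_choices (odd m),
       d \<leftarrow> label_choices (2 \<le> m), point_rule c (current_labels s r d)]))"

definition row_labels :: "nat \<Rightarrow> label list" where
  "row_labels c = [Some (2 - c), Some (1 + c)] @ replicate 16 None"
definition no_row :: "label list" where "no_row = replicate 18 None"
definition column_label :: "nat \<Rightarrow> label list" where
  "column_label x = [None, None, Some (1 + x), None, None, None]"
definition no_column :: "label list" where "no_column = replicate 6 None"
definition cup_link :: "nat \<Rightarrow> label list" where "cup_link x = no_row[16 := Some (1 + x)]"
definition cap_link :: "nat \<Rightarrow> label list" where "cap_link x = no_row[0 := Some (1 + x)]"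

text \<open>Labels on the boundary of a cell, depending on the bit \<open>c\<close> on the left of its row wire and the
  bit \<open>x\<close> of its column wire. The row wire begins in the cell if \<open>first\<close> holds.\<close>

definition row_output :: "cell_type \<Rightarrow> nat \<Rightarrow> nat \<Rightarrow> nat" where
  "row_output t c x = c + (if t = Add then x else 0)"

definition west_input :: "cell_type \<Rightarrow> bool \<Rightarrow> nat \<Rightarrow> nat \<Rightarrow> label list" where
  "west_input t first c x = (case t of Pass \<Rightarrow> if first then no_row else row_labels c
     | Add \<Rightarrow> if first then no_row else row_labels c | Term \<Rightarrow> row_labels c
     | CupR \<Rightarrow> cup_link x | CapR \<Rightarrow> cap_link x | _ \<Rightarrow> no_row)"
definition north_input :: "cell_type \<Rightarrow> nat \<Rightarrow> label list" where
  "north_input t x = (if t \<in> {Pass, Add, CapL, CapR} then column_label x else no_column)"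
definition east_output :: "cell_type \<Rightarrow> nat \<Rightarrow> nat \<Rightarrow> label list" where
  "east_output t c x = (case t of Pass \<Rightarrow> row_labels (row_output t c x) | Add \<Rightarrow> row_labels (row_output t c x)
     | CupL \<Rightarrow> cup_link x | CapL \<Rightarrow> cap_link x | _ \<Rightarrow> no_row)"
definition south_output :: "cell_type \<Rightarrow> nat \<Rightarrow> label list" where
  "south_output t x = (if t \<in> {Pass, Add, CupL, CupR} then column_label x else no_column)"

definition wire_inputs :: "(cell_type \<times> bool \<times> nat \<times> nat) list" where
  "wire_inputs = [(t, first, c, x). t \<leftarrow> [Pass, Add], (first, c) \<leftarrow> [(True, 0), (False, 0), (False, 1)], x \<leftarrow> [0, 1]]"

lemma in_wire_inputs:
  assumes "t \<in> {Pass, Add}" "c \<le> 1" "x \<le> 1" "first \<Longrightarrow> c = 0"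
  shows "(t, first, c, x) \<in> set wire_inputs"
proof -
  have "x = 0 \<or> x = 1" "c = 0 \<or> c = 1" using assms by linarith+
  then show ?thesis using assms(1,4) by (cases first) (auto simp: wire_inputs_def)
qed

definition cell_scan :: "cell_type \<Rightarrow> label list \<Rightarrow> label list \<Rightarrow> frontier list" where
  "cell_scan t ws us = scan (zip [0..<108] (cell_mask t)) [(ws, us)]"

lemma scan_wire_inputs: "list_all (\<lambda>(t, first, c, x). list_all
    (\<lambda>s. row_output t c x \<le> 1 \<and> s = (east_output t c x, south_output t x))
    (cell_scan t (west_input t first c x) (north_input t x))) wire_inputs"
  by code_simp

lemma scan_wire_cell:
  assumes "s \<in> set (cell_scan t (west_input t first c x) (north_input t x))"
    and "t \<in> {Pass, Add}" "c \<le> 1" "x \<le> 1" "first \<Longrightarrow> c = 0"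
  shows "row_output t c x \<le> 1" "s = (east_output t c x, south_output t x)"
proof -
  have "(t, first, c, x) \<in> set wire_inputs" using assms(2-5) by (rule in_wire_inputs)
  then show "row_output t c x \<le> 1" "s = (east_output t c x, south_output t x)"
    using scan_wire_inputs assms(1) unfolding list_all_iff by fastforce+
qed

lemma scan_Term: "cell_scan Term (row_labels 0) no_column = []"
  by code_simp

lemma scan_CupL: "set (cell_scan CupL no_row no_column) \<subseteq> (\<lambda>x. (cup_link x, column_label x)) ` set [0, 1]"
  by code_simp

lemma scan_CupR: "list_all (\<lambda>x. set (cell_scan CupR (cup_link x) no_column) \<subseteq> {(no_row, column_label x)}) [0, 1]"
  by code_simp

subsection \<open>Descending labellings of a cell\<close>

definition cell_outs :: "cell_type \<Rightarrow> nat \<Rightarrow> nat \<Rightarrow> (label \<times> label) list" where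
  "cell_outs t c x = map2 (\<lambda>m (a, b, h). (if odd m then Some a else None, if 2 \<le> m then Some b else None))
     (cell_mask t) (cell_codes t c x)"

lemma length_cell_outs [simp]: "length (cell_outs t c x) = 108"
  by (simp add: cell_outs_def)

definition cell_potentials :: "cell_type \<Rightarrow> nat \<Rightarrow> nat \<Rightarrow> nat list" where
  "cell_potentials t c x = map (\<lambda>(a, b, h). h) (cell_codes t c x)"

lemma length_cell_potentials [simp]: "length (cell_potentials t c x) = 108"
  by (simp add: cell_potentials_def)

definition cell_sweep :: "cell_type \<Rightarrow> bool \<Rightarrow> nat \<Rightarrow> nat \<Rightarrow> label list list \<times> frontier" where
  "cell_sweep t first c x = sweep (zip [0..<108] (cell_outs t c x)) (west_input t first c x, north_input t x)"

text \<open>Along the paths inside a cell the potential has no local minimum except at the ends of the paths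
  and on the left boundary of the cell; this excludes cycles. Of two cells that are joined by a column
  wire at the boundary of the crossbar, the inner one has potentials of at most 99.\<close>

definition point_ok :: "nat \<Rightarrow> label list \<Rightarrow> nat \<Rightarrow> nat \<Rightarrow> nat \<Rightarrow> nat \<Rightarrow> nat \<Rightarrow> bool" where
  "point_ok j ls h kl ku kr kd \<longleftrightarrow> list_all (\<lambda>l. l \<in> {None, Some 0, Some 1, Some 2}) ls \<and>
     point_rule (cell_colour j) ls \<and>
     (2 \<le> length (present ls) \<longrightarrow> list_ex (\<lambda>(l, lower). l \<notin> {None, Some 0} \<and> lower)
        (zip ls [j mod 6 = 0 \<or> kl < h, ku < h, j mod 6 \<noteq> 5 \<and> kr < h, kd < h]))"

definition cell_ok :: "cell_type \<Rightarrow> bool \<Rightarrow> nat \<Rightarrow> nat \<Rightarrow> bool" where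
  "cell_ok t first c x \<longleftrightarrow> (case cell_sweep t first c x of (lss, s) \<Rightarrow>
     let hs = cell_potentials t c x in s = (east_output t c x, south_output t x) \<and>
       list_all (\<lambda>h. h < (if t = Pass \<or> t = Add then 100 else 1000)) hs \<and>
       list_all (\<lambda>(j, ls, h, kl, ku, kr, kd). point_ok j ls h kl ku kr kd)
         (zip [0..<108] (zip lss (zip hs (zip (0 # hs) (zip (replicate 6 99 @ hs)
           (zip (tl hs @ [0]) (drop 6 hs @ replicate 6 99))))))))"

lemma cell_ok_wire_inputs:
  "list_all (\<lambda>(t, first, c, x). row_output t c x \<le> 1 \<longrightarrow> cell_ok t first c x) wire_inputs"
  by code_simp

lemma cell_ok_links: "list_all (\<lambda>x. list_all (\<lambda>t. cell_ok t False 0 x) [CupL, CupR, CapL, CapR]) [0, 1]"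
  by code_simp

lemma cell_ok_Term: "cell_ok Term False 1 0"
  by code_simp

lemma cell_ok_Empty: "cell_ok Empty False 0 0"
  by code_simp

lemma cell_ok_independent:
  "cell_ok Empty first c x = cell_ok Empty False 0 0" "cell_ok Term first c x = cell_ok Term False c 0"
  "t \<in> {CupL, CupR, CapL, CapR} \<Longrightarrow> cell_ok t first c x = cell_ok t False 0 x"
  by ((elim insertE emptyE)?; simp only: cell_ok_def cell_sweep_def cell_outs_def cell_potentials_def
    cell_codes_def west_input_def north_input_def east_output_def south_output_def cell_type.case
    insert_iff empty_iff cell_type.distinct simp_thms if_False)+

lemma cell_ok_cell:
  assumes "c \<le> 1" "x \<le> 1" "row_output t c x \<le> 1" "first \<Longrightarrow> c = 0" "t = Term \<Longrightarrow> c = 1"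
  shows "cell_ok t first c x"
proof (cases "t \<in> {Pass, Add}")
  case True
  then have "(t, first, c, x) \<in> set wire_inputs" using assms(1,2,4) by (rule in_wire_inputs)
  then show ?thesis using cell_ok_wire_inputs assms(3) by (auto simp: list_all_iff)
next
  case False
  then consider "t = Empty" | "t = Term" | "t \<in> {CupL, CupR, CapL, CapR}" by (cases t) auto
  then show ?thesis
  proof cases
    assume "t = Empty"
    then show ?thesis using cell_ok_Empty cell_ok_independent(1)[of first c x] by simp
  next
    assume "t = Term"
    then show ?thesis using cell_ok_Term cell_ok_independent(2)[of first c x] assms(5) by simp
  next
    assume t: "t \<in> {CupL, CupR, CapL, CapR}"
    moreover have "x \<in> set [0, 1]" using assms(2) by auto
    ultimately have "cell_ok t False 0 x" using cell_ok_links unfolding list_all_iff by auto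
    then show ?thesis using cell_ok_independent(3)[OF t, of first c x] by simp
  qed
qed

lemma sweep_Term: "snd (cell_sweep Term first c x) = (no_row, no_column)"
  by code_simp

definition cell_capacity :: "cell_type \<Rightarrow> bool \<Rightarrow> nat" where
  "cell_capacity t first = (case t of Empty \<Rightarrow> 0 | Pass \<Rightarrow> if first then 186 else 188
     | Add \<Rightarrow> if first then 186 else 188 | CupL \<Rightarrow> 10 | CupR \<Rightarrow> 8 | CapL \<Rightarrow> 8 | CapR \<Rightarrow> 6 | Term \<Rightarrow> 6)"

definition cell_degrees :: "cell_type \<Rightarrow> bool \<Rightarrow> nat list" where
  "cell_degrees t first = map (length \<circ> present) (fst (cell_sweep t first 0 0))"

lemma list_all_cell_degrees: "list_all (\<lambda>(t, first). let ds = cell_degrees t first in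
     list_all (\<lambda>d. d \<le> 3) ds \<and> sum_list (map (min 2) ds) = cell_capacity t first)
   ([(Pass, True), (Add, True)] @ map (\<lambda>t. (t, False)) [Empty, Pass, Add, CupL, CupR, CapL, CapR, Term])"
  by code_simp

lemma cell_degrees_independent: "t \<notin> {Pass, Add} \<Longrightarrow> cell_degrees t True = cell_degrees t False"
  by (cases t) (simp_all add: cell_degrees_def cell_sweep_def west_input_def)

lemma cell_degrees_le_3: "d \<in> set (cell_degrees t first) \<Longrightarrow> d \<le> 3"
  and sum_cell_degrees: "sum_list (map (min 2) (cell_degrees t first)) = cell_capacity t first"
proof -
  have "list_all (\<lambda>d. d \<le> 3) (cell_degrees t first) \<and>
      sum_list (map (min 2) (cell_degrees t first)) = cell_capacity t first"
    using list_all_cell_degrees by (cases t; cases first)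
      (simp_all add: cell_degrees_independent Let_def cell_capacity_def)
  then show "d \<in> set (cell_degrees t first) \<Longrightarrow> d \<le> 3"
    "sum_list (map (min 2) (cell_degrees t first)) = cell_capacity t first" by (auto simp: list_all_iff)
qed

lemma adjacent_points_of_degree_3:
  "list_all (\<lambda>t. cell_degrees t True ! 19 = 3 \<and> cell_degrees t True ! 20 = 3 \<and> edge_on t 19 False) [Pass, Add]"
  by code_simp

section \<open>Grids of cells\<close>

definition cell_point :: "nat \<Rightarrow> nat \<Rightarrow> nat \<Rightarrow> point" where
  "cell_point r v j = (6 * v + j mod 6, 18 * r + j div 6)"

lemma cell_point_Suc: "j mod 6 \<noteq> 5 \<Longrightarrow> cell_point r v (Suc j) = right_of (cell_point r v j)"
  by (simp add: cell_point_def right_of_def mod_Suc div_Suc)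

lemma cell_point_Suc_cell: "cell_point r (Suc v) (6 * y) = right_of (cell_point r v (6 * y + 5))"
  by (simp add: cell_point_def right_of_def)

lemma cell_point_add_6: "cell_point r v (j + 6) = below (cell_point r v j)"
  by (simp add: cell_point_def below_def)

lemma cell_point_add_108: "cell_point r v (j + 108) = cell_point (Suc r) v j"
proof -
  have "(j + 108) mod 6 = j mod 6" "(j + 108) div 6 = j div 6 + 18" by presburger+
  then show ?thesis by (simp add: cell_point_def)
qed

lemma colour_cell_point: "lattice_colour (cell_point r v j) = cell_colour j"
proof -
  have "6 * v + j mod 6 + (18 * r + j div 6) = (j mod 6 + j div 6) + (3 * v + 9 * r) * 2" by simp
  then show ?thesis by (simp only: lattice_colour_def cell_point_def cell_colour_def fst_conv snd_conv mod_mult_self1)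
qed

definition west_labels :: "(ledge \<Rightarrow> label) \<Rightarrow> nat \<Rightarrow> nat \<Rightarrow> label list" where
  "west_labels L r v = map (\<lambda>y. left_label L (cell_point r v (6 * y))) [0..<18]"
definition north_labels :: "(ledge \<Rightarrow> label) \<Rightarrow> nat \<Rightarrow> nat \<Rightarrow> label list" where
  "north_labels L r v = map (\<lambda>x. upper_label L (cell_point r v x)) [0..<6]"

lemma west_labels_0: "west_labels L r 0 = no_row"
  by (simp add: west_labels_def left_label_def cell_point_def no_row_def map_replicate_const)

lemma north_labels_0: "north_labels L 0 v = no_column"
  by (rule nth_equalityI) (simp_all add: north_labels_def upper_label_def cell_point_def no_column_def)

definition frontier_at :: "(ledge \<Rightarrow> label) \<Rightarrow> nat \<Rightarrow> nat \<Rightarrow> nat \<Rightarrow> frontier" where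
  "frontier_at L r v j =
     ((if j < 108 then left_label L (cell_point r v j) #
         map (\<lambda>y. left_label L (cell_point r v (6 * y))) [Suc (j div 6)..<18] else []) @
       map (\<lambda>y. left_label L (cell_point r (Suc v) (6 * y))) [0..<j div 6],
      map (\<lambda>i. upper_label L (cell_point r v i)) [j..<j + 6])"

lemma frontier_at_0: "frontier_at L r v 0 = (west_labels L r v, north_labels L r v)"
  by (simp add: frontier_at_def west_labels_def north_labels_def upt_conv_Cons)

lemma frontier_at_108: "frontier_at L r v 108 = (west_labels L r (Suc v), north_labels L (Suc r) v)"
proof -
  have "[108..<108 + 6] = map (\<lambda>x. x + 108) [0..<6]" by (simp add: map_add_upt)
  then show ?thesis
    by (simp only: frontier_at_def west_labels_def north_labels_def) (simp add: comp_def cell_point_add_108)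
qed

lemma current_labels_frontier_at:
  "j < 108 \<Longrightarrow> current_labels (frontier_at L r v j) (L (cell_point r v j, False)) (L (cell_point r v j, True)) =
     point_labels L (cell_point r v j)"
  by (simp add: current_labels_def frontier_at_def point_labels_def upt_conv_Cons)

lemma advance_frontier_at:
  assumes j: "j < 108"
  shows "advance (j mod 6 = 5) (L (cell_point r v j, False)) (L (cell_point r v j, True)) (frontier_at L r v j) =
    frontier_at L r v (Suc j)"
proof -
  have "[Suc j..<Suc j + 6] = [Suc j..<j + 6] @ [j + 6]"
    using upt_Suc_append[of "Suc j" "j + 6"] by (simp add: add.commute)
  then have upper: "map (\<lambda>i. upper_label L (cell_point r v i)) [Suc j..<Suc j + 6] =
      map (\<lambda>i. upper_label L (cell_point r v i)) [Suc j..<j + 6] @ [L (cell_point r v j, True)]"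
    by (simp only: map_append list.map cell_point_add_6 upper_label_below)
  show ?thesis
  proof (cases "j mod 6 = 5")
    case True
    define y where "y = j div 6"
    have y: "j = 6 * y + 5" "Suc j = 6 * Suc y" "Suc j div 6 = Suc y" "j div 6 = y"
      using True mult_div_mod_eq[of 6 j] by (simp_all add: y_def)
    have rows: "(if Suc j < 108 then left_label L (cell_point r v (Suc j)) #
        map (\<lambda>y. left_label L (cell_point r v (6 * y))) [Suc (Suc y)..<18] else []) =
        map (\<lambda>y. left_label L (cell_point r v (6 * y))) [Suc y..<18]"
      using j unfolding y(2) by (simp add: upt_conv_Cons)
    have "L (cell_point r v j, False) = left_label L (cell_point r (Suc v) (6 * y))"
      unfolding cell_point_Suc_cell y(1) by simp
    then show ?thesis
      unfolding frontier_at_def upper y(3,4) rows using True j by (simp add: advance_def upt_conv_Cons)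
  next
    case False
    then have "Suc j div 6 = j div 6" "Suc j < 108" using j by presburger+
    then show ?thesis unfolding frontier_at_def upper
      using j False by (simp add: advance_def cell_point_Suc upt_conv_Cons)
  qed
qed

lemma sweep_frontier_at:
  assumes "k \<le> 108"
  shows "sweep (map (\<lambda>j. (j, L (cell_point r v j, False), L (cell_point r v j, True))) [k..<108]) (frontier_at L r v k) =
    (map (\<lambda>j. point_labels L (cell_point r v j)) [k..<108], frontier_at L r v 108)"
  using assms
proof (induction k rule: inc_induct)
  case (step k)
  then show ?case
    by (simp add: upt_conv_Cons advance_frontier_at current_labels_frontier_at)
qed simp

lemma scan_frontier_at:
  assumes "k \<le> 108" "frontier_at L r v k \<in> set S"
    and choices: "\<And>j. j < 108 \<Longrightarrow> L (cell_point r v j, False) \<in> set (label_choices (odd (m j)))"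
      "\<And>j. j < 108 \<Longrightarrow> L (cell_point r v j, True) \<in> set (label_choices (2 \<le> m j))"
    and rule: "\<And>j. j < 108 \<Longrightarrow> point_rule (cell_colour j) (point_labels L (cell_point r v j))"
  shows "frontier_at L r v 108 \<in> set (scan (map (\<lambda>j. (j, m j)) [k..<108]) S)"
  using assms(1,2)
proof (induction k arbitrary: S rule: inc_induct)
  case (step k)
  let ?T = "remdups [advance (k mod 6 = 5) r d s. s \<leftarrow> S, r \<leftarrow> label_choices (odd (m k)),
    d \<leftarrow> label_choices (2 \<le> m k), point_rule (cell_colour k) (current_labels s r d)]"
  have "frontier_at L r v (Suc k) \<in> set ?T"
    using step.prems step.hyps choices[of k] rule[of k] unfolding advance_frontier_at[OF step.hyps(2), symmetric]
    by (force simp: current_labels_frontier_at)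
  from step.IH[OF this] show ?case using step.hyps by (simp add: upt_conv_Cons Let_def)
qed simp

lemma cell_sweep_eq:
  assumes "west_labels L r v = west_input t first c x" "north_labels L r v = north_input t x"
    and outs: "\<And>j. j < 108 \<Longrightarrow> cell_outs t c x ! j = (L (cell_point r v j, False), L (cell_point r v j, True))"
  shows "cell_sweep t first c x = (map (\<lambda>j. point_labels L (cell_point r v j)) [0..<108],
    (west_labels L r (Suc v), north_labels L (Suc r) v))"
proof -
  have "zip [0..<108] (cell_outs t c x) =
      map (\<lambda>j. (j, L (cell_point r v j, False), L (cell_point r v j, True))) [0..<108]"
    by (rule nth_equalityI) (simp_all add: outs)
  then show ?thesis using sweep_frontier_at[of 0 L r v]
    by (simp add: cell_sweep_def assms(1,2)[symmetric] frontier_at_0 frontier_at_108)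
qed

lemma cell_scan_mem:
  assumes "\<And>j d. j < 108 \<Longrightarrow> L (cell_point r v j, d) \<in> set (label_choices (edge_on t j d))"
    and "\<And>p. point_rule (lattice_colour p) (point_labels L p)"
  shows "(west_labels L r (Suc v), north_labels L (Suc r) v) \<in>
    set (cell_scan t (west_labels L r v) (north_labels L r v))"
proof -
  have "zip [0..<108] (cell_mask t) = map (\<lambda>j. (j, cell_mask t ! j)) [0..<108]"
    by (rule nth_equalityI) simp_all
  moreover have "frontier_at L r v 108 \<in>
      set (scan (map (\<lambda>j. (j, cell_mask t ! j)) [0..<108]) [frontier_at L r v 0])"
  proof (rule scan_frontier_at)
    show "point_rule (cell_colour j) (point_labels L (cell_point r v j))" for j
      using assms(2)[of "cell_point r v j"] by (simp add: colour_cell_point)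
  qed (use assms(1)[of _ False] assms(1)[of _ True] in \<open>simp_all add: edge_on_def\<close>)
  ultimately show ?thesis by (simp add: cell_scan_def frontier_at_0 frontier_at_108)
qed

definition cell_index :: "point \<Rightarrow> nat" where "cell_index p = 6 * (snd p mod 18) + fst p mod 6"

lemma cell_index_less: "cell_index p < 108"
  using mod_less_divisor[of 18 "snd p"] mod_less_divisor[of 6 "fst p"] unfolding cell_index_def by linarith

lemma cell_point_cell_index: "cell_point (snd p div 18) (fst p div 6) (cell_index p) = p"
  by (simp add: cell_point_def cell_index_def)

lemma cell_point_decode:
  assumes "j < 108"
  shows "fst (cell_point r v j) div 6 = v" "snd (cell_point r v j) div 18 = r" "cell_index (cell_point r v j) = j"
proof -
  have "j div 6 < 18" using assms by simp
  then show "fst (cell_point r v j) div 6 = v" "snd (cell_point r v j) div 18 = r" "cell_index (cell_point r v j) = j"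
    by (simp_all add: cell_point_def cell_index_def)
qed

text \<open>The rows strictly between \<open>cups\<close> and \<open>caps\<close> are the rows of the crossbar; \<open>A r v\<close> tells whether
  the bit of column \<open>v\<close> is added to row \<open>r\<close>.\<close>

locale grid =
  fixes rows cols cups caps wires :: nat and A :: "nat \<Rightarrow> nat \<Rightarrow> bool"
  assumes row_bounds: "Suc cups < caps" "caps < rows" and col_bounds: "0 < wires" "even wires" "wires < cols"
begin

definition kind :: "nat \<Rightarrow> nat \<Rightarrow> cell_type" where
  "kind r v = (if cups < r \<and> r < caps then if v < wires then if A r v then Add else Pass else if v = wires then Term else Empty
     else if v < wires \<and> r = cups then if even v then CupL else CupR
     else if v < wires \<and> r = caps then if even v then CapL else CapR else Empty)"

lemma kind_eq_Add_iff: "kind r v = Add \<longleftrightarrow> cups < r \<and> r < caps \<and> v < wires \<and> A r v"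
  by (auto simp: kind_def)

definition inside :: "point \<Rightarrow> bool" where "inside p \<longleftrightarrow> fst p < 6 * cols \<and> snd p < 18 * rows"

definition E :: "ledge set" where
  "E = {(p, d). inside p \<and> edge_on (kind (snd p div 18) (fst p div 6)) (cell_index p) d}"

definition edge_at :: "nat \<Rightarrow> ledge" where
  "edge_at u = (cell_point (u div 216 div cols) (u div 216 mod cols) (u mod 216 div 2), odd u)"

lemma inside_cell_point: "r < rows \<Longrightarrow> v < cols \<Longrightarrow> j < 108 \<Longrightarrow> inside (cell_point r v j)"
proof -
  assume "r < rows" "v < cols" "j < 108"
  moreover have "j mod 6 < 6" by simp
  ultimately have "6 * v + j mod 6 < 6 * cols" "18 * r + j div 6 < 18 * rows" by linarith+
  then show ?thesis by (simp add: inside_def cell_point_def)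
qed

lemma inside_div: "inside p \<Longrightarrow> snd p div 18 < rows" "inside p \<Longrightarrow> fst p div 6 < cols"
  by (simp_all add: inside_def div_less_iff_less_mult mult.commute)

lemma insideE:
  assumes "inside p"
  obtains r v j where "r < rows" "v < cols" "j < 108" "p = cell_point r v j"
  using that[OF inside_div[OF assms] cell_index_less cell_point_cell_index[symmetric]] .

lemma card_inside: "card {p. inside p} = rows * cols * 108"
proof -
  have "{p. inside p} = {..<6 * cols} \<times> {..<18 * rows}" by (auto simp: inside_def)
  then show ?thesis by (simp add: card_cartesian_product)
qed

lemma edge_at_index:
  assumes "r < rows" "v < cols" "j < 108"
  shows "edge_at (((r * cols + v) * 108 + j) * 2 + of_bool d) = (cell_point r v j, d)"
    and "((r * cols + v) * 108 + j) * 2 + of_bool d < rows * cols * 216"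
proof -
  let ?b = "j * 2 + of_bool d"
  have b: "?b < 216" "?b div 2 = j" "odd ?b = d" using assms(3) by (cases d; simp)+
  have u: "((r * cols + v) * 108 + j) * 2 + of_bool d = (r * cols + v) * 216 + ?b" by (simp add: algebra_simps)
  have digits: "((r * cols + v) * 216 + ?b) div 216 = r * cols + v" "((r * cols + v) * 216 + ?b) mod 216 = ?b"
    using b(1) by (simp, simp only: mod_mult_self3 mod_less)
  have "(r * cols + v) div cols = r" "(r * cols + v) mod cols = v" using assms(2) by simp_all
  moreover have "odd ((r * cols + v) * 216 + ?b) = d" using b(3) by simp
  ultimately show "edge_at (((r * cols + v) * 108 + j) * 2 + of_bool d) = (cell_point r v j, d)"
    unfolding u edge_at_def digits b(2) by simp
  have "r * cols + v + 1 \<le> (r + 1) * cols" using assms(2) by simp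
  also have "\<dots> \<le> rows * cols" using assms(1) by (intro mult_le_mono1) simp
  finally have "(r * cols + v + 1) * 216 \<le> rows * cols * 216" by (rule mult_le_mono1)
  then show "((r * cols + v) * 108 + j) * 2 + of_bool d < rows * cols * 216"
    unfolding u using b(1) by simp
qed

lemma inside_edges_subset: "{p. inside p} \<times> UNIV \<subseteq> edge_at ` {..<rows * cols * 216}"
proof
  fix e assume "e \<in> {p. inside p} \<times> (UNIV :: bool set)"
  then obtain p d where e: "e = (p, d)" "inside p" by auto
  obtain r v j where "r < rows" "v < cols" "j < 108" "p = cell_point r v j" using insideE[OF e(2)] .
  then show "e \<in> edge_at ` {..<rows * cols * 216}"
    using edge_at_index[of r v j d] unfolding e(1) by (metis imageI lessThan_iff)
qed

lemma inj_edge_at: "inj_on edge_at {..<rows * cols * 216}"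
proof (rule eq_card_imp_inj_on)
  have "card ({p. inside p} \<times> (UNIV :: bool set)) \<le> card (edge_at ` {..<rows * cols * 216})"
    by (rule card_mono[OF _ inside_edges_subset]) simp
  moreover have "card (edge_at ` {..<rows * cols * 216}) \<le> rows * cols * 216"
    using card_image_le[of "{..<rows * cols * 216}" edge_at] by simp
  ultimately show "card (edge_at ` {..<rows * cols * 216}) = card {..<rows * cols * 216}"
    by (simp add: card_cartesian_product card_inside)
qed simp

lemma E_subset: "E \<subseteq> edge_at ` {..<rows * cols * 216}"
  using inside_edges_subset by (auto simp: E_def)

lemma cell_point_in_E:
  "r < rows \<Longrightarrow> v < cols \<Longrightarrow> j < 108 \<Longrightarrow> (cell_point r v j, d) \<in> E \<longleftrightarrow> edge_on (kind r v) j d"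
  by (simp add: E_def inside_cell_point cell_point_decode)

subsection \<open>Bits on the wires\<close>

definition row_sum :: "(nat \<Rightarrow> nat) \<Rightarrow> nat \<Rightarrow> nat \<Rightarrow> nat" where
  "row_sum x r v = (\<Sum>u<v. if kind r u = Add then x u else 0)"

definition admissible :: "(nat \<Rightarrow> nat) \<Rightarrow> bool" where
  "admissible x \<longleftrightarrow> (\<forall>v. x v \<le> 1) \<and> (\<forall>i. 2 * i < wires \<longrightarrow> x (2 * i) = x (2 * i + 1)) \<and>
     (\<forall>r. cups < r \<longrightarrow> r < caps \<longrightarrow> row_sum x r wires \<le> 1)"

definition solution :: "(nat \<Rightarrow> nat) \<Rightarrow> bool" where
  "solution x \<longleftrightarrow> (\<forall>v. x v \<le> 1) \<and> (\<forall>i. 2 * i < wires \<longrightarrow> x (2 * i) = x (2 * i + 1)) \<and>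
     (\<forall>r. cups < r \<longrightarrow> r < caps \<longrightarrow> row_sum x r wires = 1)"

lemma admissible_if_solution: "solution x \<Longrightarrow> admissible x"
  by (auto simp: admissible_def solution_def)

lemma admissible_0: "admissible (\<lambda>_. 0)"
  by (simp add: admissible_def row_sum_def)

lemma row_sum_0 [simp]: "row_sum x r 0 = 0" "row_sum (\<lambda>_. 0) r v = 0"
  by (simp_all add: row_sum_def)

lemma row_sum_Suc: "row_sum x r (Suc v) = row_output (kind r v) (row_sum x r v) (x v)"
  by (simp add: row_sum_def row_output_def)

lemma row_sum_le_1:
  assumes "admissible x"
  shows "row_sum x r v \<le> 1"
proof (cases "cups < r \<and> r < caps")
  case True
  have "row_sum x r v = (\<Sum>u\<in>{..<v} \<inter> {..<wires}. if kind r u = Add then x u else 0)"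
    unfolding row_sum_def by (rule sum.mono_neutral_right) (auto simp: kind_eq_Add_iff)
  also have "\<dots> \<le> row_sum x r wires" unfolding row_sum_def by (rule sum_mono2) auto
  also have "\<dots> \<le> 1" using True assms by (simp add: admissible_def)
  finally show ?thesis .
next
  case False
  then have "kind r u \<noteq> Add" for u by (auto simp: kind_eq_Add_iff)
  then show ?thesis by (simp add: row_sum_def)
qed

lemma bit_le_1: "admissible x \<Longrightarrow> x v \<le> 1"
  by (simp add: admissible_def)

lemma bit_twin:
  assumes "admissible x" "even v" "v < wires"
  shows "x (Suc v) = x v" "Suc v < wires"
proof -
  obtain i where "v = 2 * i" using assms(2) by (rule evenE)
  then show "x (Suc v) = x v" using assms(1,3) by (simp add: admissible_def)
  show "Suc v < wires" using assms(2,3) col_bounds by presburger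
qed

abbreviation west_bits :: "(nat \<Rightarrow> nat) \<Rightarrow> nat \<Rightarrow> nat \<Rightarrow> label list" where
  "west_bits x r v \<equiv> west_input (kind r v) (v = 0) (row_sum x r v) (x v)"

abbreviation north_bits :: "(nat \<Rightarrow> nat) \<Rightarrow> nat \<Rightarrow> nat \<Rightarrow> label list" where
  "north_bits x r v \<equiv> north_input (kind r v) (x v)"

lemma west_bits_0: "west_bits x r 0 = no_row"
  using col_bounds by (simp add: kind_def west_input_def)

lemma north_bits_0: "north_bits x 0 v = no_column"
  using row_bounds by (simp add: kind_def north_input_def)

lemma east_output_eq_west_bits:
  assumes "admissible x"
  shows "east_output (kind r v) (row_sum x r v) (x v) = west_bits x r (Suc v)"
proof -
  consider (wire) "cups < r" "r < caps" "v < wires" | (left) "r = cups \<or> r = caps" "even v" "v < wires"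
    | (right) "r = cups \<or> r = caps" "odd v" "v < wires" | (beyond) "r < cups \<or> caps < r \<or> wires \<le> v"
    by linarith
  then show ?thesis
  proof cases
    case wire
    then have "kind r v \<in> {Pass, Add}" "kind r (Suc v) \<in> {Pass, Add, Term}" by (simp_all add: kind_def)
    then show ?thesis by (auto simp: east_output_def west_input_def row_sum_Suc)
  next
    case left
    then show ?thesis using bit_twin[OF assms left(2,3)] row_bounds
      by (auto simp: kind_def east_output_def west_input_def)
  qed (use row_bounds col_bounds in \<open>auto simp: kind_def east_output_def west_input_def\<close>)
qed

lemma south_output_eq_north_bits: "south_output (kind r v) (x v) = north_bits x (Suc r) v"
  using row_bounds by (auto simp: kind_def south_output_def north_input_def)

definition grid_label :: "(nat \<Rightarrow> nat) \<Rightarrow> ledge \<Rightarrow> label" where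
  "grid_label x e = (let r = snd (fst e) div 18; v = fst (fst e) div 6 in
     if inside (fst e) then (if snd e then snd else fst) (cell_outs (kind r v) (row_sum x r v) (x v) ! cell_index (fst e))
     else None)"

lemma cell_outs_nth:
  "j < 108 \<Longrightarrow> cell_outs t c x ! j =
     (if edge_on t j False then Some (fst (cell_codes t c x ! j)) else None,
      if edge_on t j True then Some (fst (snd (cell_codes t c x ! j))) else None)"
  by (simp add: cell_outs_def edge_on_def split: prod.split)

lemma grid_label_cell_point:
  assumes "r < rows" "v < cols" "j < 108"
  shows "cell_outs (kind r v) (row_sum x r v) (x v) ! j =
    (grid_label x (cell_point r v j, False), grid_label x (cell_point r v j, True))"
  using assms by (simp add: grid_label_def inside_cell_point cell_point_decode)

lemma dom_grid_label: "dom (grid_label x) = E"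
proof (rule set_eqI)
  show "e \<in> dom (grid_label x) \<longleftrightarrow> e \<in> E" for e
    by (cases e; cases "snd e") (auto simp: grid_label_def E_def Let_def cell_outs_nth cell_index_less split: if_splits)
qed

lemma cell_ok_solution: "solution x \<Longrightarrow> cell_ok (kind r v) (v = 0) (row_sum x r v) (x v)"
  using row_sum_le_1[OF admissible_if_solution, of x r v] row_sum_le_1[OF admissible_if_solution, of x r "Suc v"]
  by (intro cell_ok_cell) (auto simp: solution_def row_sum_Suc kind_def split: if_splits)

lemma sweep_admissible:
  assumes "admissible x"
  shows "snd (cell_sweep (kind r v) (v = 0) (row_sum x r v) (x v)) = (west_bits x r (Suc v), north_bits x (Suc r) v)"
proof -
  have "snd (cell_sweep (kind r v) (v = 0) (row_sum x r v) (x v)) =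
      (east_output (kind r v) (row_sum x r v) (x v), south_output (kind r v) (x v))"
  proof (cases "kind r v = Term")
    case True
    then show ?thesis by (simp add: sweep_Term east_output_def south_output_def)
  next
    case False
    then have "cell_ok (kind r v) (v = 0) (row_sum x r v) (x v)"
      using row_sum_le_1[OF assms, of r v] row_sum_le_1[OF assms, of r "Suc v"] bit_le_1[OF assms, of v]
      by (intro cell_ok_cell) (simp_all add: row_sum_Suc)
    then show ?thesis by (auto simp: cell_ok_def Let_def)
  qed
  then show ?thesis
    using east_output_eq_west_bits[OF assms] south_output_eq_north_bits by simp
qed

lemma labels_grid_label_step:
  assumes "admissible x" "r < rows" "v < cols"
    and "west_labels (grid_label x) r v = west_bits x r v" "north_labels (grid_label x) r v = north_bits x r v"
  shows "west_labels (grid_label x) r (Suc v) = west_bits x r (Suc v)"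
    "north_labels (grid_label x) (Suc r) v = north_bits x (Suc r) v"
  using sweep_admissible[OF assms(1), of r v]
  by (simp_all add: cell_sweep_eq[OF assms(4,5) grid_label_cell_point[OF assms(2,3)]])

lemma labels_grid_label:
  assumes x: "admissible x"
  shows "r < rows \<Longrightarrow> v \<le> cols \<Longrightarrow> west_labels (grid_label x) r v = west_bits x r v"
    and "r \<le> rows \<Longrightarrow> v < cols \<Longrightarrow> north_labels (grid_label x) r v = north_bits x r v"
proof -
  have west: "west_labels (grid_label x) r v = west_bits x r v"
    if "r < rows" "v \<le> cols" "\<And>v. v < cols \<Longrightarrow> north_labels (grid_label x) r v = north_bits x r v" for r v
    using that(2)
  proof (induction v)
    case (Suc v)
    then show ?case using labels_grid_label_step[OF x that(1)] that(3) by simp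
  qed (simp only: west_labels_0 west_bits_0)
  have north: "north_labels (grid_label x) r v = north_bits x r v" if "r \<le> rows" "v < cols" for r v
    using that
  proof (induction r arbitrary: v)
    case (Suc r)
    then show ?case using labels_grid_label_step[OF x, of r v] west[of r v] by simp
  qed (simp only: north_labels_0 north_bits_0)
  show "r < rows \<Longrightarrow> v \<le> cols \<Longrightarrow> west_labels (grid_label x) r v = west_bits x r v"
    "r \<le> rows \<Longrightarrow> v < cols \<Longrightarrow> north_labels (grid_label x) r v = north_bits x r v" for r v
    using west north by simp_all
qed

lemma sweep_grid_label:
  assumes "admissible x" "r < rows" "v < cols"
  shows "fst (cell_sweep (kind r v) (v = 0) (row_sum x r v) (x v)) =
    map (\<lambda>j. point_labels (grid_label x) (cell_point r v j)) [0..<108]"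
  using cell_sweep_eq[OF labels_grid_label[OF assms(1)] grid_label_cell_point[OF assms(2,3)]] assms(2,3) by simp

lemma left_label_outside:
  assumes x: "admissible x" and out: "\<not> inside p"
  shows "left_label (grid_label x) p = None"
proof (cases "snd p < 18 * rows \<and> fst p = 6 * cols")
  case True
  let ?r = "snd p div 18" and ?y = "snd p mod 18"
  have r: "?r < rows" using True by (simp add: div_less_iff_less_mult mult.commute)
  have "kind ?r cols = Empty" using col_bounds by (simp add: kind_def)
  then have "west_labels (grid_label x) ?r cols ! ?y = None"
    using labels_grid_label(1)[OF x r, of cols] by (simp add: west_input_def no_row_def)
  moreover have "p = cell_point ?r cols (6 * ?y)" using True by (simp add: cell_point_def prod_eq_iff)
  ultimately show ?thesis by (simp add: west_labels_def)
next
  case False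
  then show ?thesis using out
    by (auto simp: left_label_def grid_label_def Let_def inside_def split: nat.split)
qed

lemma upper_label_outside:
  assumes x: "admissible x" and out: "\<not> inside p"
  shows "upper_label (grid_label x) p = None"
proof (cases "fst p < 6 * cols \<and> snd p = 18 * rows")
  case True
  let ?v = "fst p div 6" and ?j = "fst p mod 6"
  have v: "?v < cols" using True by (simp add: div_less_iff_less_mult mult.commute)
  have "kind rows ?v = Empty" using row_bounds by (simp add: kind_def)
  then have "north_labels (grid_label x) rows ?v ! ?j = None"
    using labels_grid_label(2)[OF x _ v, of rows] by (simp add: north_input_def no_column_def)
  moreover have "p = cell_point rows ?v ?j" using True by (simp add: cell_point_def prod_eq_iff)
  ultimately show ?thesis by (simp add: north_labels_def)
next
  case False
  then show ?thesis using out
    by (auto simp: upper_label_def grid_label_def Let_def inside_def split: nat.split)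
qed

lemma incident_outside: "\<not> inside p \<Longrightarrow> lattice.incident E p = {}"
proof -
  assume out: "\<not> inside p"
  let ?L = "grid_label (\<lambda>_. 0)"
  have "?L (p, d) = None" for d using out by (simp add: grid_label_def)
  then have "present (point_labels ?L p) = []"
    using left_label_outside[OF admissible_0 out] upper_label_outside[OF admissible_0 out]
    by (simp add: point_labels_def present_def map_filter_simps)
  then have "card (lattice.incident E p) = 0" using card_incident_dom[of ?L p] by (simp add: dom_grid_label)
  then show ?thesis by (simp add: card_incident_eq_length incident_eq_set)
qed

lemma card_incident_cell_point:
  assumes "r < rows" "v < cols" "j < 108"
  shows "card (lattice.incident E (cell_point r v j)) = cell_degrees (kind r v) (v = 0) ! j"
  using sweep_grid_label[OF admissible_0 assms(1,2)] assms(3)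
  by (simp add: cell_degrees_def card_incident_dom flip: dom_grid_label[of "\<lambda>_. 0"])

lemma card_incident_le_3: "card (lattice.incident E p) \<le> 3"
proof (cases "inside p")
  case True
  obtain r v j where rvj: "r < rows" "v < cols" "j < 108" "p = cell_point r v j" using insideE[OF True] .
  have "length (cell_degrees (kind r v) (v = 0)) = 108"
    using sweep_grid_label[OF admissible_0 rvj(1,2)] by (simp add: cell_degrees_def)
  then have "cell_degrees (kind r v) (v = 0) ! j \<in> set (cell_degrees (kind r v) (v = 0))"
    using rvj(3) by (intro nth_mem) simp
  then show ?thesis using cell_degrees_le_3 card_incident_cell_point[OF rvj(1-3)] rvj(4) by simp
qed (simp add: incident_outside)

sublocale lattice_line_graph "rows * cols * 216" edge_at E
  by unfold_locales (rule inj_edge_at, rule E_subset, rule card_incident_le_3)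

end

subsection \<open>From labellings to solutions\<close>

context grid
begin

lemma west_labels_no_row:
  assumes L: "dom L = E" and rv: "r < rows" "v \<le> cols" and none: "west_bits (\<lambda>_. 0) r v = no_row"
  shows "west_labels L r v = no_row"
proof -
  have "left_label L (cell_point r v (6 * y)) = None" if "y < 18" for y
  proof -
    have "west_labels (grid_label (\<lambda>_. 0)) r v ! y = None"
      using labels_grid_label(1)[OF admissible_0 rv] none that by (simp add: no_row_def)
    then show ?thesis
      using that left_label_eq_None[of L "grid_label (\<lambda>_. 0)"] L by (simp add: west_labels_def dom_grid_label)
  qed
  then show ?thesis by (intro nth_equalityI) (simp_all add: west_labels_def no_row_def)
qed

lemma north_labels_no_column:
  assumes L: "dom L = E" and rv: "r \<le> rows" "v < cols" and none: "north_bits (\<lambda>_. 0) r v = no_column"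
  shows "north_labels L r v = no_column"
proof -
  have "upper_label L (cell_point r v x) = None" if "x < 6" for x
  proof -
    have "north_labels (grid_label (\<lambda>_. 0)) r v ! x = None"
      using labels_grid_label(2)[OF admissible_0 rv] none that by (simp add: no_column_def)
    then show ?thesis
      using that upper_label_eq_None[of L "grid_label (\<lambda>_. 0)"] L by (simp add: north_labels_def dom_grid_label)
  qed
  then show ?thesis by (intro nth_equalityI) (simp_all add: north_labels_def no_column_def)
qed

end

locale labelled_grid = grid +
  fixes l :: "ledge \<Rightarrow> nat"
  assumes labelling_l: "labelling l"
begin

abbreviation L :: "ledge \<Rightarrow> label" where "L \<equiv> edge_label l"

lemma dom_L: "dom L = E"
  by (auto simp: edge_label_def split: if_splits)

lemma scan_labelling:
  assumes "r < rows" "v < cols"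
  shows "(west_labels L r (Suc v), north_labels L (Suc r) v) \<in>
    set (cell_scan (kind r v) (west_labels L r v) (north_labels L r v))"
proof (rule cell_scan_mem)
  have l: "l e \<le> 2" "l e \<noteq> 0 \<Longrightarrow> e \<in> E" for e using labelling_l unfolding labelling_def by blast+
  show "L (cell_point r v j, d) \<in> set (label_choices (edge_on (kind r v) j d))" if "j < 108" for j d
    using cell_point_in_E[OF assms that, of d] l(1)[of "(cell_point r v j, d)"]
    by (auto simp: edge_label_def label_choices_def)
  show "point_rule (lattice_colour p) (point_labels L p)" for p
    using labelling_l unfolding labelling_iff_point_rule by blast
qed

lemma cup_pair:
  assumes v: "even v" "v < wires"
  obtains a where "a \<le> 1" "north_labels L (Suc cups) v = column_label a"
    "north_labels L (Suc cups) (Suc v) = column_label a"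
proof -
  have v': "Suc v < wires" using v col_bounds by presburger
  have bounds: "cups < rows" "v < cols" "Suc v < cols" using row_bounds col_bounds v' by simp_all
  have kinds: "kind cups v = CupL" "kind cups (Suc v) = CupR" using v v' by (simp_all add: kind_def)
  have "west_labels L cups v = no_row"
    by (rule west_labels_no_row[OF dom_L]) (use bounds in \<open>simp_all add: kinds west_input_def\<close>)
  moreover have above: "north_labels L cups u = no_column" if "kind cups u \<in> {CupL, CupR}" "u < cols" for u
    by (rule north_labels_no_column[OF dom_L]) (use bounds that in \<open>auto simp: north_input_def\<close>)
  ultimately have "(west_labels L cups (Suc v), north_labels L (Suc cups) v) \<in> set (cell_scan CupL no_row no_column)"
    using scan_labelling[OF bounds(1,2)] above[of v] bounds kinds by simp
  from subsetD[OF scan_CupL this] obtain a where a: "a \<le> 1" "west_labels L cups (Suc v) = cup_link a"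
    "north_labels L (Suc cups) v = column_label a" by auto
  have "(west_labels L cups (Suc (Suc v)), north_labels L (Suc cups) (Suc v)) \<in> set (cell_scan CupR (cup_link a) no_column)"
    using scan_labelling[OF bounds(1,3)] above[of "Suc v"] bounds kinds a(2) by simp
  moreover have "a \<in> set [0, 1]" using a(1) by auto
  then have "set (cell_scan CupR (cup_link a) no_column) \<subseteq> {(no_row, column_label a)}"
    using scan_CupR unfolding list_all_iff by blast
  ultimately have "north_labels L (Suc cups) (Suc v) = column_label a" by blast
  with a show thesis by (intro that)
qed

lemma ex_column_bits:
  obtains x where "\<And>v. x v \<le> 1" "\<And>i. 2 * i < wires \<Longrightarrow> x (2 * i) = x (2 * i + 1)"
    "\<And>v. v < wires \<Longrightarrow> north_labels L (Suc cups) v = column_label (x v)"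
proof -
  have "\<exists>a\<le>1. 2 * i < wires \<longrightarrow> north_labels L (Suc cups) (2 * i) = column_label a \<and>
      north_labels L (Suc cups) (Suc (2 * i)) = column_label a" for i
  proof (cases "2 * i < wires")
    case True
    obtain a where "a \<le> 1" "north_labels L (Suc cups) (2 * i) = column_label a"
      "north_labels L (Suc cups) (Suc (2 * i)) = column_label a" by (rule cup_pair[OF _ True]) simp
    then show ?thesis by blast
  qed auto
  then obtain a where a: "\<And>i. a i \<le> 1" "\<And>i. 2 * i < wires \<Longrightarrow>
      north_labels L (Suc cups) (2 * i) = column_label (a i) \<and>
      north_labels L (Suc cups) (Suc (2 * i)) = column_label (a i)" by metis
  show thesis
  proof (rule that[of "\<lambda>v. a (v div 2)"])
    show "north_labels L (Suc cups) v = column_label (a (v div 2))" if "v < wires" for v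
    proof (cases "even v")
      case True
      then show ?thesis using a(2)[of "v div 2"] that by simp
    next
      case False
      then have "v = Suc (2 * (v div 2))" by presburger
      then show ?thesis using a(2)[of "v div 2"] that by (metis Suc_lessD)
    qed
  qed (use a(1) in simp_all)
qed

lemma wire_step:
  assumes r: "cups < r" "r < caps" and v: "v < wires" and "x v \<le> 1" "row_sum x r v \<le> 1"
    and west: "west_labels L r v = west_bits x r v" and north: "north_labels L r v = column_label (x v)"
  shows "row_sum x r (Suc v) \<le> 1" "west_labels L r (Suc v) = row_labels (row_sum x r (Suc v))"
    "north_labels L (Suc r) v = column_label (x v)"
proof -
  have kind: "kind r v \<in> {Pass, Add}" using r v by (simp add: kind_def)
  have "north_labels L r v = north_bits x r v" using north kind by (auto simp: north_input_def)
  then have scan: "(west_labels L r (Suc v), north_labels L (Suc r) v) \<in> set (cell_scan (kind r v)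
      (west_bits x r v) (north_bits x r v))"
    using scan_labelling[of r v] r v row_bounds col_bounds west by simp
  have "v = 0 \<Longrightarrow> row_sum x r v = 0" by simp
  note scan_wire_cell[OF scan kind assms(5,4) this]
  then show "row_sum x r (Suc v) \<le> 1" "west_labels L r (Suc v) = row_labels (row_sum x r (Suc v))"
    "north_labels L (Suc r) v = column_label (x v)"
    using kind by (auto simp: row_sum_Suc east_output_def south_output_def)
qed

lemma crossbar_row:
  assumes r: "cups < r" "r < caps" and x: "\<And>v. x v \<le> 1"
    and north: "\<And>v. v < wires \<Longrightarrow> north_labels L r v = column_label (x v)"
  shows "row_sum x r wires = 1" "\<And>v. v < wires \<Longrightarrow> north_labels L (Suc r) v = column_label (x v)"
proof -
  have row: "row_sum x r v \<le> 1 \<and> west_labels L r v = west_bits x r v \<and>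
      (\<forall>u<v. north_labels L (Suc r) u = column_label (x u))" if "v \<le> wires" for v
    using that
  proof (induction v)
    case 0
    show ?case using west_labels_0[of L r] west_bits_0[of r x] by simp
  next
    case (Suc v)
    then have v: "v < wires" by simp
    note step = wire_step[of r v x, OF r v x _ _ north[OF v]]
    have "west_bits x r (Suc v) = row_labels (row_sum x r (Suc v))"
      using r Suc.prems by (auto simp: kind_def west_input_def)
    then show ?case using Suc.IH step v by (auto simp: less_Suc_eq)
  qed
  show "north_labels L (Suc r) v = column_label (x v)" if "v < wires" for v using row[of wires] that by simp
  have kind: "kind r wires = Term" "r < rows" using r row_bounds by (simp_all add: kind_def)
  have "north_labels L r wires = no_column"
    by (rule north_labels_no_column[OF dom_L]) (use kind col_bounds in \<open>simp_all add: north_input_def\<close>)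
  then have "(west_labels L r (Suc wires), north_labels L (Suc r) wires) \<in>
      set (cell_scan Term (row_labels (row_sum x r wires)) no_column)"
    using scan_labelling[of r wires] row[of wires] kind col_bounds by (simp add: west_input_def)
  then have "row_sum x r wires \<noteq> 0" using scan_Term by (intro notI) simp
  then show "row_sum x r wires = 1" using row[of wires] by simp
qed

lemma ex_solution: "\<exists>x. solution x"
proof -
  obtain x where x: "\<And>v. x v \<le> 1" "\<And>i. 2 * i < wires \<Longrightarrow> x (2 * i) = x (2 * i + 1)"
    and top: "\<And>v. v < wires \<Longrightarrow> north_labels L (Suc cups) v = column_label (x v)" using ex_column_bits by metis
  have "\<forall>v<wires. north_labels L r v = column_label (x v)" if "Suc cups \<le> r" "r \<le> caps" for r
    using that
  proof (induction r rule: dec_induct)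
    case (step r)
    then show ?case using crossbar_row(2)[of r x] x(1) by simp
  qed (simp add: top)
  then have "row_sum x r wires = 1" if "cups < r" "r < caps" for r
    using crossbar_row(1)[OF that x(1)] that by simp
  then show ?thesis using x by (auto simp: solution_def)
qed

end

subsection \<open>Degrees and capacity\<close>

lemma sum_alternating:
  assumes "even n"
  shows "2 * (\<Sum>v<n. if even v then a else b) = n * (a + b :: nat)"
proof -
  obtain m where "n = 2 * m" using assms by (rule evenE)
  moreover have "(\<Sum>v<2 * m. if even v then a else b) = m * (a + b)"
    by (induction m) (simp_all add: algebra_simps)
  ultimately show ?thesis by simp
qed

context grid
begin

lemma length_cell_degrees: "r < rows \<Longrightarrow> v < cols \<Longrightarrow> length (cell_degrees (kind r v) (v = 0)) = 108"
  using sweep_grid_label[OF admissible_0, of r v] by (simp add: cell_degrees_def)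

lemma max_degree_G_eq_4: "max_degree G = 4"
proof -
  have r: "Suc cups < rows" "0 < cols" using row_bounds col_bounds by simp_all
  let ?p = "cell_point (Suc cups) 0"
  have "kind (Suc cups) 0 \<in> set [Pass, Add]" using row_bounds col_bounds by (simp add: kind_def)
  then have "cell_degrees (kind (Suc cups) 0) True ! 19 = 3" "cell_degrees (kind (Suc cups) 0) True ! 20 = 3"
    "edge_on (kind (Suc cups) 0) 19 False"
    using adjacent_points_of_degree_3 unfolding list_all_iff by blast+
  moreover have "far (?p 19, False) = ?p 20" by (simp add: far_def right_of_def cell_point_def)
  ultimately have "(?p 19, False) \<in> E" "card (incident E (near (?p 19, False))) = 3"
    "card (incident E (far (?p 19, False))) = 3"
    using cell_point_in_E[OF r] card_incident_cell_point[OF r] by (simp_all add: near_def)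
  then have "max_degree G = 2 * (3 - 1)"
    by (intro max_degree_G[of _ "(?p 19, False)"] card_incident_le_3) (auto simp: ends_def)
  then show ?thesis by simp
qed

lemma capacity_eq_sum_cells: "capacity = (\<Sum>r<rows. \<Sum>v<cols. cell_capacity (kind r v) (v = 0))"
proof -
  let ?d = "\<lambda>p. min 2 (card (incident E p))"
  have "{p. inside p} = {..<6 * cols} \<times> {..<18 * rows}" by (auto simp: inside_def)
  then have "finite {p. inside p}" by simp
  moreover have "points \<subseteq> {p. inside p}" using incident_outside by (fastforce simp: points_def incident_def)
  ultimately have "capacity = (\<Sum>p | inside p. ?d p)"
    unfolding capacity_def by (intro sum.mono_neutral_left) (auto simp: incident_outside_points)
  also have "\<dots> = (\<Sum>(r, v, j)\<in>{..<rows} \<times> {..<cols} \<times> {..<108}. ?d (cell_point r v j))"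
    by (rule sum.reindex_bij_witness[where i = "\<lambda>(r, v, j). cell_point r v j"
          and j = "\<lambda>p. (snd p div 18, fst p div 6, cell_index p)"])
      (auto simp: cell_point_cell_index cell_point_decode cell_index_less inside_cell_point inside_div)
  also have "\<dots> = (\<Sum>r<rows. \<Sum>v<cols. \<Sum>j<108. ?d (cell_point r v j))"
    by (simp add: sum.cartesian_product)
  also have "\<dots> = (\<Sum>r<rows. \<Sum>v<cols. cell_capacity (kind r v) (v = 0))"
  proof (intro sum.cong refl)
    fix r v assume "r \<in> {..<rows}" "v \<in> {..<cols}"
    then have "(\<Sum>j<108. ?d (cell_point r v j)) = sum_list (map (min 2) (cell_degrees (kind r v) (v = 0)))"
      by (simp add: sum_list_sum_nth length_cell_degrees card_incident_cell_point atLeast0LessThan)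
    then show "(\<Sum>j<108. ?d (cell_point r v j)) = cell_capacity (kind r v) (v = 0)"
      by (simp add: sum_cell_degrees)
  qed
  finally show ?thesis .
qed

lemma row_capacity:
  "(\<Sum>v<cols. cell_capacity (kind r v) (v = 0)) = (if r = cups then 9 * wires else 0) +
     (if r = caps then 7 * wires else 0) + (if cups < r \<and> r < caps then 188 * wires + 4 else 0)"
proof -
  have "(\<Sum>v<cols. cell_capacity (kind r v) (v = 0)) = (\<Sum>v<Suc wires. cell_capacity (kind r v) (v = 0))"
    by (rule sum.mono_neutral_right) (use col_bounds in \<open>auto simp: kind_def cell_capacity_def\<close>)
  then have split: "(\<Sum>v<cols. cell_capacity (kind r v) (v = 0)) =
      (\<Sum>v<wires. cell_capacity (kind r v) (v = 0)) + cell_capacity (kind r wires) False"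
    using col_bounds by simp
  consider (cups) "r = cups" | (caps) "r = caps" | (inner) "cups < r" "r < caps" | (outer) "r < cups \<or> caps < r"
    by linarith
  then show ?thesis
  proof cases
    case cups
    then have "(\<Sum>v<wires. cell_capacity (kind r v) (v = 0)) = (\<Sum>v<wires. if even v then 10 else 8)"
      by (intro sum.cong refl) (simp add: kind_def cell_capacity_def)
    moreover have "cell_capacity (kind r wires) False = 0"
      using cups by (simp add: kind_def cell_capacity_def)
    ultimately show ?thesis unfolding split using cups row_bounds sum_alternating[OF col_bounds(2), of 10 8] by simp
  next
    case caps
    then have "(\<Sum>v<wires. cell_capacity (kind r v) (v = 0)) = (\<Sum>v<wires. if even v then 8 else 6)"
      using row_bounds by (intro sum.cong refl) (simp add: kind_def cell_capacity_def)
    moreover have "cell_capacity (kind r wires) False = 0"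
      using caps by (simp add: kind_def cell_capacity_def)
    ultimately show ?thesis unfolding split using caps row_bounds sum_alternating[OF col_bounds(2), of 8 6] by simp
  next
    case inner
    obtain k where k: "wires = Suc k" using col_bounds by (cases wires) auto
    have "(\<Sum>v<wires. cell_capacity (kind r v) (v = 0)) = (\<Sum>v<wires. if v = 0 then 186 else 188)"
      using inner by (intro sum.cong refl) (simp add: kind_def cell_capacity_def)
    also have "\<dots> = 186 + 188 * k" unfolding k by (simp only: sum.lessThan_Suc_shift) simp
    also have "\<dots> + 2 = 188 * wires" using k by simp
    moreover have "cell_capacity (kind r wires) False = 6" using inner by (simp add: kind_def cell_capacity_def)
    ultimately show ?thesis unfolding split using inner by simp
  next
    case outer
    then have "kind r v = Empty" for v using row_bounds by (auto simp: kind_def)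
    then show ?thesis using outer row_bounds by (auto simp: cell_capacity_def)
  qed
qed

lemma capacity_eq: "capacity = 4 * ((caps - cups - 1) * (47 * wires + 1) + 4 * wires)"
proof -
  have "(\<Sum>r<rows. if cups < r \<and> r < caps then 188 * wires + 4 else 0) = (\<Sum>r\<in>{cups<..<caps}. 188 * wires + 4)"
    by (rule sum.mono_neutral_cong_right) (use row_bounds in auto)
  also have "\<dots> = (caps - cups - 1) * (188 * wires + 4)" by simp
  finally show ?thesis
    using row_bounds by (simp add: capacity_eq_sum_cells row_capacity sum.distrib algebra_simps)
qed

end

subsection \<open>From solutions to labellings\<close>

locale solved_grid = grid +
  fixes x :: "nat \<Rightarrow> nat"
  assumes solution_x: "solution x"
begin

abbreviation L :: "ledge \<Rightarrow> label" where "L \<equiv> grid_label x"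

definition grid_labelling :: "ledge \<Rightarrow> nat" where
  "grid_labelling e = (case L e of None \<Rightarrow> 0 | Some a \<Rightarrow> a)"

abbreviation potentials :: "nat \<Rightarrow> nat \<Rightarrow> nat list" where
  "potentials r v \<equiv> cell_potentials (kind r v) (row_sum x r v) (x v)"

definition height :: "point \<Rightarrow> nat" where
  "height p = 1000 * (fst p div 6) + potentials (snd p div 18) (fst p div 6) ! cell_index p"

lemma edge_label_grid_labelling: "edge_label grid_labelling = L"
proof
  have "e \<in> E \<longleftrightarrow> (\<exists>a. L e = Some a)" for e using dom_grid_label[of x] by (auto simp: dom_def)
  then show "edge_label grid_labelling e = L e" for e
    by (cases "L e") (auto simp: edge_label_def grid_labelling_def)
qed

lemma admissible_x: "admissible x"
  using solution_x by (rule admissible_if_solution)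

lemma height_cell_point: "j < 108 \<Longrightarrow> height (cell_point r v j) = 1000 * v + potentials r v ! j"
  by (simp add: height_def cell_point_decode)

lemma potential_less:
  assumes "j < 108"
  shows "potentials r v ! j < (if kind r v = Pass \<or> kind r v = Add then 100 else 1000)"
  using cell_ok_solution[OF solution_x, of r v] assms
  by (auto simp: cell_ok_def Let_def list_all_length split: prod.splits)

lemma height_bounds: "1000 * (fst p div 6) \<le> height p" "height p < 1000 * (fst p div 6) + 1000"
  using potential_less[OF cell_index_less, of "snd p div 18" "fst p div 6" p]
  by (auto simp: height_def split: if_splits)

lemma point_ok_cell_point:
  assumes rv: "r < rows" "v < cols" and j: "j < 108"
  defines "hs \<equiv> potentials r v"
  shows "point_ok j (point_labels L (cell_point r v j)) (hs ! j)
    (if j = 0 then 0 else hs ! (j - 1)) (if j < 6 then 99 else hs ! (j - 6))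
    (if j < 107 then hs ! (j + 1) else 0) (if j < 102 then hs ! (j + 6) else 99)"
proof -
  let ?ls = "map (\<lambda>j. point_labels L (cell_point r v j)) [0..<108]"
  let ?neighbours = "zip [0..<108] (zip ?ls (zip hs (zip (0 # hs) (zip (replicate 6 99 @ hs)
    (zip (tl hs @ [0]) (drop 6 hs @ replicate 6 99))))))"
  have length: "length hs = 108" by (simp add: hs_def)
  have "list_all (\<lambda>(j, ls, h, kl, ku, kr, kd). point_ok j ls h kl ku kr kd) ?neighbours"
    using cell_ok_solution[OF solution_x, of r v] sweep_grid_label[OF admissible_x rv]
    by (auto simp: cell_ok_def Let_def hs_def split: prod.splits)
  moreover have "?neighbours ! j = (j, point_labels L (cell_point r v j), hs ! j,
      (if j = 0 then 0 else hs ! (j - 1)), (if j < 6 then 99 else hs ! (j - 6)),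
      (if j < 107 then hs ! (j + 1) else 0), (if j < 102 then hs ! (j + 6) else 99))"
    using j length by (auto simp: nth_append nth_Cons' nth_tl add.commute)
  ultimately show ?thesis using j length by (auto simp: list_all_length)
qed

lemma point_rule_L: "point_rule (lattice_colour p) (point_labels L p)"
proof (cases "inside p")
  case True
  obtain r v j where "r < rows" "v < cols" "j < 108" "p = cell_point r v j" using insideE[OF True] .
  then show ?thesis using point_ok_cell_point[of r v j] by (simp add: point_ok_def colour_cell_point)
next
  case False
  have "length (present (point_labels L p)) = 0"
    using card_incident_dom[of L p] incident_outside[OF False] by (simp add: dom_grid_label)
  then show ?thesis by (simp add: point_rule_def)
qed

lemma grid_labelling_le_2: "grid_labelling e \<le> 2"
proof (cases "inside (fst e)")
  case True
  obtain r v j where rvj: "r < rows" "v < cols" "j < 108" "fst e = cell_point r v j" using insideE[OF True] .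
  then have "e = (cell_point r v j, snd e)" by (simp add: prod_eq_iff)
  then have "L e \<in> {None, Some 0, Some 1, Some 2}"
    using point_ok_cell_point[OF rvj(1-3)] by (cases "snd e") (auto simp: point_ok_def point_labels_def)
  then show ?thesis by (auto simp: grid_labelling_def)
qed (simp add: grid_labelling_def grid_label_def)

lemma labelling_grid_labelling: "labelling grid_labelling"
proof -
  have "e \<in> E" if "grid_labelling e \<noteq> 0" for e
    using that dom_grid_label[of x] by (auto simp: grid_labelling_def split: option.splits)
  then show ?thesis
    using point_rule_L grid_labelling_le_2 by (simp add: labelling_iff_point_rule edge_label_grid_labelling)
qed

definition descends :: "point \<Rightarrow> bool" where
  "descends p \<longleftrightarrow> (\<exists>e\<in>incident E p. grid_labelling e \<noteq> 0 \<and> (\<exists>q\<in>ends e. height q < height p))"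

lemma descendsI:
  assumes "L e \<notin> {None, Some 0}" "p \<in> ends e" "q \<in> ends e" "height q < height p"
  shows "descends p"
proof -
  have "e \<in> E" "grid_labelling e \<noteq> 0" using assms(1) dom_grid_label[of x] by (auto simp: grid_labelling_def)
  then show ?thesis using assms(2-4) unfolding descends_def incident_def by blast
qed

lemma descends_left:
  assumes j: "j < 108" and label: "left_label L (cell_point r v j) \<notin> {None, Some 0}"
    and lower: "j mod 6 = 0 \<or> (if j = 0 then 0 else potentials r v ! (j - 1)) < potentials r v ! j"
  shows "descends (cell_point r v j)"
proof -
  have "left_label L (cell_point r v j) \<noteq> None" using label by simp
  then obtain q where q: "cell_point r v j = right_of q"
    by (rule left_labelE)
  have "height q < height (cell_point r v j)"
  proof (cases "j mod 6 = 0")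
    case True
    then have "Suc (fst q) = 6 * v" using q by (simp add: cell_point_def right_of_def)
    then have "fst q div 6 + 1 \<le> v" by presburger
    then show ?thesis using height_bounds(2)[of q] j by (simp add: height_cell_point)
  next
    case False
    then obtain i where i: "j = Suc i" by (cases j) auto
    then have "i mod 6 \<noteq> 5" using False by presburger
    then have "right_of q = right_of (cell_point r v i)" using q cell_point_Suc[of i r v] i by simp
    then have "q = cell_point r v i" by (simp add: right_of_def prod_eq_iff)
    then show ?thesis using lower False i j by (simp add: height_cell_point)
  qed
  then show ?thesis using label q by (intro descendsI[of "(q, False)" _ q]) (simp_all add: ends_def near_def far_def)
qed

lemma descends_right:
  assumes j: "j < 108" and label: "L (cell_point r v j, False) \<notin> {None, Some 0}"
    and lower: "j mod 6 \<noteq> 5" "(if j < 107 then potentials r v ! (j + 1) else 0) < potentials r v ! j"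
  shows "descends (cell_point r v j)"
proof (rule descendsI[OF label])
  have "j < 107" using j lower(1) by (cases "j = 107") auto
  then have "height (cell_point r v (Suc j)) < height (cell_point r v j)"
    using lower(2) by (simp add: height_cell_point)
  then show "height (right_of (cell_point r v j)) < height (cell_point r v j)"
    using lower(1) by (simp add: cell_point_Suc)
qed (simp_all add: ends_def near_def far_def)

lemma label_between_cells:
  assumes "r < rows" "v < cols" "i < 6" "upper_label L (cell_point (Suc r) v i) \<noteq> None"
  shows "cups \<le> r" "r < caps" "v < wires"
proof -
  have "north_labels L (Suc r) v ! i \<noteq> None" using assms(3,4) by (simp add: north_labels_def)
  then have "north_bits x (Suc r) v ! i \<noteq> None"
    using labels_grid_label(2)[OF admissible_x, of "Suc r" v] assms(1,2) by simp
  then have "kind (Suc r) v \<in> {Pass, Add, CapL, CapR}"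
    using assms(3) by (auto simp: north_input_def no_column_def split: if_splits)
  then show "cups \<le> r" "r < caps" "v < wires" using row_bounds by (auto simp: kind_def split: if_splits)
qed

lemma descends_up:
  assumes rv: "r < rows" "v < cols" and j: "j < 108" and label: "upper_label L (cell_point r v j) \<notin> {None, Some 0}"
    and lower: "(if j < 6 then 99 else potentials r v ! (j - 6)) < potentials r v ! j"
  shows "descends (cell_point r v j)"
proof -
  have "upper_label L (cell_point r v j) \<noteq> None" using label by simp
  then obtain q where q: "cell_point r v j = below q"
    by (rule upper_labelE)
  have "height q < height (cell_point r v j)"
  proof (cases "j < 6")
    case True
    then obtain r' where r': "r = Suc r'" using q by (cases r) (auto simp: cell_point_def below_def)
    have bounds: "cups \<le> r'" "r' < caps" "v < wires"
      using label_between_cells[of r' v j] rv True label r' by auto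
    have "\<not> (kind r v = Pass \<or> kind r v = Add)" using potential_less[OF j, of r v] lower True by auto
    then have "r = caps" using bounds r' by (auto simp: kind_def split: if_splits)
    then have "kind r' v = Pass \<or> kind r' v = Add" using bounds r' row_bounds by (auto simp: kind_def)
    moreover have "below q = below (cell_point r' v (j + 102))"
      using q cell_point_add_6[of r' v "j + 102"] cell_point_add_108[of r' v j] r' by (simp add: add.commute)
    then have "q = cell_point r' v (j + 102)" by (simp add: below_def prod_eq_iff)
    ultimately show ?thesis
      using potential_less[of "j + 102" r' v] lower True by (simp add: height_cell_point)
  next
    case False
    have "below q = below (cell_point r v (j - 6))" using q cell_point_add_6[of r v "j - 6"] False by simp
    then have "q = cell_point r v (j - 6)" by (simp add: below_def prod_eq_iff)
    then show ?thesis using lower False j by (simp add: height_cell_point)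
  qed
  then show ?thesis using label q by (intro descendsI[of "(q, True)" _ q]) (simp_all add: ends_def near_def far_def)
qed

lemma descends_down:
  assumes rv: "r < rows" "v < cols" and j: "j < 108" and label: "L (cell_point r v j, True) \<notin> {None, Some 0}"
    and lower: "(if j < 102 then potentials r v ! (j + 6) else 99) < potentials r v ! j"
  shows "descends (cell_point r v j)"
proof -
  have "height (cell_point r v (j + 6)) < height (cell_point r v j)"
  proof (cases "j < 102")
    case True
    then show ?thesis using lower by (simp add: height_cell_point)
  next
    case False
    define i where "i = j - 102"
    have i: "j = i + 102" "i < 6" using False j by (simp_all add: i_def)
    have below: "cell_point r v (j + 6) = cell_point (Suc r) v i"
      using cell_point_add_108[of r v i] i by (simp add: add.commute)
    then have "upper_label L (cell_point (Suc r) v i) = L (cell_point r v j, True)"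
      unfolding below[symmetric] cell_point_add_6 by simp
    then have "upper_label L (cell_point (Suc r) v i) \<noteq> None" using label by simp
    then have bounds: "cups \<le> r" "r < caps" "v < wires" using label_between_cells[OF rv i(2)] by auto
    have "\<not> (kind r v = Pass \<or> kind r v = Add)" using potential_less[OF j, of r v] lower False by auto
    then have "r = cups" using bounds by (auto simp: kind_def split: if_splits)
    then have "kind (Suc r) v = Pass \<or> kind (Suc r) v = Add" using bounds row_bounds by (auto simp: kind_def)
    then show ?thesis
      using potential_less[of i "Suc r" v] lower False i j unfolding below by (simp add: height_cell_point)
  qed
  then show ?thesis unfolding cell_point_add_6
    by (intro descendsI[OF label, of _ "below (cell_point r v j)"]) (simp_all add: ends_def near_def far_def)
qed

lemma descending_grid_labelling: "descending grid_labelling height"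
  unfolding descending_def descends_def[symmetric]
proof (intro allI impI)
  fix p assume degree: "2 \<le> card (incident E p)"
  then have "inside p" using incident_outside[of p] by fastforce
  then obtain r v j where rvj: "r < rows" "v < cols" "j < 108" and p: "p = cell_point r v j" by (rule insideE)
  have "2 \<le> length (present (point_labels L (cell_point r v j)))"
    using degree card_incident_dom[of L p] by (simp add: dom_grid_label p)
  then have "list_ex (\<lambda>(l, lower). l \<notin> {None, Some 0} \<and> lower) (zip (point_labels L (cell_point r v j))
     [j mod 6 = 0 \<or> (if j = 0 then 0 else potentials r v ! (j - 1)) < potentials r v ! j,
      (if j < 6 then 99 else potentials r v ! (j - 6)) < potentials r v ! j,
      j mod 6 \<noteq> 5 \<and> (if j < 107 then potentials r v ! (j + 1) else 0) < potentials r v ! j,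
      (if j < 102 then potentials r v ! (j + 6) else 99) < potentials r v ! j])"
    using point_ok_cell_point[OF rvj] unfolding point_ok_def by blast
  then show "descends p"
    using descends_left[OF rvj(3), of r v] descends_up[OF rvj] descends_right[OF rvj(3), of r v] descends_down[OF rvj]
    unfolding p point_labels_def zip_Cons_Cons list_ex_Cons_iff prod.case by auto
qed

end

theorem (in grid) matching_iff_solution:
  "(\<exists>M. acyclic_matching G M \<and> card M = (caps - cups - 1) * (47 * wires + 1) + 4 * wires) \<longleftrightarrow> (\<exists>x. solution x)"
proof
  assume "\<exists>M. acyclic_matching G M \<and> card M = (caps - cups - 1) * (47 * wires + 1) + 4 * wires"
  then obtain l where "labelling l" using ex_labelling_if_saturated capacity_eq by metis
  then interpret labelled_grid rows cols cups caps wires A l by unfold_locales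
  show "\<exists>x. solution x" by (rule ex_solution)
next
  assume "\<exists>x. solution x"
  then obtain x where "solution x" ..
  then interpret solved_grid rows cols cups caps wires A x by unfold_locales
  obtain M where "acyclic_matching G M" "4 * card M = capacity"
    using saturated_if_descending_labelling[OF labelling_grid_labelling descending_grid_labelling] by blast
  then show "\<exists>M. acyclic_matching G M \<and> card M = (caps - cups - 1) * (47 * wires + 1) + 4 * wires"
    using capacity_eq by auto
qed

section \<open>The crossbar of an exact cover problem\<close>

lemma sum_lessThan_add: "(\<Sum>v<a + n. f v) = (\<Sum>v<a. f v) + (\<Sum>j<n. f (a + j :: nat) :: nat)"
  by (induction n) simp_all

lemma sum_lessThan_mult: "(\<Sum>v<m * n. f v) = (\<Sum>i<m. \<Sum>j<n. f (i * n + j :: nat) :: nat)"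
  by (induction m) (simp_all add: sum_lessThan_add add.commute[of n])

lemma mixed_radix_less:
  fixes i j m n :: nat
  assumes "i < m" "j < n"
  shows "i * n + j < m * n"
proof -
  have "(i + 1) * n \<le> m * n" using assms(1) by (intro mult_le_mono1) simp
  then show ?thesis using assms(2) by simp
qed

lemma count_eq_sum: "count K B = (\<Sum>a<K. if B a then 1 else 0)"
proof -
  have "{a. a < K \<and> B a} = {..<K} \<inter> {a. B a}" by auto
  then show ?thesis by (simp add: count_def sum.If_cases)
qed

lemma exact_cover_cong:
  assumes "\<And>b a. a < K \<Longrightarrow> x b a = y b a"
  shows "exact_cover K C S A0 A1 A2 x = exact_cover K C S A0 A1 A2 y"
proof -
  have "count K (\<lambda>a. x b a \<and> B a) = count K (\<lambda>a. y b a \<and> B a)" for b B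
    using assms by (simp add: count_eq_sum)
  then show ?thesis by (simp add: exact_cover_def)
qed

text \<open>The crossbar has a row for every constraint of the exact cover problem and a pair of columns for
  every variable. The columns of the variables of one position form a block.\<close>

locale crossbar =
  fixes K C S :: nat and A0 :: "nat \<Rightarrow> nat \<Rightarrow> nat \<Rightarrow> bool" and A1 A2 :: "nat \<Rightarrow> nat \<Rightarrow> bool"
  assumes K: "1 \<le> K" and C: "1 \<le> C" and S: "1 < S"
begin

definition positions :: nat where "positions = S * S"
definition blocks :: nat where "blocks = positions + S + 1"

definition entry :: "nat \<Rightarrow> nat \<Rightarrow> nat \<Rightarrow> nat \<Rightarrow> bool" where
  "entry b t p a \<longleftrightarrow> p = b \<and> A0 b t a \<or> p = b + 1 \<and> A1 t a \<or> p = b + S \<and> A2 t a"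

definition used :: "nat \<Rightarrow> nat \<Rightarrow> bool" where
  "used r v \<longleftrightarrow> even v \<and> entry (r div C) (r mod C) (v div 2 div K) (v div 2 mod K)"

lemma used_digits:
  assumes "t < C" "a < K" "s < 2"
  shows "used (b * C + t) ((p * K + a) * 2 + s) \<longleftrightarrow> s = 0 \<and> entry b t p a"
proof -
  have "(b * C + t) div C = b" "(b * C + t) mod C = t" "(p * K + a) div K = p" "(p * K + a) mod K = a"
    "((p * K + a) * 2 + s) div 2 = p * K + a" "even ((p * K + a) * 2 + s) \<longleftrightarrow> s = 0"
    using assms by (auto simp: less_2_cases_iff)
  then show ?thesis unfolding used_def by (simp only:)
qed

sublocale grid "(positions + 2) * C" "(blocks + 1) * K * 2" "C - 1" "(positions + 1) * C" "blocks * K * 2" used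
proof
  have "1 * C \<le> positions * C" using S by (intro mult_le_mono1) (simp add: positions_def)
  then show "Suc (C - 1) < (positions + 1) * C" using C by simp
qed (use K C in \<open>simp_all add: blocks_def\<close>)

abbreviation wires :: nat where "wires \<equiv> blocks * K * 2"

lemma crossbar_row_iff: "C - 1 < r \<and> r < (positions + 1) * C \<longleftrightarrow> r div C \<in> {1..positions}"
  using C by (auto simp: div_less_iff_less_mult Suc_le_eq div_greater_zero_iff less_Suc_eq_le[symmetric])

lemma entry_cases:
  "entry b t b a \<longleftrightarrow> A0 b t a" "entry b t (Suc b) a \<longleftrightarrow> A1 t a" "entry b t (b + S) a \<longleftrightarrow> A2 t a"
  using S by (auto simp: entry_def)

lemma row_sum_entries:
  assumes b: "b \<in> {1..positions}" and t: "t < C"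
  shows "row_sum x (b * C + t) wires = (\<Sum>p\<in>{b, b + 1, b + S}. \<Sum>a<K. if entry b t p a then x ((p * K + a) * 2) else 0)"
proof -
  have "C - 1 < b * C + t \<and> b * C + t < (positions + 1) * C" unfolding crossbar_row_iff using b t by simp
  then have "row_sum x (b * C + t) wires = (\<Sum>v<wires. if used (b * C + t) v then x v else 0)"
    unfolding row_sum_def kind_eq_Add_iff by (intro sum.cong refl) simp
  also have "\<dots> = (\<Sum>p<blocks. \<Sum>a<K. \<Sum>s<2. if used (b * C + t) ((p * K + a) * 2 + s) then x ((p * K + a) * 2 + s) else 0)"
    unfolding sum_lessThan_mult ..
  also have "\<dots> = (\<Sum>p<blocks. \<Sum>a<K. if entry b t p a then x ((p * K + a) * 2) else 0)"
  proof (intro sum.cong refl)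
    fix p a assume "a \<in> {..<K}"
    then have a: "a < K" by simp
    show "(\<Sum>s<2. if used (b * C + t) ((p * K + a) * 2 + s) then x ((p * K + a) * 2 + s) else 0) =
        (if entry b t p a then x ((p * K + a) * 2) else 0)"
      using used_digits[OF t a, of 0 b p] used_digits[OF t a, of 1 b p] by (simp add: numeral_2_eq_2)
  qed
  also have "\<dots> = (\<Sum>p\<in>{b, b + 1, b + S}. \<Sum>a<K. if entry b t p a then x ((p * K + a) * 2) else 0)"
    by (rule sum.mono_neutral_right) (use b S in \<open>auto simp: blocks_def entry_def\<close>)
  finally show ?thesis .
qed

lemma row_sum_eq_count:
  assumes x: "\<And>v. x v \<le> 1" and b: "b \<in> {1..positions}" and t: "t < C"
  defines "z \<equiv> \<lambda>p a. x ((p * K + a) * 2) = 1"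
  shows "row_sum x (b * C + t) wires = count K (\<lambda>a. z b a \<and> A0 b t a) + count K (\<lambda>a. z (b + 1) a \<and> A1 t a) +
    count K (\<lambda>a. z (b + S) a \<and> A2 t a)"
proof -
  have "(if B then x v else 0) = (if x v = 1 \<and> B then 1 else 0)" for B v using x[of v] by auto
  then have block: "(\<Sum>a<K. if B a then x ((p * K + a) * 2) else 0) = count K (\<lambda>a. z p a \<and> B a)" for B p
    unfolding count_eq_sum z_def by simp
  have "b \<noteq> b + 1" "b \<noteq> b + S" "b + 1 \<noteq> b + S" using S by simp_all
  then show ?thesis unfolding row_sum_entries[OF b t] by (simp add: block entry_cases)
qed

lemma row_sums_iff_exact_cover:
  assumes x: "\<And>v. x v \<le> 1"
  shows "(\<forall>r. C - 1 < r \<longrightarrow> r < (positions + 1) * C \<longrightarrow> row_sum x r wires = 1) \<longleftrightarrow>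
    exact_cover K C S A0 A1 A2 (\<lambda>p a. x ((p * K + a) * 2) = 1)"
proof -
  have "(\<forall>r. C - 1 < r \<longrightarrow> r < (positions + 1) * C \<longrightarrow> row_sum x r wires = 1) \<longleftrightarrow>
      (\<forall>b\<in>{1..positions}. \<forall>t<C. row_sum x (b * C + t) wires = 1)"
  proof safe
    fix b t assume "\<forall>r. C - 1 < r \<longrightarrow> r < (positions + 1) * C \<longrightarrow> row_sum x r wires = 1"
      "b \<in> {1..positions}" "t < C"
    then show "row_sum x (b * C + t) wires = 1" using crossbar_row_iff[of "b * C + t"] by simp
  next
    fix r assume sums: "\<forall>b\<in>{1..positions}. \<forall>t<C. row_sum x (b * C + t) wires = 1"
      and "C - 1 < r" "r < (positions + 1) * C"
    then have "r div C \<in> {1..positions}" "r mod C < C" using crossbar_row_iff[of r] C by simp_all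
    then show "row_sum x r wires = 1" using sums by (metis div_mult_mod_eq)
  qed
  then show ?thesis using row_sum_eq_count[OF x] by (simp add: exact_cover_def positions_def)
qed

lemma ex_solution_iff: "(\<exists>x. solution x) \<longleftrightarrow> (\<exists>z. exact_cover K C S A0 A1 A2 z)"
proof
  assume "\<exists>x. solution x"
  then show "\<exists>z. exact_cover K C S A0 A1 A2 z" unfolding solution_def using row_sums_iff_exact_cover by blast
next
  assume "\<exists>z. exact_cover K C S A0 A1 A2 z"
  then obtain z where z: "exact_cover K C S A0 A1 A2 z" ..
  define x :: "nat \<Rightarrow> nat" where "x v = of_bool (z (v div 2 div K) (v div 2 mod K))" for v
  have "exact_cover K C S A0 A1 A2 (\<lambda>p a. x ((p * K + a) * 2) = 1)"
    using z by (subst exact_cover_cong[of K _ z]) (simp_all add: x_def)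
  moreover have "x v \<le> 1" "x (2 * i) = x (2 * i + 1)" for v i by (simp_all add: x_def)
  ultimately show "\<exists>x. solution x"
    unfolding solution_def using row_sums_iff_exact_cover[of x] by (intro exI[of _ x]) blast
qed

definition matching_size :: nat where "matching_size = positions * C * (47 * wires + 1) + 4 * wires"

lemma has_acyclic_matching_iff:
  "has_acyclic_matching (G, matching_size) \<longleftrightarrow> (\<exists>z. exact_cover K C S A0 A1 A2 z)"
proof -
  have "(positions + 1) * C - (C - 1) - 1 = positions * C" using C by simp
  then show ?thesis
    using matching_iff_solution unfolding ex_solution_iff by (simp add: has_acyclic_matching_def matching_size_def)
qed

lemma matching_size_pos: "0 < matching_size"
  using K by (simp add: matching_size_def blocks_def)

definition vertex :: "nat \<Rightarrow> nat \<Rightarrow> nat \<Rightarrow> nat \<Rightarrow> nat \<Rightarrow> nat \<Rightarrow> nat \<Rightarrow> nat \<Rightarrow> nat" where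
  "vertex b t p a s y x d = ((((((b * C + t) * (blocks + 1) + p) * K + a) * 2 + s) * 18 + y) * 6 + x) * 2 + d"

lemma edge_at_vertex:
  assumes "b < positions + 2" "t < C" "p < blocks + 1" "a < K" "s < 2" "y < 18" "x < 6" "d < 2"
  defines "r \<equiv> b * C + t" and "v \<equiv> (p * K + a) * 2 + s"
  shows "edge_at (vertex b t p a s y x d) = (cell_point r v (6 * y + x), d = 1)"
    and "vertex b t p a s y x d < (positions + 2) * C * ((blocks + 1) * K * 2) * 216"
    and "edge_at (vertex b t p a s y x d) \<in> E \<longleftrightarrow> edge_on (kind r v) (6 * y + x) (d = 1)"
proof -
  have rv: "r < (positions + 2) * C" "v < (blocks + 1) * K * 2"
    unfolding r_def v_def using assms(1-5) by (intro mixed_radix_less; simp)+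
  have j: "6 * y + x < 108" using assms(6,7) by linarith
  have "vertex b t p a s y x d = ((r * ((blocks + 1) * K * 2) + v) * 108 + (6 * y + x)) * 2 + of_bool (d = 1)"
    using assms(8) unfolding vertex_def r_def v_def by (cases "d = 0") (simp_all add: algebra_simps)
  then show edge: "edge_at (vertex b t p a s y x d) = (cell_point r v (6 * y + x), d = 1)"
    and "vertex b t p a s y x d < (positions + 2) * C * ((blocks + 1) * K * 2) * 216"
    using edge_at_index[OF rv j, of "d = 1"] by simp_all
  show "edge_at (vertex b t p a s y x d) \<in> E \<longleftrightarrow> edge_on (kind r v) (6 * y + x) (d = 1)"
    unfolding edge by (rule cell_point_in_E[OF rv j])
qed

end

subsection \<open>The adjacency of the crossbar graph as a program\<close>

definition coordinates :: "bool list \<Rightarrow> (nat \<Rightarrow> nat) \<Rightarrow> expr \<times> expr \<Rightarrow> point" where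
  "coordinates w \<rho> e = (val w \<rho> (fst e), val w \<rho> (snd e))"

lemma branchable_coordinates_eq:
  assumes "var_bound (fst a) \<le> f" "var_bound (snd a) \<le> f" "var_bound (fst b) \<le> f" "var_bound (snd b) \<le> f"
  shows "branchable f R (\<lambda>w \<rho>. coordinates w \<rho> a = coordinates w \<rho> b)"
  unfolding coordinates_def prod.inject using assms by (intro branchable_conj branchable_eq)

lemma ends_meet_iff: "ends e \<inter> ends f \<noteq> {} \<longleftrightarrow> near e = near f \<or> near e = far f \<or> far e = near f \<or> far e = far f"
  by (auto simp: ends_def)

definition row_expr :: "nat \<Rightarrow> nat \<Rightarrow> expr" where
  "row_expr C f = Plus (Times (Var f) (Num C)) (Var (f + 2))"
definition column_expr :: "nat \<Rightarrow> nat \<Rightarrow> expr" where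
  "column_expr K f = Plus (Times (Plus (Times (Var (f + 4)) (Num K)) (Var (f + 6))) (Num 2)) (Var (f + 8))"

definition near_expr :: "nat \<Rightarrow> nat \<Rightarrow> nat \<Rightarrow> expr \<times> expr" where
  "near_expr K C f = (Plus (Times (Num 6) (column_expr K f)) (Var (f + 12)),
     Plus (Times (Num 18) (row_expr C f)) (Var (f + 10)))"
definition far_expr :: "nat \<Rightarrow> nat \<Rightarrow> nat \<Rightarrow> expr \<times> expr" where
  "far_expr K C f = (Plus (fst (near_expr K C f)) (Minus (Num 1) (Var (f + 14))),
     Plus (snd (near_expr K C f)) (Var (f + 14)))"

locale crossbar_program =
  fixes K C :: nat and A0 :: "nat \<times> bool \<times> bool \<times> bool \<times> bool \<Rightarrow> nat \<Rightarrow> nat \<Rightarrow> bool" and A1 A2 :: "nat \<Rightarrow> nat \<Rightarrow> bool"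
    and p :: "nat poly" and bound :: expr
  assumes K: "1 \<le> K" and C: "1 \<le> C" and p: "1 \<le> poly p n"
    and bound_closed: "var_bound bound = 0" and val_bound: "val w \<rho> bound = poly p (length w)"
begin

sublocale crossbar K C "row_length (poly p (length w))" "\<lambda>b. A0 (input_class w (poly p (length w)) b)" A1 A2
  for w :: "bool list"
  by unfold_locales (use K C p in \<open>simp_all add: row_length_def Suc_le_eq\<close>)

definition row_length_expr :: expr where "row_length_expr = Plus (Times (Num 2) bound) (Num 1)"
definition positions_expr :: expr where "positions_expr = Times row_length_expr row_length_expr"
definition blocks_expr :: expr where "blocks_expr = Plus (Plus positions_expr row_length_expr) (Num 1)"
definition wires_expr :: expr where "wires_expr = Times (Times blocks_expr (Num K)) (Num 2)"

lemma var_bound_exprs [simp]: "var_bound row_length_expr = 0" "var_bound positions_expr = 0" "var_bound blocks_expr = 0"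
  "var_bound wires_expr = 0"
  by (simp_all add: row_length_expr_def positions_expr_def blocks_expr_def wires_expr_def bound_closed)

lemma val_row_length_expr [simp]: "val w \<rho> row_length_expr = row_length (poly p (length w))"
  by (simp add: row_length_expr_def row_length_def val_bound)

lemma val_exprs [simp]: "val w \<rho> positions_expr = positions w" "val w \<rho> blocks_expr = blocks w"
  "val w \<rho> wires_expr = wires w"
  by (simp_all add: positions_expr_def blocks_expr_def wires_expr_def positions_def blocks_def)

definition radices :: "expr list" where
  "radices = [Plus positions_expr (Num 2), Num C, Plus blocks_expr (Num 1), Num K, Num 2, Num 18, Num 6, Num 2]"

definition matching_size_expr :: expr where
  "matching_size_expr = Plus (Times (Times positions_expr (Num C)) (Plus (Times (Num 47) wires_expr) (Num 1)))
     (Times (Num 4) wires_expr)"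

definition in_range :: "bool list \<Rightarrow> (nat \<Rightarrow> nat) \<Rightarrow> bool" where
  "in_range w \<rho> \<longleftrightarrow> radix_digits w radices 0 \<rho> \<and> radix_digits w radices 16 \<rho>"

lemma radices_closed: "\<forall>e\<in>set radices. var_bound e = 0"
  by (simp add: radices_def)

lemma digits_less:
  assumes "in_range w \<rho>" "f \<in> {0, 16}"
  shows "\<rho> f < positions w + 2" "\<rho> (f + 2) < C" "\<rho> (f + 4) < blocks w + 1" "\<rho> (f + 6) < K" "\<rho> (f + 8) < 2"
    "\<rho> (f + 10) < 18" "\<rho> (f + 12) < 6" "\<rho> (f + 14) < 2"
proof -
  have "radix_digits w radices f \<rho>" using assms by (auto simp: in_range_def)
  then show "\<rho> f < positions w + 2" "\<rho> (f + 2) < C" "\<rho> (f + 4) < blocks w + 1" "\<rho> (f + 6) < K" "\<rho> (f + 8) < 2"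
    "\<rho> (f + 10) < 18" "\<rho> (f + 12) < 6" "\<rho> (f + 14) < 2"
    by (simp_all add: radices_def radix_digits_Cons add.assoc del: add_2_eq_Suc add_2_eq_Suc')
qed

lemma radix_val_radices:
  "radix_val w radices f \<rho> = vertex w (\<rho> f) (\<rho> (f + 2)) (\<rho> (f + 4)) (\<rho> (f + 6)) (\<rho> (f + 8)) (\<rho> (f + 10)) (\<rho> (f + 12)) (\<rho> (f + 14))"
  by (simp add: radix_val_def radices_def vertex_def add.assoc del: add_2_eq_Suc add_2_eq_Suc')

lemma radix_range_radices: "radix_range w radices = (positions w + 2) * C * ((blocks w + 1) * K * 2) * 216"
proof -
  have "k * (c * (b * (a * (2 * (18 * (6 * (2 * 1))))))) = k * c * (b * a * 2) * 216" for a b c k :: nat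
    by simp
  then show ?thesis
    by (simp only: radix_range_def radices_def list.map prod_list.Nil prod_list.Cons val.simps val_exprs)
qed

lemma edge_at_radix_val:
  assumes "in_range w \<rho>" "f \<in> {0, 16}"
  shows "edge_at w (radix_val w radices f \<rho>) =
      (cell_point (val w \<rho> (row_expr C f)) (val w \<rho> (column_expr K f)) (6 * \<rho> (f + 10) + \<rho> (f + 12)), \<rho> (f + 14) = 1)"
    and "radix_val w radices f \<rho> < (positions w + 2) * C * ((blocks w + 1) * K * 2) * 216"
    and "edge_at w (radix_val w radices f \<rho>) \<in> E w \<longleftrightarrow>
      edge_on (kind w (val w \<rho> (row_expr C f)) (val w \<rho> (column_expr K f))) (6 * \<rho> (f + 10) + \<rho> (f + 12)) (\<rho> (f + 14) = 1)"
  using edge_at_vertex[OF digits_less[OF assms]]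
  unfolding radix_val_radices row_expr_def column_expr_def val.simps by simp_all

lemma branchable_digit:
  assumes "f \<in> {0, 16}" "i \<le> 14" "\<And>w \<rho>. in_range w \<rho> \<Longrightarrow> \<rho> (f + i) < n"
  shows "branchable 32 in_range (\<lambda>w \<rho>. \<rho> (f + i))"
proof -
  have "branchable 32 in_range (\<lambda>w \<rho>. val w \<rho> (Var (f + i)))"
    by (rule branchable_val) (use assms in auto)
  then show ?thesis by simp
qed

lemma branchable_digits:
  assumes f: "f \<in> {0, 16}"
  shows "branchable 32 in_range (\<lambda>w \<rho>. \<rho> (f + 2))" "branchable 32 in_range (\<lambda>w \<rho>. \<rho> (f + 6))"
    "branchable 32 in_range (\<lambda>w \<rho>. \<rho> (f + 10))" "branchable 32 in_range (\<lambda>w \<rho>. \<rho> (f + 12))"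
    "branchable 32 in_range (\<lambda>w \<rho>. \<rho> (f + 14))"
  by ((rule branchable_digit[OF f], simp), erule digits_less(2)[OF _ f])
    ((rule branchable_digit[OF f], simp), erule digits_less(4,6-8)[OF _ f])+

lemma branchable_input_class:
  assumes f: "f \<in> {0, 16}"
  shows "branchable 32 in_range (\<lambda>w \<rho>. input_class w (poly p (length w)) (\<rho> f))"
proof -
  have eq: "branchable 32 in_range (\<lambda>w \<rho>. \<rho> f = val w \<rho> e)" if "var_bound e = 0" for e
    using branchable_eq[of "Var f" 32 e in_range] f that by auto
  have symbol: "branchable 32 in_range (\<lambda>w \<rho>. val w \<rho> (Sym (Var f) (Plus bound (Num 1))))"
    by (rule branchable_val[where n = 3]) (use f bound_closed word_contents_less_3 in auto)
  have "branchable 32 in_range (\<lambda>w \<rho>. word_contents w (int (\<rho> f) - int (poly p (length w) + 1)))"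
    using symbol by (simp add: val_bound)
  moreover have "branchable 32 in_range (\<lambda>w \<rho>. \<rho> f = poly p (length w) + 1)"
    using eq[of "Plus bound (Num 1)"] by (simp add: bound_closed val_bound)
  moreover have "branchable 32 in_range (\<lambda>w \<rho>. \<rho> f = 1)" using eq[of "Num 1"] by simp
  moreover have "branchable 32 in_range (\<lambda>w \<rho>. \<rho> f = row_length (poly p (length w)))"
    using eq[of row_length_expr] by simp
  moreover have "branchable 32 in_range (\<lambda>w \<rho>. \<rho> f \<le> row_length (poly p (length w)))"
    using branchable_le[of "Var f" 32 row_length_expr in_range] f by auto
  ultimately show ?thesis unfolding input_class_def by (intro branchable_Pair)
qed

lemma branchable_entry:
  assumes f: "f \<in> {0, 16}"
  shows "branchable 32 in_range (\<lambda>w \<rho>. entry w (\<rho> f) (\<rho> (f + 2)) (\<rho> (f + 4)) (\<rho> (f + 6)))"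
proof -
  have digits: "branchable 32 in_range (\<lambda>w \<rho>. (\<rho> (f + 2), \<rho> (f + 6)))"
    by (intro branchable_Pair branchable_digits[OF f])
  have position: "branchable 32 in_range (\<lambda>w \<rho>. \<rho> (f + 4) = val w \<rho> e)" if "var_bound e \<le> 32" for e
    using branchable_eq[of "Var (f + 4)" 32 e in_range] f that by auto
  have "branchable 32 in_range (\<lambda>w \<rho>. \<rho> (f + 4) = \<rho> f)" using position[of "Var f"] f by auto
  moreover have "branchable 32 in_range (\<lambda>w \<rho>. \<rho> (f + 4) = \<rho> f + 1)"
    using position[of "Plus (Var f) (Num 1)"] f by auto
  moreover have "branchable 32 in_range (\<lambda>w \<rho>. \<rho> (f + 4) = \<rho> f + row_length (poly p (length w)))"
    using position[of "Plus (Var f) row_length_expr"] f by auto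
  moreover have "branchable 32 in_range (\<lambda>w \<rho>. A0 (input_class w (poly p (length w)) (\<rho> f)) (\<rho> (f + 2)) (\<rho> (f + 6)))"
    using branchable_map[OF branchable_Pair[OF branchable_input_class[OF f] digits], of "\<lambda>(c, t, a). A0 c t a"] by simp
  moreover have "branchable 32 in_range (\<lambda>w \<rho>. B (\<rho> (f + 2)) (\<rho> (f + 6)))" for B :: "nat \<Rightarrow> nat \<Rightarrow> bool"
    using branchable_map[OF digits, of "\<lambda>(t, a). B t a"] by simp
  ultimately show ?thesis unfolding entry_def by (intro branchable_disj branchable_conj)
qed

lemma branchable_kind:
  assumes f: "f \<in> {0, 16}"
  shows "branchable 32 in_range (\<lambda>w \<rho>. kind w (val w \<rho> (row_expr C f)) (val w \<rho> (column_expr K f)))"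
proof -
  have bounds: "var_bound (row_expr C f) \<le> 32" "var_bound (column_expr K f) \<le> 32"
    using f by (auto simp: row_expr_def column_expr_def)
  have less: "branchable 32 in_range (\<lambda>w \<rho>. val w \<rho> a < val w \<rho> b)"
    and eq: "branchable 32 in_range (\<lambda>w \<rho>. val w \<rho> a = val w \<rho> b)"
    if "var_bound a \<le> 32" "var_bound b \<le> 32" for a b
    using branchable_not[OF branchable_le[OF that(2,1), of in_range]] branchable_eq[OF that, of in_range]
    by (simp_all add: not_le)
  have row: "branchable 32 in_range (\<lambda>w \<rho>. C - 1 < val w \<rho> (row_expr C f))"
    "branchable 32 in_range (\<lambda>w \<rho>. val w \<rho> (row_expr C f) = C - 1)"
    "branchable 32 in_range (\<lambda>w \<rho>. val w \<rho> (row_expr C f) < (positions w + 1) * C)"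
    "branchable 32 in_range (\<lambda>w \<rho>. val w \<rho> (row_expr C f) = (positions w + 1) * C)"
    using less[of "Num (C - 1)"] less[of _ "Times (Plus positions_expr (Num 1)) (Num C)"] eq[of _ "Num (C - 1)"]
      eq[of _ "Times (Plus positions_expr (Num 1)) (Num C)"] bounds(1) by simp_all
  have column: "branchable 32 in_range (\<lambda>w \<rho>. val w \<rho> (column_expr K f) < wires w)"
    "branchable 32 in_range (\<lambda>w \<rho>. val w \<rho> (column_expr K f) = wires w)"
    using less[of _ wires_expr] eq[of _ wires_expr] bounds(2) by simp_all
  have s: "branchable 32 in_range (\<lambda>w \<rho>. \<rho> (f + 8) = 0)"
    using eq[of "Var (f + 8)" "Num 0"] f by auto
  have even: "branchable 32 in_range (\<lambda>w \<rho>. even (val w \<rho> (column_expr K f)))"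
  proof (rule branchable_cong[OF s])
    fix w \<rho> assume "in_range w \<rho>"
    then have "\<rho> (f + 8) = 0 \<or> \<rho> (f + 8) = 1" using digits_less(5)[OF _ f] by (simp add: less_2_cases_iff)
    then show "(\<rho> (f + 8) = 0) = even (val w \<rho> (column_expr K f))" by (auto simp: column_expr_def)
  qed
  have used: "branchable 32 in_range (\<lambda>w \<rho>. used w (val w \<rho> (row_expr C f)) (val w \<rho> (column_expr K f)))"
  proof (rule branchable_cong[OF branchable_conj[OF s branchable_entry[OF f]]])
    fix w \<rho> assume "in_range w \<rho>"
    from digits_less(2,4,5)[OF this f] used_digits[of "\<rho> (f + 2)" "\<rho> (f + 6)" "\<rho> (f + 8)" w "\<rho> f" "\<rho> (f + 4)"]
    show "(\<rho> (f + 8) = 0 \<and> entry w (\<rho> f) (\<rho> (f + 2)) (\<rho> (f + 4)) (\<rho> (f + 6))) =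
        used w (val w \<rho> (row_expr C f)) (val w \<rho> (column_expr K f))" by (simp add: row_expr_def column_expr_def)
  qed
  show ?thesis unfolding kind_def by (intro branchable_if branchable_conj branchable_const row column even used)
qed

lemma branchable_in_E:
  assumes f: "f \<in> {0, 16}"
  shows "branchable 32 in_range (\<lambda>w \<rho>. edge_at w (radix_val w radices f \<rho>) \<in> E w)"
proof -
  have "branchable 32 in_range (\<lambda>w \<rho>. (kind w (val w \<rho> (row_expr C f)) (val w \<rho> (column_expr K f)),
      \<rho> (f + 10), \<rho> (f + 12), \<rho> (f + 14)))"
    by (intro branchable_Pair branchable_kind[OF f] branchable_digits[OF f])
  from branchable_map[OF this, of "\<lambda>(t, y, x, d). edge_on t (6 * y + x) (d = 1)"]
  show ?thesis by (rule branchable_cong) (use edge_at_radix_val(3)[OF _ f] in simp)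
qed

lemma near_far_radix_val:
  assumes "in_range w \<rho>" "f \<in> {0, 16}"
  shows "near (edge_at w (radix_val w radices f \<rho>)) = coordinates w \<rho> (near_expr K C f)"
    "far (edge_at w (radix_val w radices f \<rho>)) = coordinates w \<rho> (far_expr K C f)"
proof -
  have "\<rho> (f + 12) < 6" "\<rho> (f + 14) = 0 \<or> \<rho> (f + 14) = 1"
    using digits_less(7,8)[OF assms] by (simp_all add: less_2_cases_iff)
  then show "near (edge_at w (radix_val w radices f \<rho>)) = coordinates w \<rho> (near_expr K C f)"
    "far (edge_at w (radix_val w radices f \<rho>)) = coordinates w \<rho> (far_expr K C f)"
    unfolding edge_at_radix_val(1)[OF assms]
    by (auto simp: near_def far_def right_of_def below_def cell_point_def coordinates_def near_expr_def far_expr_def)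
qed

lemma branchable_ends_meet:
  "branchable 32 in_range (\<lambda>w \<rho>. ends (edge_at w (radix_val w radices 0 \<rho>)) \<inter> ends (edge_at w (radix_val w radices 16 \<rho>)) \<noteq> {})"
proof -
  have "branchable 32 in_range (\<lambda>w \<rho>. coordinates w \<rho> a = coordinates w \<rho> b)"
    if "a \<in> {near_expr K C 0, far_expr K C 0}" "b \<in> {near_expr K C 16, far_expr K C 16}" for a b
    by (rule branchable_coordinates_eq)
      (use that in \<open>auto simp: near_expr_def far_expr_def row_expr_def column_expr_def\<close>)
  then have "branchable 32 in_range (\<lambda>w \<rho>.
      coordinates w \<rho> (near_expr K C 0) = coordinates w \<rho> (near_expr K C 16) \<or>
      coordinates w \<rho> (near_expr K C 0) = coordinates w \<rho> (far_expr K C 16) \<or>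
      coordinates w \<rho> (far_expr K C 0) = coordinates w \<rho> (near_expr K C 16) \<or>
      coordinates w \<rho> (far_expr K C 0) = coordinates w \<rho> (far_expr K C 16))"
    by (intro branchable_disj) simp_all
  then show ?thesis
  proof (rule branchable_cong)
    fix w \<rho> assume "in_range w \<rho>"
    then have range: "in_range w \<rho>" "0 \<in> {0, 16 :: nat}" "in_range w \<rho>" "16 \<in> {0, 16 :: nat}" by simp_all
    show "(coordinates w \<rho> (near_expr K C 0) = coordinates w \<rho> (near_expr K C 16) \<or>
        coordinates w \<rho> (near_expr K C 0) = coordinates w \<rho> (far_expr K C 16) \<or>
        coordinates w \<rho> (far_expr K C 0) = coordinates w \<rho> (near_expr K C 16) \<or>
        coordinates w \<rho> (far_expr K C 0) = coordinates w \<rho> (far_expr K C 16)) \<longleftrightarrow>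
        ends (edge_at w (radix_val w radices 0 \<rho>)) \<inter> ends (edge_at w (radix_val w radices 16 \<rho>)) \<noteq> {}"
      unfolding ends_meet_iff near_far_radix_val[OF range(1,2)] near_far_radix_val[OF range(3,4)] ..
  qed
qed

lemma branchable_adjacent:
  "branchable 32 in_range (\<lambda>w \<rho>. {radix_val w radices 0 \<rho>, radix_val w radices 16 \<rho>} \<in> edges (G w))"
proof -
  have "var_bound (radix_expr radices f (Num 0)) \<le> 32" if "f \<in> {0, 16}" for f
    using var_bound_radix_expr[OF radices_closed, of "Num 0" f] that by (auto simp: radices_def)
  then have "branchable 32 in_range (\<lambda>w \<rho>. radix_val w radices 0 \<rho> = radix_val w radices 16 \<rho>)"
    unfolding radix_val_def by (intro branchable_eq) simp_all
  then have "branchable 32 in_range (\<lambda>w \<rho>. \<not> radix_val w radices 0 \<rho> = radix_val w radices 16 \<rho> \<and>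
      edge_at w (radix_val w radices 0 \<rho>) \<in> E w \<and> edge_at w (radix_val w radices 16 \<rho>) \<in> E w \<and>
      ends (edge_at w (radix_val w radices 0 \<rho>)) \<inter> ends (edge_at w (radix_val w radices 16 \<rho>)) \<noteq> {})"
    by (intro branchable_conj branchable_not branchable_in_E branchable_ends_meet) simp_all
  then show ?thesis
    by (rule branchable_cong) (unfold edge_G_iff, use edge_at_radix_val(2) in blast)
qed

theorem polytime_computable_crossbar: "polytime_computable (\<lambda>w. encode_instance (G w, matching_size w))"
proof -
  have "polytime_computable (\<lambda>w. encode_instance (G w, const_val w matching_size_expr))"
  proof (rule polytime_computable_encode_instance)
    show "branchable (16 + 16) (\<lambda>w \<rho>. radix_digits w radices 0 \<rho> \<and> radix_digits w radices 16 \<rho>)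
        (\<lambda>w \<rho>. {radix_val w radices 0 \<rho>, radix_val w radices 16 \<rho>} \<in> edges (G w))"
      using branchable_adjacent by (simp add: in_range_def[abs_def])
    show "verts (G w) = {..<radix_range w radices}" for w unfolding radix_range_radices by (rule verts_G)
    show "var_bound matching_size_expr = 0" by (simp add: matching_size_expr_def)
    show "16 = 2 * length radices" by (simp add: radices_def)
  qed (rule radices_closed)
  moreover have "const_val w matching_size_expr = matching_size w" for w
    by (simp add: matching_size_expr_def matching_size_def)
  ultimately show ?thesis by simp
qed

lemma crossbar_instance:
  "(G w, matching_size w) \<in> {(G, k) \<in> acyclic_matching_instances. planar G \<and> is_line_graph G \<and> max_degree G = 4}"
  unfolding acyclic_matching_instances_def mem_Collect_eq case_prod_conv
  using simple_graph_G verts_G matching_size_pos planar_G is_line_graph_G max_degree_G_eq_4 by blast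

end

theorem theorem6:
  "NP_hard encode_instance
     {(G, k) \<in> acyclic_matching_instances. planar G \<and> is_line_graph G \<and> max_degree G = 4}
     has_acyclic_matching"
  unfolding NP_hard_def
proof
  fix L :: "bool list set" assume "L \<in> NP"
  then obtain K C A0 A1 A2 and p :: "nat poly" where pos: "1 \<le> K" "1 \<le> C" "\<And>n. 1 \<le> poly p n"
    and L: "\<And>w. w \<in> L \<longleftrightarrow> (\<exists>x. exact_cover K C (row_length (poly p (length w)))
      (\<lambda>b. A0 (input_class w (poly p (length w)) b)) A1 A2 x)" by (rule NP_exact_cover) blast
  obtain bound where bound: "var_bound bound = 0" "\<And>w \<rho>. val w \<rho> bound = poly p (length w)"
    using expr_of_poly[of p] by blast
  interpret crossbar_program K C A0 A1 A2 p bound by unfold_locales (use pos bound in auto)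
  have "w \<in> L \<longleftrightarrow> has_acyclic_matching (G w, matching_size w)" for w
    using L has_acyclic_matching_iff by simp
  then show "\<exists>f. polytime_computable f \<and> (\<forall>w. \<exists>i\<in>{(G, k) \<in> acyclic_matching_instances.
      planar G \<and> is_line_graph G \<and> max_degree G = 4}. f w = encode_instance i \<and> (w \<in> L \<longleftrightarrow> has_acyclic_matching i))"
    using polytime_computable_crossbar crossbar_instance
    by (intro exI[of _ "\<lambda>w. encode_instance (G w, matching_size w)"]) blast
qed

end
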